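(* (a) Let $0<\omega<\pi/2$. For every deterministic adaptive probing strategy that correctly determines every convex polygon all of whose internal angles are strictly larger than $\omega$, and for every integer $n\ge 5$, there exist a convex polygon $\mathcal{O}$ with $n$ vertices, all internal angles strictly larger than $\omega$, a point $p\in\mathcal{O}$ and a circle $\Psi$ enclosing $\mathcal{O}$, such that the strategy, run on $\mathcal{O}$ with data $p,\Psi$, makes at least $2n-2$ $\omega$-probes. (b) The same holds for $\omega=\pi/2$ with $2n-3$ in place of $2n-2$.
   Context: An $\omega$-wedge $\mathcal{W}(\omega,q,H_1,H_2)$ is the closed region formed by a point $q$ (the apex), two rays $H_1,H_2$ emanating from $q$ with angle $\omega$ between them such that $H_2$ is obtained from $H_1$ by a counterclockwise rotation by $\omega$, and all points between them. A valid $\omega$-probe of a convex polygon $\mathcal{O}$ with respect to a directed line $\overrightarrow{L}$ is an $\omega$-wedge containing $\mathcal{O}$, each of whose rays contains at least one point of $\mathcal{O}$, whose apex $q$ lies on $\overrightarrow{L}$, and such that the ray from $q$ in the direction of $\overrightarrow{L}$ intersects $\mathcal{O}$. Probing model: $\mathcal{O}$ is unknown to the prober, who knows only a point $p\in\mathcal{O}$ and a circle $\Psi$ with $\mathcal{O}$ contained in the disk bounded by $\Psi$ (the number $n$ of vertices is not known). One $\omega$-probe consists of the prober choosing a directed line $\overrightarrow{L}$; if a valid $\omega$-probe of $\mathcal{O}$ with respect to $\overrightarrow{L}$ exists, the prober receives its apex $q$, its rays $H_1,H_2$, and the points $p_1\in\mathcal{O}\cap H_1$, $p_2\in\mathcal{O}\cap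 H_2$ closest to $q$; otherwise the prober is told only that the probe missed $\mathcal{O}$. A strategy is adaptive: each chosen line may depend on all previous outcomes; it is deterministic and must output exactly $\mathcal{O}$ after its last probe. *)

theory Defs
  imports "HOL-Analysis.Analysis"
begin

definition vec_angle :: "complex \<Rightarrow> complex \<Rightarrow> real" where
  "vec_angle u w = arccos ((u \<bullet> w) / (norm u * norm w))"

(* P is a convex polygon with exactly n vertices, all internal angles > \<omega>.
   Vertices = extreme points; the internal angle at v is the angle between the
   two edges (1-dimensional faces [v,u], [v,w]) incident to v. *)
definition convex_polygon_angles_gt :: "real \<Rightarrow> complex set \<Rightarrow> nat \<Rightarrow> bool" where
  "convex_polygon_angles_gt \<omega> P n \<longleftrightarrow>
     polytope P \<and> aff_dim P = 2 \<and> card {v. v extreme_point_of P} = n \<and>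
     (\<forall>u v w. v extreme_point_of P \<and> u extreme_point_of P \<and> w extreme_point_of P \<and>
        u \<noteq> v \<and> w \<noteq> v \<and> u \<noteq> w \<and>
        closed_segment v u face_of P \<and> closed_segment v w face_of P
        \<longrightarrow> vec_angle (u - v) (w - v) > \<omega>)"

definition ray :: "complex \<Rightarrow> complex \<Rightarrow> complex set" where
  "ray q d = {q + of_real t * d | t. t \<ge> 0}"

definition wedge :: "real \<Rightarrow> complex \<Rightarrow> complex \<Rightarrow> complex set" where
  "wedge \<omega> q d1 = {q + of_real s * d1 + of_real t * (cis \<omega> * d1) | s t. s \<ge> 0 \<and> t \<ge> 0}"

(* a directed line: (point on it, nonzero direction) *)
type_synonym dline = "complex \<times> complex"

definition line_pts :: "dline \<Rightarrow> complex set" where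
  "line_pts L = {fst L + of_real t * snd L | t. True}"

definition valid_probe :: "real \<Rightarrow> complex set \<Rightarrow> dline \<Rightarrow> complex \<Rightarrow> complex \<Rightarrow> bool" where
  "valid_probe \<omega> K L q d1 \<longleftrightarrow>
     norm d1 = 1 \<and> K \<subseteq> wedge \<omega> q d1 \<and>
     ray q d1 \<inter> K \<noteq> {} \<and> ray q (cis \<omega> * d1) \<inter> K \<noteq> {} \<and>
     q \<in> line_pts L \<and> ray q (snd L) \<inter> K \<noteq> {}"

definition closest :: "complex set \<Rightarrow> complex \<Rightarrow> complex set \<Rightarrow> complex" where
  "closest K q H = (THE x. x \<in> K \<inter> H \<and> (\<forall>y \<in> K \<inter> H. dist q x \<le> dist q y))"

datatype outcome = Miss | Hit complex "complex set" "complex set" complex complex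

definition probe_result :: "real \<Rightarrow> complex set \<Rightarrow> dline \<Rightarrow> outcome" where
  "probe_result \<omega> K L =
    (if \<exists>q d1. valid_probe \<omega> K L q d1 then
       (let x = (THE x. valid_probe \<omega> K L (fst x) (snd x)); q = fst x; d1 = snd x
        in Hit q (ray q d1) (ray q (cis \<omega> * d1))
               (closest K q (ray q d1)) (closest K q (ray q (cis \<omega> * d1))))
     else Miss)"

(* deterministic adaptive strategy: given p, centre c and radius r of \<Psi>, and the
   history of outcomes so far, either probe a directed line (Inl) or stop and
   output a set (Inr). *)
type_synonym strategy = "complex \<Rightarrow> complex \<Rightarrow> real \<Rightarrow> outcome list \<Rightarrow> dline + complex set"

fun run :: "real \<Rightarrow> strategy \<Rightarrow> complex set \<Rightarrow> complex \<Rightarrow> complex \<Rightarrow> real \<Rightarrow> nat \<Rightarrow> outcome list" where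
  "run \<omega> \<sigma> K p c r 0 = []"
| "run \<omega> \<sigma> K p c r (Suc k) =
     (let h = run \<omega> \<sigma> K p c r k in
      case \<sigma> p c r h of Inl L \<Rightarrow> h @ [probe_result \<omega> K L] | Inr _ \<Rightarrow> h)"

definition determines :: "real \<Rightarrow> strategy \<Rightarrow> complex set \<Rightarrow> complex \<Rightarrow> complex \<Rightarrow> real \<Rightarrow> bool" where
  "determines \<omega> \<sigma> K p c r \<longleftrightarrow> (\<exists>k. \<sigma> p c r (run \<omega> \<sigma> K p c r k) = Inr K)"

definition correct_strategy :: "real \<Rightarrow> strategy \<Rightarrow> bool" where
  "correct_strategy \<omega> \<sigma> \<longleftrightarrow>
     (\<forall>P n p c r. convex_polygon_angles_gt \<omega> P n \<and> p \<in> P \<and> 0 < r \<and> P \<subseteq> cball c r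
        \<longrightarrow> determines \<omega> \<sigma> P p c r)"

definition makes_at_least :: "real \<Rightarrow> strategy \<Rightarrow> complex set \<Rightarrow> complex \<Rightarrow> complex \<Rightarrow> real \<Rightarrow> nat \<Rightarrow> bool" where
  "makes_at_least \<omega> \<sigma> K p c r m \<longleftrightarrow> (\<forall>k < m. isl (\<sigma> p c r (run \<omega> \<sigma> K p c r k)))"

end

theory Submission
  imports Defs
begin

text \<open>
  An adversary argument. A polygon can only be recognised once every edge has lain along a ray of some
  probe: if the edge \<open>ab\<close> has never been touched, a new vertex just beyond its midpoint leaves all
  answers unchanged. When no two edges enclose the angle \<open>\<omega>\<close>, one probe touches at most one
  edge. So a generic polygon with \<open>n\<close> vertices whose first \<open>N\<close> probes touch no edge costs at
  least \<open>N + n\<close> probes. The adversary raises \<open>n\<close> and \<open>N\<close> together: whenever a probe touches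
  an edge, a generic new vertex just beyond that edge makes the probe, and all earlier ones, touch no
  edge of the larger polygon. It starts from a square (\<open>\<omega> < \<pi>/2\<close>) or a pentagon
  (\<open>\<omega> = \<pi>/2\<close>) whose first two probes touch no edge. The first answer, if not a miss, names
  two non-adjacent vertices; the other vertices can then be moved into generic position with respect to
  the second line without changing that answer.
\<close>

section \<open>Cross products and wedges\<close>

text \<open>Every insertion adds one probe that touches nothing and one more edge to be found. A
  start with \<open>k\<close> vertices and two such probes therefore yields
  \<open>2 + (n - k) + n\<close>, so \<open>k\<close> decides the constant. The angles of a
  quadrilateral sum to four right angles, which rules out \<open>k = 4\<close> at
  \<open>\<omega> = pi / 2\<close>. Bad places for a new vertex lie on finitely many lines, a null
  set, while the places just beyond the midpoint of an edge form a nonempty open set. Open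
  conditions are therefore stated as holding near the midpoint, generic ones as avoiding a null set.
  One obstacle resists this: for an edge lying on the probing line the apex is not confined to
  finitely many points. Such an edge is touched by every valid probe, so none is left once a
  different edge is known to be touched; for the second probe all vertices but two, which do not
  form an edge, are moved off the line. All of this presupposes that a line determines its answer:
  the valid probe is unique because every internal angle exceeds
  \<open>\<omega> \<le> pi / 2\<close>, and it exists as soon as the line meets the polygon.\<close>

definition cr :: "complex \<Rightarrow> complex \<Rightarrow> real" where
  "cr u w = Re u * Im w - Im u * Re w"

lemma cr_self [simp]: "cr u u = 0"
  by (simp add: cr_def)

lemma cr_zero [simp]: "cr 0 w = 0" "cr u 0 = 0"
  by (simp_all add: cr_def)

lemma cr_add: "cr (u + v) w = cr u w + cr v w" "cr u (v + w) = cr u v + cr u w"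
  by (simp_all add: cr_def algebra_simps)

lemma cr_diff: "cr (u - v) w = cr u w - cr v w" "cr u (v - w) = cr u v - cr u w"
  by (simp_all add: cr_def algebra_simps)

lemma cr_minus: "cr (- u) w = - cr u w" "cr u (- w) = - cr u w"
  by (simp_all add: cr_def)

lemma cr_of_real: "cr (of_real s * u) w = s * cr u w" "cr u (of_real s * w) = s * cr u w"
  by (simp_all add: cr_def algebra_simps)

lemma cr_scaleR: "cr (s *\<^sub>R u) w = s * cr u w" "cr u (s *\<^sub>R w) = s * cr u w"
  by (simp_all add: cr_def algebra_simps)

lemma cr_swap: "cr w u = - cr u w"
  by (simp add: cr_def)

lemma cr_mult_left: "cr (k * u) (k * w) = (norm k)\<^sup>2 * cr u w"
  unfolding cmod_power2 by (simp add: cr_def power2_eq_square algebra_simps)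

lemma inner_mult_left_complex: "(k * u) \<bullet> (k * w) = (norm k)\<^sup>2 * (u \<bullet> w)" for k u w :: complex
  unfolding cmod_power2 by (simp add: inner_complex_def power2_eq_square algebra_simps)

lemma cr_cis_self: "cr u (cis \<omega> * u) = (norm u)\<^sup>2 * sin \<omega>" "cr (cis \<omega> * u) u = - (norm u)\<^sup>2 * sin \<omega>"
  unfolding cmod_power2 by (simp_all add: cr_def power2_eq_square algebra_simps)

lemma inner_cr_norm: "(u \<bullet> w)\<^sup>2 + (cr u w)\<^sup>2 = (norm u)\<^sup>2 * (norm w)\<^sup>2"
  unfolding cmod_power2 by (simp add: cr_def inner_complex_def power2_eq_square algebra_simps)

lemma tendsto_cr [tendsto_intros]:
  "(f \<longlongrightarrow> a) F \<Longrightarrow> (g \<longlongrightarrow> b) F \<Longrightarrow> ((\<lambda>x. cr (f x) (g x)) \<longlongrightarrow> cr a b) F"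
  unfolding cr_def by (intro tendsto_intros)

lemma cr_eq_0_cases:
  assumes "cr u w = 0" "u \<noteq> 0"
  obtains t where "w = of_real t * u"
proof
  have n: "(Re u)\<^sup>2 + (Im u)\<^sup>2 \<noteq> 0"
    using assms(2) by (simp add: complex_eq_iff sum_power2_eq_zero_iff)
  show "w = of_real ((u \<bullet> w) / ((Re u)\<^sup>2 + (Im u)\<^sup>2)) * u"
    using assms(1) n unfolding complex_eq_iff
    by (simp add: cr_def inner_complex_def field_simps) (simp add: power2_eq_square algebra_simps)
qed

lemma convex_cr_ge: "convex {x. c \<le> cr u (x - q)}" "convex {x. c \<le> cr (x - q) u}"
proof -
  have "{x. c \<le> cr u (x - q)} = {x. (Complex (- Im u) (Re u)) \<bullet> x \<ge> c + cr u q}"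
    by (auto simp: cr_def inner_complex_def algebra_simps)
  then show "convex {x. c \<le> cr u (x - q)}" by (simp add: convex_halfspace_ge)
  have "{x. c \<le> cr (x - q) u} = {x. (Complex (Im u) (- Re u)) \<bullet> x \<ge> c + cr q u}"
    by (auto simp: cr_def inner_complex_def algebra_simps)
  then show "convex {x. c \<le> cr (x - q) u}" by (simp add: convex_halfspace_ge)
qed

lemma convex_cr_gt: "convex {x. c < cr u (x - q)}"
proof -
  have "{x. c < cr u (x - q)} = {x. (Complex (- Im u) (Re u)) \<bullet> x > c + cr u q}"
    by (auto simp: cr_def inner_complex_def algebra_simps)
  then show ?thesis by (simp add: convex_halfspace_gt)
qed

lemma negligible_cr_line:
  assumes "u \<noteq> 0"
  shows "negligible {x. cr u (x - p) = 0}"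
proof -
  have "{x. cr u (x - p) = 0} = {x. (Complex (- Im u) (Re u)) \<bullet> x = cr u p}"
    by (auto simp: cr_def inner_complex_def algebra_simps)
  moreover have "Complex (- Im u) (Re u) \<noteq> 0"
    using assms by (auto simp: complex_eq_iff)
  ultimately show ?thesis by (simp add: negligible_hyperplane)
qed

lemma cr_hull_ge:
  assumes "\<And>v. v \<in> V \<Longrightarrow> 0 \<le> cr u (v - q)" "x \<in> convex hull V"
  shows "0 \<le> cr u (x - q)"
proof -
  have "convex hull V \<subseteq> {x. 0 \<le> cr u (x - q)}"
    using assms(1) by (intro hull_minimal convex_cr_ge) auto
  then show ?thesis using assms(2) by auto
qed

lemma cr_hull_gt:
  assumes "\<And>v. v \<in> V \<Longrightarrow> 0 < cr u (v - q)" "x \<in> convex hull V"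
  shows "0 < cr u (x - q)"
proof -
  have "convex hull V \<subseteq> {x. 0 < cr u (x - q)}"
    using assms(1) by (intro hull_minimal convex_cr_gt) auto
  then show ?thesis using assms(2) by auto
qed

text \<open>A convex combination of nonnegative values vanishes only if all vertices of positive
  weight have value zero. Contacts of a ray with the polygon thus depend only on the vertices on
  that ray, which is why adding a vertex elsewhere in the wedge does not change an answer.\<close>

lemma hull_cr_face:
  assumes "finite V" "\<And>v. v \<in> V \<Longrightarrow> 0 \<le> cr u (v - q)"
    and x: "x \<in> convex hull V" "cr u (x - q) = 0"
  shows "x \<in> convex hull {v \<in> V. cr u (v - q) = 0}"
proof -
  obtain l where l: "\<And>v. v \<in> V \<Longrightarrow> 0 \<le> l v" "sum l V = 1" "(\<Sum>v\<in>V. l v *\<^sub>R v) = x"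
    using x(1) unfolding convex_hull_finite[OF assms(1)] by auto
  have lin: "cr u (\<Sum>v\<in>W. l v *\<^sub>R v) = (\<Sum>v\<in>W. l v * cr u v)" if "finite W" for W
    using that by (induction W rule: finite_induct) (simp_all add: cr_add cr_scaleR)
  have "(\<Sum>v\<in>V. l v * cr u (v - q)) = cr u x - sum l V * cr u q"
    unfolding cr_diff right_diff_distrib sum_subtractf sum_distrib_right
    using lin[OF assms(1)] l(3) by simp
  also have "\<dots> = 0" using l(2) x(2) by (simp add: cr_diff)
  finally have z: "l v * cr u (v - q) = 0" if "v \<in> V" for v
    using sum_nonneg_eq_0_iff[OF assms(1), of "\<lambda>v. l v * cr u (v - q)"] l(1) assms(2) that by simp
  let ?W = "{v \<in> V. cr u (v - q) = 0}"
  have fW: "finite ?W" using assms(1) by simp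
  have "sum l ?W = sum l V"
    by (rule sum.mono_neutral_left) (use assms(1) z in auto)
  moreover have "(\<Sum>v\<in>?W. l v *\<^sub>R v) = (\<Sum>v\<in>V. l v *\<^sub>R v)"
    by (rule sum.mono_neutral_left) (use assms(1) z in auto)
  ultimately show ?thesis
    unfolding convex_hull_finite[OF fW] using l by auto
qed

section \<open>Oblique coordinates along the two rays of a wedge\<close>

locale wedge_angle =
  fixes \<omega> :: real
  assumes pos: "0 < \<omega>" and le: "\<omega> \<le> pi / 2"
begin

lemma sin_pos: "0 < sin \<omega>"
  using pos le pi_gt_zero by (intro sin_gt_zero) linarith+

lemma cos_nonneg: "0 \<le> cos \<omega>"
  using pos le by (intro cos_ge_zero) auto

lemma cos_less_1: "cos \<omega> < 1"
  using pos le pi_gt_zero cos_monotone_0_pi[of 0 \<omega>] by simp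

lemma cr_frame: "norm d = 1 \<Longrightarrow> cr d (cis \<omega> * d) = sin \<omega>"
  by (simp add: cr_cis_self)

text \<open>Cramer's rule in the basis \<open>d\<close>, \<open>cis \<omega> * d\<close>, whose
  determinant is \<open>sin \<omega>\<close>. It turns membership in wedges and rays into sign
  conditions on two linear functionals.\<close>

lemma frame_decomp:
  assumes "norm d = 1"
  shows "y = of_real (cr y (cis \<omega> * d) / sin \<omega>) * d + of_real (cr d y / sin \<omega>) * (cis \<omega> * d)"
proof -
  have n: "Re d * Re d + Im d * Im d = 1"
    using assms cmod_power2[of d] by (simp add: power2_eq_square)
  have *: "a * (Re d * Re d) + a * (Im d * Im d) = a" for a
    using n by (metis distrib_left mult.right_neutral)
  have "of_real (sin \<omega>) * y = of_real (cr y (cis \<omega> * d)) * d + of_real (cr d y) * (cis \<omega> * d)"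
    unfolding complex_eq_iff cr_def
    using *[of "Re y * sin \<omega>"] *[of "Im y * sin \<omega>"]  by (auto simp: algebra_simps)
  then show ?thesis using sin_pos by (simp add: field_simps)
qed

lemma wedge_iff:
  assumes "norm d = 1"
  shows "x \<in> wedge \<omega> q d \<longleftrightarrow> 0 \<le> cr d (x - q) \<and> 0 \<le> cr (x - q) (cis \<omega> * d)"
proof
  assume "x \<in> wedge \<omega> q d"
  then obtain s t where st: "x = q + of_real s * d + of_real t * (cis \<omega> * d)" "s \<ge> 0" "t \<ge> 0"
    by (auto simp: wedge_def)
  then have "x - q = of_real s * d + of_real t * (cis \<omega> * d)" by simp
  then show "0 \<le> cr d (x - q) \<and> 0 \<le> cr (x - q) (cis \<omega> * d)"
    using st(2,3) sin_pos cr_frame[OF assms] by (simp add: cr_add cr_of_real)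
next
  assume a: "0 \<le> cr d (x - q) \<and> 0 \<le> cr (x - q) (cis \<omega> * d)"
  show "x \<in> wedge \<omega> q d"
    unfolding wedge_def mem_Collect_eq
  proof (intro exI conjI)
    show "x = q + of_real (cr (x - q) (cis \<omega> * d) / sin \<omega>) * d
              + of_real (cr d (x - q) / sin \<omega>) * (cis \<omega> * d)"
      using frame_decomp[OF assms, of "x - q"] by (simp add: algebra_simps)
  qed (use a sin_pos in auto)
qed

lemma ray1_iff:
  assumes "norm d = 1"
  shows "x \<in> ray q d \<longleftrightarrow> cr d (x - q) = 0 \<and> 0 \<le> cr (x - q) (cis \<omega> * d)"
proof
  assume "x \<in> ray q d"
  then obtain t where "x = q + of_real t * d" "t \<ge> 0" by (auto simp: ray_def)
  then show "cr d (x - q) = 0 \<and> 0 \<le> cr (x - q) (cis \<omega> * d)"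
    using sin_pos cr_frame[OF assms] by (simp add: cr_of_real)
next
  assume a: "cr d (x - q) = 0 \<and> 0 \<le> cr (x - q) (cis \<omega> * d)"
  show "x \<in> ray q d"
    unfolding ray_def mem_Collect_eq
  proof (intro exI conjI)
    show "x = q + of_real (cr (x - q) (cis \<omega> * d) / sin \<omega>) * d"
      using frame_decomp[OF assms, of "x - q"] a by (simp add: algebra_simps)
  qed (use a sin_pos in auto)
qed

lemma ray2_iff:
  assumes "norm d = 1"
  shows "x \<in> ray q (cis \<omega> * d) \<longleftrightarrow> cr (x - q) (cis \<omega> * d) = 0 \<and> 0 \<le> cr d (x - q)"
proof
  assume "x \<in> ray q (cis \<omega> * d)"
  then obtain t where "x = q + of_real t * (cis \<omega> * d)" "t \<ge> 0" by (auto simp: ray_def)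
  then show "cr (x - q) (cis \<omega> * d) = 0 \<and> 0 \<le> cr d (x - q)"
    using sin_pos cr_frame[OF assms] by (simp add: cr_of_real)
next
  assume a: "cr (x - q) (cis \<omega> * d) = 0 \<and> 0 \<le> cr d (x - q)"
  show "x \<in> ray q (cis \<omega> * d)"
    unfolding ray_def mem_Collect_eq
  proof (intro exI conjI)
    show "x = q + of_real (cr d (x - q) / sin \<omega>) * (cis \<omega> * d)"
      using frame_decomp[OF assms, of "x - q"] a by (simp add: algebra_simps)
  qed (use a sin_pos in auto)
qed

lemma cone_pointed:
  assumes d: "norm d = 1" and "0 \<le> cr d y" "0 \<le> cr y (cis \<omega> * d)"
    and "0 \<le> cr d (of_real t * y)" "0 \<le> cr (of_real t * y) (cis \<omega> * d)" "y \<noteq> 0"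
  shows "0 \<le> t"
proof (rule ccontr)
  assume "\<not> 0 \<le> t"
  then have "cr d y = 0" "cr y (cis \<omega> * d) = 0"
    using assms by (auto simp: cr_of_real zero_le_mult_iff)
  then have "y = 0" using frame_decomp[OF d, of y] by simp
  then show False using assms by simp
qed

lemma inner_frame:
  assumes d: "norm d = 1"
  shows "(of_real s * d + of_real t * (cis \<omega> * d)) \<bullet> (of_real s' * d + of_real t' * (cis \<omega> * d))
    = s * s' + t * t' + (s * t' + t * s') * cos \<omega>"
proof -
  let ?e = "cis \<omega> * d"
  have n: "(Re d)\<^sup>2 + (Im d)\<^sup>2 = 1" using d cmod_power2[of d] by simp
  have dd: "d \<bullet> d = 1" "?e \<bullet> ?e = 1" using d by (simp_all add: norm_mult dot_square_norm)
  have de: "d \<bullet> ?e = cos \<omega>" "?e \<bullet> d = cos \<omega>"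
  proof -
    have "d \<bullet> ?e = cos \<omega> * ((Re d)\<^sup>2 + (Im d)\<^sup>2)"
      by (simp add: inner_complex_def power2_eq_square algebra_simps)
    then show "d \<bullet> ?e = cos \<omega>" "?e \<bullet> d = cos \<omega>" using n by (simp_all add: inner_commute)
  qed
  have sc: "of_real r * z = r *\<^sub>R z" for r and z :: complex by (simp add: scaleR_conv_of_real)
  show ?thesis
    unfolding sc inner_add_left inner_add_right inner_scaleR_left inner_scaleR_right dd de
    by (simp add: algebra_simps)
qed

text \<open>In cone coordinates the cross product is a difference of two nonnegative products, and
  their sum enters the inner product with weight \<open>cos \<omega>\<close>. The first bound is
  "tangent of the enclosed angle at most \<open>tan \<omega>\<close>", cleared of denominators so as
  to cover \<open>\<omega> = pi / 2\<close>.\<close>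

lemma cone_inner_ge:
  assumes d: "norm d = 1"
    and u: "0 \<le> cr d u" "0 \<le> cr u (cis \<omega> * d)"
    and w: "0 \<le> cr d w" "0 \<le> cr w (cis \<omega> * d)"
  shows "cos \<omega> * \<bar>cr u w\<bar> \<le> sin \<omega> * (u \<bullet> w)" and "0 \<le> u \<bullet> w"
proof -
  let ?e = "cis \<omega> * d"
  obtain s t where u': "u = of_real s * d + of_real t * ?e" "0 \<le> s" "0 \<le> t"
    using frame_decomp[OF d, of u] u sin_pos divide_nonneg_pos by metis
  obtain s' t' where w': "w = of_real s' * d + of_real t' * ?e" "0 \<le> s'" "0 \<le> t'"
    using frame_decomp[OF d, of w] w sin_pos divide_nonneg_pos by metis
  have dot: "u \<bullet> w = s * s' + t * t' + (s * t' + t * s') * cos \<omega>"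
    unfolding u' w' by (rule inner_frame[OF d])
  have crs: "cr u w = (s * t' - t * s') * sin \<omega>"
    unfolding u' w' cr_add cr_of_real cr_self cr_frame[OF d] cr_swap[of ?e d]
    by (simp add: left_diff_distrib)
  have nn: "0 \<le> s * s'" "0 \<le> t * t'" "0 \<le> s * t'" "0 \<le> t * s'" using u' w' by simp_all
  show "0 \<le> u \<bullet> w" unfolding dot using nn cos_nonneg by simp
  have "\<bar>cr u w\<bar> = \<bar>s * t' - t * s'\<bar> * sin \<omega>" unfolding crs using sin_pos by (simp add: abs_mult)
  also have "\<dots> \<le> (s * t' + t * s') * sin \<omega>" using nn sin_pos by (intro mult_right_mono) auto
  finally have "cos \<omega> * \<bar>cr u w\<bar> \<le> cos \<omega> * ((s * t' + t * s') * sin \<omega>)"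
    using cos_nonneg by (intro mult_left_mono)
  also have "\<dots> \<le> sin \<omega> * (u \<bullet> w)"
    unfolding dot using mult_nonneg_nonneg[OF add_nonneg_nonneg[OF nn(1,2)], of "sin \<omega>"] sin_pos
    by (simp add: algebra_simps)
  finally show "cos \<omega> * \<bar>cr u w\<bar> \<le> sin \<omega> * (u \<bullet> w)" .
qed

text \<open>Squaring the previous bound and applying Lagrange's identity
  \<open>inner_cr_norm\<close> trades the cross product for norms. This is the form that contradicts
  the angle condition of \<open>convex_gon\<close> at an apex.\<close>

lemma cone_inner_norm_ge:
  assumes d: "norm d = 1"
    and u: "0 \<le> cr d u" "0 \<le> cr u (cis \<omega> * d)"
    and w: "0 \<le> cr d w" "0 \<le> cr w (cis \<omega> * d)"
  shows "cos \<omega> * (norm u * norm w) \<le> u \<bullet> w"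
proof (rule power2_le_imp_le)
  note c = cone_inner_ge[OF assms]
  have "(cos \<omega> * \<bar>cr u w\<bar>)\<^sup>2 \<le> (sin \<omega> * (u \<bullet> w))\<^sup>2"
    using c(1) cos_nonneg by (intro power_mono) auto
  then have "(cos \<omega>)\<^sup>2 * (cr u w)\<^sup>2 \<le> (sin \<omega>)\<^sup>2 * (u \<bullet> w)\<^sup>2" by (simp add: power_mult_distrib)
  then have "(cos \<omega>)\<^sup>2 * ((u \<bullet> w)\<^sup>2 + (cr u w)\<^sup>2) \<le> ((sin \<omega>)\<^sup>2 + (cos \<omega>)\<^sup>2) * (u \<bullet> w)\<^sup>2"
    by (simp only: distrib_left distrib_right)
  then show "(cos \<omega> * (norm u * norm w))\<^sup>2 \<le> (u \<bullet> w)\<^sup>2"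
    unfolding inner_cr_norm by (simp add: power_mult_distrib)
  show "0 \<le> u \<bullet> w" by (rule c(2))
qed

end

text \<open>With contacts at distances \<open>s\<close>, \<open>t\<close> from an apex and probing direction \<open>(\<alpha>, \<beta>)\<close>, a second
  apex at distance \<open>\<tau>\<close> further along the line sees the contacts under too large an angle, unless it
  is itself one of them.\<close>

lemma nested_apex_inequality:
  fixes s t \<tau> \<alpha> \<beta> C :: real
  assumes st: "0 < s" "0 < t" "0 < \<tau>" "0 \<le> \<alpha>" "0 \<le> \<beta>" "0 < \<alpha> + \<beta>" "0 \<le> C" "C < 1"
    and a: "\<tau> * (s * \<beta> + t * \<alpha>) \<le> s * t"
    and b: "s * \<alpha> + t * \<beta> \<le> \<tau> * (\<alpha>\<^sup>2 + \<beta>\<^sup>2 + 2 * \<alpha> * \<beta> * C)"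
  shows "\<beta> = 0 \<and> \<tau> * \<alpha> = s \<or> \<alpha> = 0 \<and> \<tau> * \<beta> = t"
proof -
  \<comment> \<open>Coordinates of the second apex in units of the contact distances:
    \<open>X + Y \<le> 1\<close> says that it does not pass the chord between the contacts.\<close>
  define X Y where "X = \<tau> * \<alpha> / s" and "Y = \<tau> * \<beta> / t"
  have al: "\<tau> * \<alpha> = s * X" and be: "\<tau> * \<beta> = t * Y" using st by (simp_all add: X_def Y_def)
  have nn: "0 \<le> X" "0 \<le> Y" using st by (simp_all add: X_def Y_def)
  have "s * t * (X + Y) = s * (t * Y) + t * (s * X)" by (simp add: algebra_simps)
  also have "\<dots> = \<tau> * (s * \<beta> + t * \<alpha>)" unfolding al[symmetric] be[symmetric] by (simp add: algebra_simps)
  finally have "s * t * (X + Y) \<le> s * t * 1" using a by simp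
  then have XY: "X + Y \<le> 1" using st by (simp del: mult.right_neutral)
  have "\<tau> * (s * \<alpha> + t * \<beta>) \<le> \<tau> * (\<tau> * (\<alpha>\<^sup>2 + \<beta>\<^sup>2 + 2 * \<alpha> * \<beta> * C))"
    using b st by (intro mult_left_mono) auto
  also have "\<dots> = (\<tau> * \<alpha>)\<^sup>2 + (\<tau> * \<beta>)\<^sup>2 + 2 * (\<tau> * \<alpha>) * (\<tau> * \<beta>) * C"
    by (simp add: power2_eq_square algebra_simps)
  also have "\<tau> * (s * \<alpha> + t * \<beta>) = s * (\<tau> * \<alpha>) + t * (\<tau> * \<beta>)" by (simp add: algebra_simps)
  finally have m: "s\<^sup>2 * X + t\<^sup>2 * Y \<le> s\<^sup>2 * X\<^sup>2 + t\<^sup>2 * Y\<^sup>2 + 2 * (s * t) * (X * Y) * C"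
    unfolding al be by (simp add: power2_eq_square algebra_simps)
  \<comment> \<open>As \<open>X + Y \<le> 1\<close>, both \<open>X * (1 - X)\<close> and
    \<open>Y * (1 - Y)\<close> are at least \<open>X * Y\<close>, so \<open>m\<close> becomes
    \<open>(s\<^sup>2 + t\<^sup>2) * X * Y \<le> 2 * s * t * X * Y * C\<close>. Since
    \<open>2 * s * t \<le> s\<^sup>2 + t\<^sup>2\<close> and \<open>C < 1\<close>, one of
    \<open>X\<close>, \<open>Y\<close> vanishes.\<close>
  have e1: "s\<^sup>2 * (X * Y) \<le> s\<^sup>2 * (X * (1 - X))" and e2: "t\<^sup>2 * (X * Y) \<le> t\<^sup>2 * (Y * (1 - Y))"
    by (intro mult_left_mono; use nn XY mult_left_mono[of Y "1 - X" X]
        mult_left_mono[of X "1 - Y" Y] in \<open>simp add: mult.commute\<close>)+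
  have "(s\<^sup>2 + t\<^sup>2) * (X * Y) \<le> 2 * (s * t) * (X * Y) * C"
    using m e1 e2 by (simp add: power2_eq_square algebra_simps)
  moreover have "2 * (s * t) * (X * Y) \<le> (s\<^sup>2 + t\<^sup>2) * (X * Y)"
    using nn sum_squares_bound[of s t] by (intro mult_right_mono) (auto simp: algebra_simps)
  ultimately have "2 * (s * t) * (X * Y) * (1 - C) \<le> 0" by (simp add: algebra_simps)
  moreover have "0 \<le> X * Y" using nn by simp
  ultimately have z: "X * Y = 0"
    using st by (smt (verit, best) mult_pos_pos mult_less_0_iff)
  have ab: "X > 0 \<or> Y > 0" using st al be nn
    by (metis add.right_neutral less_eq_real_def mult_eq_0_iff mult_zero_right not_less_iff_gr_or_eq)
  show ?thesis
  proof (cases "Y = 0")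
    case True
    then have X: "X > 0" using ab by simp
    have "s\<^sup>2 * X \<le> s\<^sup>2 * X\<^sup>2" using m True by simp
    then have "X \<le> X * X" using st by (simp add: power2_eq_square)
    then have "X = 1" using X XY True by (smt (verit) mult_le_cancel_right1 mult_cancel_right1)
    then show ?thesis using True al be st by auto
  next
    case False
    then have "X = 0" using z by simp
    have "t\<^sup>2 * Y \<le> t\<^sup>2 * Y\<^sup>2" using m \<open>X = 0\<close> by simp
    then have "Y \<le> Y * Y" using st by (simp add: power2_eq_square)
    then have "Y = 1" using False nn XY \<open>X = 0\<close> by (smt (verit) mult_le_cancel_right1 mult_cancel_right1)
    then show ?thesis using \<open>X = 0\<close> al be st by auto
  qed
qed


section \<open>Uniqueness and existence of the valid probe\<close>

definition edge :: "complex set \<Rightarrow> complex \<Rightarrow> complex \<Rightarrow> bool" where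
  "edge V a b \<longleftrightarrow> a \<in> V \<and> b \<in> V \<and> a \<noteq> b \<and> (\<forall>v\<in>V. v \<noteq> a \<and> v \<noteq> b \<longrightarrow> 0 < cr (b - a) (v - a))"

text \<open>Predecessor and successor stand in for the faces of the hull, and the angle is compared
  through its cosine. Everything is thereby a finite set of strict inequalities between vertices,
  which small moves preserve.\<close>

definition convex_gon :: "real \<Rightarrow> complex set \<Rightarrow> bool" where
  "convex_gon \<omega> V \<longleftrightarrow> finite V \<and> 3 \<le> card V \<and>
     (\<forall>v\<in>V. \<exists>a b. edge V a v \<and> edge V v b \<and>
        (a - v) \<bullet> (b - v) < cos \<omega> * (norm (a - v) * norm (b - v)))"

lemma edgeD:
  assumes "edge V a b"
  shows "a \<in> V" "b \<in> V" "a \<noteq> b" "v \<in> V \<Longrightarrow> v \<noteq> a \<Longrightarrow> v \<noteq> b \<Longrightarrow> 0 < cr (b - a) (v - a)"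
  using assms by (auto simp: edge_def)

lemma edge_nonneg: "edge V a b \<Longrightarrow> v \<in> V \<Longrightarrow> 0 \<le> cr (b - a) (v - a)"
  by (metis cr_self cr_zero(2) diff_self edgeD(4) order.order_iff_strict)

lemma edge_eq_0: "edge V a b \<Longrightarrow> v \<in> V \<Longrightarrow> cr (b - a) (v - a) = 0 \<Longrightarrow> v = a \<or> v = b"
  by (metis edgeD(4) less_irrefl)

lemma edge_out_unique: "edge V a b \<Longrightarrow> edge V a c \<Longrightarrow> b = c"
  by (metis cr_swap edge_def less_minus_iff neg_0_less_iff_less not_less_iff_gr_or_eq)

lemma edge_in_unique: "edge V a c \<Longrightarrow> edge V b c \<Longrightarrow> a = b"
proof (rule ccontr)
  assume e: "edge V a c" "edge V b c" and "a \<noteq> b"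
  have "0 < cr (c - a) (b - a)" using edgeD(4)[OF e(1), of b] edgeD[OF e(2)] \<open>a \<noteq> b\<close> by simp
  moreover have "0 < cr (c - b) (a - b)" using edgeD(4)[OF e(2), of a] edgeD[OF e(1)] \<open>a \<noteq> b\<close> by simp
  moreover have "cr (c - b) (a - b) = - cr (c - a) (b - a)" by (simp add: cr_def algebra_simps)
  ultimately show False by simp
qed

lemma convex_gonD:
  assumes "convex_gon \<omega> V"
  shows "finite V" "3 \<le> card V" "V \<noteq> {}"
    "v \<in> V \<Longrightarrow> \<exists>a b. edge V a v \<and> edge V v b \<and>
        (a - v) \<bullet> (b - v) < cos \<omega> * (norm (a - v) * norm (b - v))"
  using assms by (auto simp: convex_gon_def)

lemma third_vertex:
  assumes "finite V" "3 \<le> card V"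
  obtains v where "v \<in> V" "v \<noteq> a" "v \<noteq> b"
proof -
  have "card {a, b} < card V" using assms by (simp add: card_insert_if)
  then have "\<not> V \<subseteq> {a, b}" using card_mono[of "{a, b}" V] by auto
  then show ?thesis using that by auto
qed

lemma edge_asym:
  assumes "convex_gon \<omega> V" "edge V a b"
  shows "\<not> edge V b a"
proof
  assume "edge V b a"
  obtain v where v: "v \<in> V" "v \<noteq> a" "v \<noteq> b" using third_vertex convex_gonD assms(1) by metis
  have "0 < cr (b - a) (v - a)" "0 < cr (a - b) (v - b)"
    using edgeD(4)[OF assms(2) v(1)] edgeD(4)[OF \<open>edge V b a\<close> v(1)] v by auto
  moreover have "cr (a - b) (v - b) = - cr (b - a) (v - a)" by (simp add: cr_def algebra_simps)
  ultimately show False by simp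
qed

lemma convex_wedge_ineq: "convex {x. 0 \<le> cr u (x - q) \<and> 0 \<le> cr (x - q) w}"
  using convex_Int[OF convex_cr_ge(1)[of 0 u q] convex_cr_ge(2)[of 0 q w]] by (simp add: Int_def)

lemma continuous_on_Min:
  fixes f :: "'v \<Rightarrow> 'a::topological_space \<Rightarrow> real"
  assumes "finite V" "V \<noteq> {}" "\<And>v. v \<in> V \<Longrightarrow> continuous_on A (f v)"
  shows "continuous_on A (\<lambda>t. Min ((\<lambda>v. f v t) ` V))"
  using assms
proof (induction V rule: finite_ne_induct)
  case (insert x F)
  then have "continuous_on A (\<lambda>t. min (f x t) (Min ((\<lambda>v. f v t) ` F)))"
    by (intro continuous_on_min) auto
  then show ?case using insert by simp
qed simp

lemma cr_cis: "cr (cis a) (cis b) = sin (b - a)"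
  by (simp add: cr_def sin_diff)

lemma cr_pluecker: "cr n y * cr u w = cr n u * cr y w + cr n w * cr u y"
  by (simp add: cr_def algebra_simps)

section \<open>Valid probes in terms of vertices\<close>

context wedge_angle
begin

lemma hull_subset_wedge_iff:
  assumes "norm d = 1"
  shows "convex hull V \<subseteq> wedge \<omega> q d \<longleftrightarrow> V \<subseteq> wedge \<omega> q d"
proof -
  have "wedge \<omega> q d = {x. 0 \<le> cr d (x - q) \<and> 0 \<le> cr (x - q) (cis \<omega> * d)}"
    using wedge_iff[OF assms] by auto
  then have "convex (wedge \<omega> q d)" using convex_wedge_ineq by simp
  then show ?thesis by (rule subset_hull)
qed

lemma ray_meets_hull:
  assumes "finite V" "norm d = 1" "V \<subseteq> wedge \<omega> q d"
  shows "ray q d \<inter> convex hull V \<noteq> {} \<longleftrightarrow> (\<exists>v\<in>V. v \<in> ray q d)"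
    and "ray q (cis \<omega> * d) \<inter> convex hull V \<noteq> {} \<longleftrightarrow> (\<exists>v\<in>V. v \<in> ray q (cis \<omega> * d))"
proof -
  have w: "0 \<le> cr d (v - q)" "0 \<le> cr (- (cis \<omega> * d)) (v - q)" "0 \<le> cr (v - q) (cis \<omega> * d)" if "v \<in> V" for v
    using assms that wedge_iff[OF assms(2), of v q] cr_swap[of "v - q" "cis \<omega> * d"] by (auto simp: cr_minus)
  have "\<exists>v\<in>V. v \<in> ray q d" if "x \<in> ray q d" "x \<in> convex hull V" for x
  proof -
    have "x \<in> convex hull {v \<in> V. cr d (v - q) = 0}"
      using that ray1_iff[OF assms(2)] w by (intro hull_cr_face) (auto simp: assms)
    then have "{v \<in> V. cr d (v - q) = 0} \<noteq> {}" by (metis convex_hull_empty empty_iff)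
    then show ?thesis using w ray1_iff[OF assms(2)] by auto
  qed
  then show "ray q d \<inter> convex hull V \<noteq> {} \<longleftrightarrow> (\<exists>v\<in>V. v \<in> ray q d)"
    using hull_subset[of V convex] by blast
  have "\<exists>v\<in>V. v \<in> ray q (cis \<omega> * d)" if "x \<in> ray q (cis \<omega> * d)" "x \<in> convex hull V" for x
  proof -
    have "cr (- (cis \<omega> * d)) (x - q) = 0"
      using that(1) ray2_iff[OF assms(2), of x q] cr_swap[of "x - q" "cis \<omega> * d"] by (simp add: cr_minus)
    then have "x \<in> convex hull {v \<in> V. cr (- (cis \<omega> * d)) (v - q) = 0}"
      using that(2) w by (intro hull_cr_face) (auto simp: assms)
    then have "{v \<in> V. cr (- (cis \<omega> * d)) (v - q) = 0} \<noteq> {}" by (metis convex_hull_empty empty_iff)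
    then obtain v where "v \<in> V" "cr (- (cis \<omega> * d)) (v - q) = 0" by blast
    then show ?thesis using w ray2_iff[OF assms(2), of v q] cr_swap[of "v - q" "cis \<omega> * d"]
      by (auto simp: cr_minus)
  qed
  then show "ray q (cis \<omega> * d) \<inter> convex hull V \<noteq> {} \<longleftrightarrow> (\<exists>v\<in>V. v \<in> ray q (cis \<omega> * d))"
    using hull_subset[of V convex] by blast
qed

lemma valid_probe_hull_iff:
  assumes "finite V"
  shows "valid_probe \<omega> (convex hull V) L q d \<longleftrightarrow>
     norm d = 1 \<and> V \<subseteq> wedge \<omega> q d \<and> (\<exists>v\<in>V. v \<in> ray q d) \<and> (\<exists>v\<in>V. v \<in> ray q (cis \<omega> * d)) \<and>
     q \<in> line_pts L \<and> ray q (snd L) \<inter> convex hull V \<noteq> {}"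
  unfolding valid_probe_def using hull_subset_wedge_iff ray_meets_hull[OF assms] by meson

text \<open>An apex in the hull would have to be a vertex, since the two rays have only it in
  common. Its neighbours would then lie in the cone and enclose at most \<omega>. Here the large
  internal angles enter the uniqueness of probes.\<close>

lemma wedge_apex_notin:
  assumes P: "convex_gon \<omega> V" and d: "norm d = 1" and W: "V \<subseteq> wedge \<omega> q d"
  shows "q \<notin> convex hull V"
proof
  assume q: "q \<in> convex hull V"
  let ?e = "cis \<omega> * d"
  have w: "0 \<le> cr d (v - q)" "0 \<le> cr (- ?e) (v - q)" "0 \<le> cr (v - q) ?e" if "v \<in> V" for v
    using W that wedge_iff[OF d, of v q] cr_swap[of "v - q" "cis \<omega> * d"] by (auto simp: cr_minus)
  have fin: "finite V" using convex_gonD[OF P] by simp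
  let ?W = "{v \<in> V. cr d (v - q) = 0}"
  have "q \<in> convex hull ?W" by (rule hull_cr_face[OF fin]) (use w q in auto)
  then have "q \<in> convex hull {v \<in> ?W. cr (- ?e) (v - q) = 0}"
    by (intro hull_cr_face[of ?W]) (use w fin in auto)
  then have "{v \<in> ?W. cr (- ?e) (v - q) = 0} \<noteq> {}" by (metis convex_hull_empty empty_iff)
  then obtain v where v: "v \<in> V" "cr d (v - q) = 0" "cr (- ?e) (v - q) = 0" by blast
  then have "cr (v - q) ?e = 0" using cr_swap[of "v - q" ?e] by (simp add: cr_minus)
  then have "v = q" using frame_decomp[OF d, of "v - q"] v(2) by simp
  then obtain a b where ab: "edge V a q" "edge V q b"
    "(a - q) \<bullet> (b - q) < cos \<omega> * (norm (a - q) * norm (b - q))"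
    using convex_gonD(4)[OF P] v by blast
  moreover have "a \<in> V" "b \<in> V" using ab edgeD by auto
  ultimately show False using cone_inner_norm_ge[OF d, of "a - q" "b - q"] w by force
qed

lemma probe_forward:
  assumes "convex_gon \<omega> V" "valid_probe \<omega> (convex hull V) L q d"
  shows "q \<notin> convex hull V" "snd L \<noteq> 0" "0 \<le> cr d (snd L)" "0 \<le> cr (snd L) (cis \<omega> * d)"
    "\<exists>a>0. q + of_real a * snd L \<in> convex hull V"
proof -
  have fin: "finite V" using convex_gonD[OF assms(1)] by simp
  note v = assms(2)[unfolded valid_probe_hull_iff[OF fin]]
  show q: "q \<notin> convex hull V" using wedge_apex_notin v assms(1) by blast
  obtain a where a: "a \<ge> 0" "q + of_real a * snd L \<in> convex hull V"
    using v by (auto simp: ray_def)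
  then show "snd L \<noteq> 0" using q by auto
  have "a \<noteq> 0" using a q by auto
  then have a0: "a > 0" using a by simp
  then show "\<exists>a>0. q + of_real a * snd L \<in> convex hull V" using a by blast
  have "q + of_real a * snd L \<in> wedge \<omega> q d"
    using a(2) assms(2) by (auto simp: valid_probe_def)
  then show "0 \<le> cr d (snd L)" "0 \<le> cr (snd L) (cis \<omega> * d)"
    using wedge_iff[of d] v a0 by (auto simp: cr_of_real zero_le_mult_iff)
qed

lemma cone_pos:
  assumes d: "norm d = 1" and "0 \<le> cr d y" "0 \<le> cr y (cis \<omega> * d)" "y \<noteq> 0"
  shows "0 < cr d y + cr y (cis \<omega> * d)"
proof (rule ccontr)
  assume "\<not> ?thesis"
  then have "cr d y = 0" "cr y (cis \<omega> * d) = 0" using assms by linarith+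
  then show False using frame_decomp[OF d, of y] assms by simp
qed

text \<open>A second apex further along the line must still see the two contacts of the first wedge
  within \<omega>. But in the triangle of first apex and contacts, away from that apex, the viewing
  angle exceeds \<omega> except at the contacts themselves, and an apex is never a vertex.\<close>

lemma probe_apex_forward_eq:
  assumes P: "convex_gon \<omega> V" and v: "valid_probe \<omega> (convex hull V) L q d"
    and v': "valid_probe \<omega> (convex hull V) L q' d'"
    and q': "q' = q + of_real \<tau> * snd L" and "0 \<le> \<tau>"
  shows "q' = q"
proof (rule ccontr)
  assume "q' \<noteq> q"
  with q' \<open>0 \<le> \<tau>\<close> have \<tau>: "0 < \<tau>" by (cases "\<tau> = 0") auto
  define \<delta> e e' where "\<delta> = snd L" and "e = cis \<omega> * d" and "e' = cis \<omega> * d'"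
  have fin: "finite V" using convex_gonD[OF P] by simp
  note pf = probe_forward[OF P v, folded \<delta>_def e_def] and pf' = probe_forward[OF P v', folded \<delta>_def e'_def]
  note v = v[unfolded valid_probe_hull_iff[OF fin]] and v' = v'[unfolded valid_probe_hull_iff[OF fin]]
  have d: "norm d = 1" "norm d' = 1" using v v' by auto
  define \<alpha> \<beta> where "\<alpha> = cr \<delta> e / sin \<omega>" and "\<beta> = cr d \<delta> / sin \<omega>"
  have ab: "0 \<le> \<alpha>" "0 \<le> \<beta>" using pf sin_pos by (auto simp: \<alpha>_def \<beta>_def)
  have \<delta>: "\<delta> = of_real \<alpha> * d + of_real \<beta> * e"
    unfolding \<alpha>_def \<beta>_def e_def by (rule frame_decomp[OF d(1)])
  have "\<alpha> + \<beta> \<noteq> 0"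
    using \<delta> pf(2) ab by (smt (verit) add_cancel_right_left mult_zero_left of_real_0)
  then have ab0: "0 < \<alpha> + \<beta>" using ab by linarith
  obtain p1 p2 where p: "p1 \<in> V" "p1 \<in> ray q d" "p2 \<in> V" "p2 \<in> ray q e" using v e_def by auto
  obtain s where s: "p1 = q + of_real s * d" "0 \<le> s" using p by (auto simp: ray_def)
  obtain t where t: "p2 = q + of_real t * e" "0 \<le> t" using p by (auto simp: ray_def)
  have VK: "V \<subseteq> convex hull V" by (rule hull_subset)
  have "s \<noteq> 0" using p s pf(1) VK by auto
  then have s0: "0 < s" using s by simp
  have "t \<noteq> 0" using p t pf(1) VK by auto
  then have t0: "0 < t" using t by simp
  define u1 u2 where "u1 = p1 - q'" and "u2 = p2 - q'"
  have u1: "u1 = of_real s * d - of_real \<tau> * \<delta>" and u2: "u2 = of_real t * e - of_real \<tau> * \<delta>"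
    by (simp_all add: u1_def u2_def s t q' \<delta>_def)
  have c1: "0 \<le> cr d' u1" "0 \<le> cr u1 e'" and c2: "0 \<le> cr d' u2" "0 \<le> cr u2 e'"
    using v' p wedge_iff[OF d(2)] unfolding u1_def u2_def e'_def by auto
  have cd: "cr d e = sin \<omega>" using cr_frame[OF d(1)] by (simp add: e_def)
  have ed: "cr e d = - sin \<omega>" using cd cr_swap[of e d] by simp
  have d\<delta>: "cr d \<delta> = \<beta> * sin \<omega>" "cr \<delta> e = \<alpha> * sin \<omega>"
    using sin_pos by (simp_all add: \<alpha>_def \<beta>_def)
  have k1: "0 \<le> cr u1 \<delta>" using s0 pf by (simp add: u1 cr_diff cr_of_real)
  have k2: "0 \<le> cr \<delta> u2" using t0 pf by (simp add: u2 cr_diff cr_of_real)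
  \<comment> \<open>This is the sum of the two functionals that cut out the second wedge, so it is
    positive on the nonzero vectors of its cone. As \<open>\<delta>\<close> runs between
    \<open>u1\<close> and \<open>u2\<close>, the identity \<open>cr_pluecker\<close> then yields
    their orientation.\<close>
  have f: "cr (d' - e') y = cr d' y + cr y e'" for y by (simp add: cr_diff cr_swap[of e' y])
  have "0 \<le> cr (d' - e') u1 * cr \<delta> u2 + cr (d' - e') u2 * cr u1 \<delta>"
    unfolding f using c1 c2 k1 k2 by simp
  then have "0 \<le> cr (d' - e') \<delta> * cr u1 u2" using cr_pluecker[of "d' - e'" \<delta> u1 u2] by simp
  moreover have "0 < cr (d' - e') \<delta>"
    unfolding f using cone_pos[OF d(2)] pf' by (simp add: e'_def)
  ultimately have cn: "0 \<le> cr u1 u2" by (simp add: zero_le_mult_iff)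
  have crs: "cr u1 u2 = sin \<omega> * (s * t - \<tau> * (s * \<beta> + t * \<alpha>))"
  proof -
    have "cr u1 u2 = s * t * cr d e - s * \<tau> * cr d \<delta> - \<tau> * t * cr \<delta> e"
      unfolding u1 u2 cr_diff cr_of_real cr_self by (simp add: algebra_simps)
    then show ?thesis unfolding cd d\<delta> by (simp add: algebra_simps)
  qed
  then have a: "\<tau> * (s * \<beta> + t * \<alpha>) \<le> s * t"
    using cn sin_pos by (simp add: zero_le_mult_iff)
  have dot: "u1 \<bullet> u2 = (s - \<tau> * \<alpha>) * (- \<tau> * \<alpha>) + (- \<tau> * \<beta>) * (t - \<tau> * \<beta>)
     + ((s - \<tau> * \<alpha>) * (t - \<tau> * \<beta>) + \<tau> * \<beta> * (\<tau> * \<alpha>)) * cos \<omega>"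
  proof -
    have "u1 = of_real (s - \<tau> * \<alpha>) * d + of_real (- \<tau> * \<beta>) * (cis \<omega> * d)"
      unfolding u1 \<delta> e_def by (simp add: algebra_simps)
    moreover have "u2 = of_real (- \<tau> * \<alpha>) * d + of_real (t - \<tau> * \<beta>) * (cis \<omega> * d)"
      unfolding u2 \<delta> e_def by (simp add: algebra_simps)
    ultimately show ?thesis
      by (simp only: inner_frame[OF d(1)]) (simp add: algebra_simps)
  qed
  have "cos \<omega> * cr u1 u2 \<le> sin \<omega> * (u1 \<bullet> u2)"
    using cone_inner_ge(1)[OF d(2), of u1 u2] c1 c2 cn by (simp add: e'_def)
  then have "sin \<omega> * (cos \<omega> * (s * t - \<tau> * (s * \<beta> + t * \<alpha>))) \<le> sin \<omega> * (u1 \<bullet> u2)"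
    unfolding crs by (simp add: algebra_simps)
  then have "cos \<omega> * (s * t - \<tau> * (s * \<beta> + t * \<alpha>)) \<le> u1 \<bullet> u2"
    using sin_pos by (rule mult_left_le_imp_le)
  \<comment> \<open>The first apex sees the contact directions under exactly \<omega>; hence the
    terms without \<open>\<tau>\<close> cancel, and one factor \<open>\<tau>\<close> can be divided
    out.\<close>
  then have "\<tau> * (s * \<alpha> + t * \<beta>) \<le> \<tau> * (\<tau> * (\<alpha>\<^sup>2 + \<beta>\<^sup>2 + 2 * \<alpha> * \<beta> * cos \<omega>))"
    unfolding dot by (simp add: algebra_simps power2_eq_square)
  then have b: "s * \<alpha> + t * \<beta> \<le> \<tau> * (\<alpha>\<^sup>2 + \<beta>\<^sup>2 + 2 * \<alpha> * \<beta> * cos \<omega>)"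
    using \<tau> by (rule mult_left_le_imp_le)
  from nested_apex_inequality[OF s0 t0 \<tau> ab ab0 cos_nonneg cos_less_1 a b]
  have "u1 = 0 \<or> u2 = 0"
  proof
    assume "\<beta> = 0 \<and> \<tau> * \<alpha> = s"
    then have "u1 = 0" unfolding u1 \<delta> by auto
    then show ?thesis ..
  next
    assume "\<alpha> = 0 \<and> \<tau> * \<beta> = t"
    then have "u2 = 0" unfolding u2 \<delta> by auto
    then show ?thesis ..
  qed
  then have "q' \<in> V" using p by (auto simp: u1_def u2_def)
  then show False using pf'(1) VK by blast
qed

text \<open>A contact on the first ray of one wedge lies in the other wedge, so each of
  \<open>d\<close>, \<open>d'\<close> is weakly to the left of the other. They are parallel, and
  opposite directions would leave the wedge.\<close>

lemma probe_apex_eq_dir_eq: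
  assumes P: "convex_gon \<omega> V" and v: "valid_probe \<omega> (convex hull V) L q d"
    and v': "valid_probe \<omega> (convex hull V) L q d'"
  shows "d' = d"
proof -
  have fin: "finite V" using convex_gonD[OF P] by simp
  have *: "0 \<le> cr d' d \<and> 0 \<le> cr d (cis \<omega> * d')"
    if v: "valid_probe \<omega> (convex hull V) L q d" and v': "valid_probe \<omega> (convex hull V) L q d'" for d d'
  proof -
    note v1 = v[unfolded valid_probe_hull_iff[OF fin]]
    note v1' = v'[unfolded valid_probe_hull_iff[OF fin]]
    obtain p where p: "p \<in> V" "p \<in> ray q d" using v1 by blast
    obtain s where s: "p = q + of_real s * d" "0 \<le> s" using p by (auto simp: ray_def)
    have "s \<noteq> 0" using p s probe_forward(1)[OF P v] hull_subset[of V convex] by auto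
    moreover have "p \<in> wedge \<omega> q d'" using v1' p by auto
    ultimately show ?thesis using s wedge_iff[of d'] v1' by (auto simp: cr_of_real zero_le_mult_iff)
  qed
  have n: "norm d = 1" "norm d' = 1" using v v' by (auto simp: valid_probe_def)
  have "cr d d' = 0" using *[OF v v'] *[OF v' v] cr_swap[of d d'] by linarith
  moreover have "d \<noteq> 0" using n by auto
  ultimately obtain t where t: "d' = of_real t * d" by (rule cr_eq_0_cases)
  then have "\<bar>t\<bar> = 1" using n by (simp add: norm_mult)
  moreover have "t \<noteq> -1"
    using *[OF v v'] t sin_pos cr_frame[OF n(1)] by (auto simp: cr_minus)
  ultimately show ?thesis using t by (auto simp: abs_if split: if_splits)
qed

lemma valid_probe_unique:
  assumes P: "convex_gon \<omega> V" and v: "valid_probe \<omega> (convex hull V) L q d"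
    and v': "valid_probe \<omega> (convex hull V) L q' d'"
  shows "q' = q" "d' = d"
proof -
  obtain x x' where "q = fst L + of_real x * snd L" "q' = fst L + of_real x' * snd L"
    using v v' by (auto simp: valid_probe_def line_pts_def)
  then have "q' = q + of_real (x' - x) * snd L" "q = q' + of_real (x - x') * snd L"
    by (simp_all add: algebra_simps)
  then show "q' = q"
    using probe_apex_forward_eq[OF P v v'] probe_apex_forward_eq[OF P v' v]
    by (cases "x \<le> x'") (metis diff_ge_0_iff_ge nle_le)+
  then show "d' = d" using probe_apex_eq_dir_eq[OF P v] v' by blast
qed

text \<open>Turn a circumscribed wedge: the direction \<open>\<theta>\<close> of its first ray fixes
  two supporting lines and thus the apex \<open>q \<theta>\<close>. Between the position with the
  second ray parallel to the line and the one with the first ray parallel to it, the apex changes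
  sides, so by continuity it meets the line.\<close>

lemma valid_probe_exists:
  assumes fin: "finite V" "V \<noteq> {}" and nz: "snd L \<noteq> 0" and z: "z \<in> convex hull V" "z \<in> line_pts L"
  shows "\<exists>q d. valid_probe \<omega> (convex hull V) L q d"
proof -
  define \<delta> \<phi> where "\<delta> = snd L" and "\<phi> = Arg \<delta>"
  have \<delta>: "\<delta> = of_real (norm \<delta>) * cis \<phi>"
    using rcis_cmod_Arg[of \<delta>] by (simp add: \<phi>_def rcis_def)
  have n\<delta>: "0 < norm \<delta>" using nz by (simp add: \<delta>_def)
  define d e where "d \<theta> = cis \<theta>" and "e \<theta> = cis \<omega> * cis \<theta>" for \<theta>
  have e: "e \<theta> = cis (\<omega> + \<theta>)" for \<theta> by (simp add: e_def cis_mult)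
  define m1 m2 where "m1 \<theta> = Min ((\<lambda>v. cr (d \<theta>) v) ` V)" and "m2 \<theta> = Min ((\<lambda>v. cr v (e \<theta>)) ` V)" for \<theta>
  define q where "q \<theta> = of_real (m2 \<theta> / sin \<omega>) * d \<theta> + of_real (m1 \<theta> / sin \<omega>) * e \<theta>" for \<theta>
  have nd: "norm (d \<theta>) = 1" for \<theta> by (simp add: d_def)
  have cde: "cr (d \<theta>) (e \<theta>) = sin \<omega>" for \<theta> using cr_frame[OF nd] by (simp add: e_def d_def)
  have q1: "cr (d \<theta>) (q \<theta>) = m1 \<theta>" and q2: "cr (q \<theta>) (e \<theta>) = m2 \<theta>" for \<theta>
    using sin_pos unfolding q_def cr_add cr_of_real cde cr_self by simp_all
  have W1: "0 \<le> cr (d \<theta>) (v - q \<theta>)" and W2: "0 \<le> cr (v - q \<theta>) (e \<theta>)" if "v \<in> V" for v \<theta>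
    unfolding cr_diff q1 q2 m1_def m2_def using that fin by auto
  have T1: "\<exists>v\<in>V. cr (d \<theta>) (v - q \<theta>) = 0" for \<theta>
    unfolding cr_diff q1 m1_def using Min_in[of "(\<lambda>v. cr (d \<theta>) v) ` V"] fin
    by (metis (no_types, lifting) eq_iff_diff_eq_0 finite_imageI image_iff image_is_empty)
  have T2: "\<exists>v\<in>V. cr (v - q \<theta>) (e \<theta>) = 0" for \<theta>
    unfolding cr_diff q2 m2_def using Min_in[of "(\<lambda>v. cr v (e \<theta>)) ` V"] fin
    by (metis (no_types, lifting) eq_iff_diff_eq_0 finite_imageI image_iff image_is_empty)
  have W: "V \<subseteq> wedge \<omega> (q \<theta>) (d \<theta>)" for \<theta>
    using W1 W2 wedge_iff[OF nd] by (auto simp: e_def d_def)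
  have zW: "0 \<le> cr (d \<theta>) (z - q \<theta>)" "0 \<le> cr (z - q \<theta>) (e \<theta>)" for \<theta>
  proof -
    have "z \<in> wedge \<omega> (q \<theta>) (d \<theta>)" using W hull_subset_wedge_iff[OF nd] z by blast
    then show "0 \<le> cr (d \<theta>) (z - q \<theta>)" "0 \<le> cr (z - q \<theta>) (e \<theta>)"
      using wedge_iff[OF nd] by (auto simp: e_def d_def)
  qed
  define g where "g \<theta> = cr \<delta> (q \<theta> - z)" for \<theta>
  have cis_cont: "continuous_on A (\<lambda>\<theta>. Re (cis (f \<theta>)))" "continuous_on A (\<lambda>\<theta>. Im (cis (f \<theta>)))"
    if "continuous_on A f" for A and f :: "real \<Rightarrow> real"
    using that by (auto intro!: continuous_intros)
  have "continuous_on {\<phi> - \<omega>..\<phi>} m1" "continuous_on {\<phi> - \<omega>..\<phi>} m2"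
    unfolding m1_def m2_def cr_def d_def e
    by (intro continuous_on_Min fin continuous_intros cis_cont)+
  then have cont: "continuous_on {\<phi> - \<omega>..\<phi>} g"
    unfolding g_def q_def cr_def d_def e using sin_pos
    by (auto intro!: continuous_intros)
  have d\<delta>: "cr \<delta> x = norm \<delta> * cr (cis \<phi>) x" for x by (metis \<delta> cr_of_real(1))
  have gp: "g \<phi> \<le> 0"
  proof -
    have "g \<phi> = - norm \<delta> * cr (d \<phi>) (z - q \<phi>)"
      unfolding g_def d\<delta> d_def by (simp add: cr_def algebra_simps)
    then show ?thesis using zW(1)[of \<phi>] n\<delta> by simp
  qed
  have gm: "0 \<le> g (\<phi> - \<omega>)"
  proof -
    have "g (\<phi> - \<omega>) = norm \<delta> * cr (z - q (\<phi> - \<omega>)) (e (\<phi> - \<omega>))"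
      unfolding g_def d\<delta> e by (simp add: cr_def algebra_simps)
    then show ?thesis using zW(2)[of "\<phi> - \<omega>"] n\<delta> by simp
  qed
  obtain \<theta> where \<theta>: "\<phi> - \<omega> \<le> \<theta>" "\<theta> \<le> \<phi>" "g \<theta> = 0"
    using IVT2'[OF gp gm _ cont] pos by auto
  have "\<delta> \<noteq> 0" using n\<delta> by auto
  then obtain t where t: "q \<theta> - z = of_real t * \<delta>"
    using cr_eq_0_cases[of \<delta> "q \<theta> - z"] \<theta>(3) g_def by metis
  \<comment> \<open>As \<open>\<theta>\<close> stays within \<omega> of the argument of
    \<open>\<delta>\<close>, the line enters the cone at the apex. The cone is pointed, so
    \<open>z\<close> lies ahead of the apex and not behind it.\<close>
  have "cr (d \<theta>) \<delta> = norm \<delta> * sin (\<phi> - \<theta>)" "cr \<delta> (e \<theta>) = norm \<delta> * sin (\<omega> + \<theta> - \<phi>)"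
    by (subst \<delta>, simp add: cr_of_real cr_cis d_def e)+
  moreover have "0 \<le> sin (\<phi> - \<theta>)" "0 \<le> sin (\<omega> + \<theta> - \<phi>)"
    using \<theta> le pi_gt_zero by (intro sin_ge_zero; linarith)+
  ultimately have c: "0 \<le> cr (d \<theta>) \<delta>" "0 \<le> cr \<delta> (e \<theta>)" by simp_all
  have zt: "z - q \<theta> = of_real (- t) * \<delta>" 
    using t by (metis minus_diff_eq mult_minus_left of_real_minus)
  have "0 \<le> - t"
    using zW[of \<theta>, unfolded zt] c \<open>\<delta> \<noteq> 0\<close>
    by - (rule cone_pointed[OF nd, of \<theta> \<delta>]; simp add: e_def d_def)
  moreover have "z = q \<theta> + of_real (- t) * \<delta>" using zt by (simp add: algebra_simps)
  ultimately have "z \<in> ray (q \<theta>) \<delta>" unfolding ray_def by blast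
  obtain x where x: "z = fst L + of_real x * \<delta>" using z by (auto simp: line_pts_def \<delta>_def)
  have "q \<theta> = fst L + of_real (x + t) * \<delta>" using t x by (simp add: algebra_simps)
  then have "q \<theta> \<in> line_pts L" unfolding line_pts_def \<delta>_def by blast
  moreover have "\<exists>v\<in>V. v \<in> ray (q \<theta>) (d \<theta>)"
    using T1[of \<theta>] W2 ray1_iff[OF nd] by (auto simp: e_def d_def)
  moreover have "\<exists>v\<in>V. v \<in> ray (q \<theta>) (cis \<omega> * d \<theta>)"
    using T2[of \<theta>] W1 ray2_iff[OF nd] by (auto simp: e_def d_def)
  ultimately show ?thesis
    using valid_probe_hull_iff[OF fin(1)] nd W z \<open>z \<in> ray (q \<theta>) \<delta>\<close> \<delta>_def by blast
qed

end


section \<open>Inserting a vertex beyond an edge\<close>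

lemma hull_face_of_hull:
  assumes "finite V" "\<And>v. v \<in> V \<Longrightarrow> 0 \<le> cr u (v - q)"
  shows "convex hull {v \<in> V. cr u (v - q) = 0} face_of convex hull V"
proof -
  let ?a = "Complex (- Im u) (Re u)"
  have a: "?a \<bullet> x = cr u (x - q) + cr u q" for x
    by (simp add: cr_def inner_complex_def algebra_simps)
  have "convex hull V \<inter> {x. ?a \<bullet> x = cr u q} face_of convex hull V"
    by (intro face_of_Int_supporting_hyperplane_ge convex_convex_hull)
      (use cr_hull_ge[OF assms(2)] a in auto)
  moreover have "convex hull V \<inter> {x. ?a \<bullet> x = cr u q} = convex hull {v \<in> V. cr u (v - q) = 0}"
  proof
    show "convex hull V \<inter> {x. ?a \<bullet> x = cr u q} \<subseteq> convex hull {v \<in> V. cr u (v - q) = 0}"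
      using hull_cr_face[OF assms] a by auto
    have "convex {x. ?a \<bullet> x = cr u q}" by (rule convex_hyperplane)
    then have "convex hull {v \<in> V. cr u (v - q) = 0} \<subseteq> {x. ?a \<bullet> x = cr u q}"
      by (intro hull_minimal) (auto simp: a)
    moreover have "convex hull {v \<in> V. cr u (v - q) = 0} \<subseteq> convex hull V" by (rule hull_mono) auto
    ultimately show "convex hull {v \<in> V. cr u (v - q) = 0} \<subseteq> convex hull V \<inter> {x. ?a \<bullet> x = cr u q}"
      by blast
  qed
  ultimately show ?thesis by simp
qed

lemma cr_expand: "of_real (cr x y) * z = of_real (cr z y) * x + of_real (cr x z) * y"
  by (simp add: complex_eq_iff cr_def algebra_simps)

text \<open>The line through a vertex parallel to the chord of its two neighbours supports the
  polygon at that vertex alone: its functional is the sum of those of the two incident edges, whose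
  lines share no other vertex.\<close>

lemma convex_gon_extreme_points:
  assumes P: "convex_gon \<omega> V"
  shows "{v. v extreme_point_of convex hull V} = V"
proof
  show "{v. v extreme_point_of convex hull V} \<subseteq> V" using extreme_point_of_convex_hull by blast
  show "V \<subseteq> {v. v extreme_point_of convex hull V}"
  proof
    fix v assume v: "v \<in> V"
    then obtain a b where ab: "edge V a v" "edge V v b" using convex_gonD(4)[OF P] by blast
    have sum: "cr (b - a) (w - v) = cr (v - a) (w - a) + cr (b - v) (w - v)" for w
      by (simp add: cr_def algebra_simps)
    have nn: "0 \<le> cr (b - a) (w - v)" if "w \<in> V" for w
      unfolding sum using edge_nonneg ab that by (simp add: add_nonneg_nonneg)
    have z: "w = v" if w: "w \<in> V" "cr (b - a) (w - v) = 0" for w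
    proof (rule ccontr)
      assume "w \<noteq> v"
      have "cr (v - a) (w - a) = 0" "cr (b - v) (w - v) = 0"
        using w edge_nonneg[OF ab(1) w(1)] edge_nonneg[OF ab(2) w(1)] unfolding sum by linarith+
      then have "w = a" "w = b" using edge_eq_0[OF ab(1) w(1)] edge_eq_0[OF ab(2) w(1)] \<open>w \<noteq> v\<close> by auto
      then show False using edge_asym[OF P ab(1)] ab(2) by simp
    qed
    have "{w \<in> V. cr (b - a) (w - v) = 0} = {v}" using z v by auto
    then have "{v} face_of convex hull V"
      using hull_face_of_hull[of V "b - a" v] nn convex_gonD(1)[OF P] by simp
    then show "v \<in> {v. v extreme_point_of convex hull V}" by (simp add: face_of_singleton)
  qed
qed

text \<open>The direction of a diagonal from \<open>v\<close> is a positive combination of the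
  directions to the two neighbours of \<open>v\<close>. A functional exposing the diagonal would
  then be maximal at both neighbours as well, making them collinear with \<open>v\<close>.\<close>

lemma convex_gon_face_edge:
  assumes P: "convex_gon \<omega> V" and u: "u \<in> V" "v \<in> V" "u \<noteq> v"
    and f: "closed_segment v u face_of convex hull V"
  shows "edge V v u \<or> edge V u v"
proof (rule ccontr)
  assume n: "\<not> ?thesis"
  obtain p s where ps: "edge V p v" "edge V v s" using convex_gonD(4)[OF P u(2)] by blast
  have us: "u \<noteq> s" "u \<noteq> p" using n ps by auto
  have "s \<noteq> p" using edge_asym[OF P ps(1)] ps(2) by auto
  then have D: "0 < cr (s - v) (p - v)"
    using edgeD(4)[OF ps(2), of p] edgeD[OF ps(1)] by auto
  have \<alpha>: "0 < cr (s - v) (u - v)" using edgeD(4)[OF ps(2) u(1)] us u by auto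
  have "0 < cr (v - p) (u - p)" using edgeD(4)[OF ps(1) u(1)] us u by auto
  also have "cr (v - p) (u - p) = cr (u - v) (p - v)" by (simp add: cr_def algebra_simps)
  finally have \<beta>: "0 < cr (u - v) (p - v)" .
  have "polyhedron (convex hull V)"
    using convex_gonD(1)[OF P] by (intro polytope_imp_polyhedron) (auto simp: polytope_def)
  then have "closed_segment v u exposed_face_of convex hull V"
    using f exposed_face_of_polyhedron by blast
  then obtain g c where g: "convex hull V \<subseteq> {x. g \<bullet> x \<le> c}"
      "closed_segment v u = convex hull V \<inter> {x. g \<bullet> x = c}"
    by (auto simp: exposed_face_of_def)
  have VK: "V \<subseteq> convex hull V" by (rule hull_subset)
  have gv: "g \<bullet> v = c" "g \<bullet> u = c"
    using g(2) ends_in_segment by blast+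
  have gsp: "g \<bullet> (s - v) \<le> 0" "g \<bullet> (p - v) \<le> 0"
    using g(1) VK edgeD(1,2)[OF ps(1)] edgeD(1,2)[OF ps(2)] gv by (auto simp: inner_diff_right)
  have "cr (s - v) (p - v) *\<^sub>R (u - v) = cr (u - v) (p - v) *\<^sub>R (s - v) + cr (s - v) (u - v) *\<^sub>R (p - v)"
    using cr_expand[of "s - v" "p - v" "u - v"] by (simp add: scaleR_conv_of_real)
  then have "cr (s - v) (p - v) * (g \<bullet> (u - v))
      = cr (u - v) (p - v) * (g \<bullet> (s - v)) + cr (s - v) (u - v) * (g \<bullet> (p - v))"
    by (metis inner_add_right inner_scaleR_right)
  moreover have "g \<bullet> (u - v) = 0" using gv by (simp add: inner_diff_right)
  ultimately have "g \<bullet> (s - v) = 0 \<and> g \<bullet> (p - v) = 0"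
    using mult_nonneg_nonpos[of "cr (u - v) (p - v)" "g \<bullet> (s - v)"]
      mult_nonneg_nonpos[of "cr (s - v) (u - v)" "g \<bullet> (p - v)"] gsp \<alpha> \<beta>
    by (smt (verit) mult_eq_0_iff mult_zero_right)
  then have "s \<in> closed_segment v u" "p \<in> closed_segment v u"
    unfolding g(2) using VK edgeD(1,2)[OF ps(1)] edgeD(1,2)[OF ps(2)] gv by (auto simp: inner_diff_right)
  then obtain x y where "s = v + x *\<^sub>R (u - v)" "p = v + y *\<^sub>R (u - v)"
    by (auto simp: in_segment algebra_simps)
  then have "cr (s - v) (p - v) = 0" by (simp add: cr_scaleR)
  then show False using D by simp
qed

text \<open>The rays of a probe differ by \<open>cis \<omega>\<close>, so this keeps them from
  carrying one edge each. The test ignores orientation because an edge may run towards the apex or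
  away from it.\<close>

definition generic :: "real \<Rightarrow> complex set \<Rightarrow> bool" where
  "generic \<omega> V \<longleftrightarrow> (\<forall>a b c d. edge V a b \<longrightarrow> edge V c d \<longrightarrow> cr (cis \<omega> * (b - a)) (d - c) \<noteq> 0)"

definition touched :: "real \<Rightarrow> complex set \<Rightarrow> dline \<Rightarrow> complex \<Rightarrow> complex \<Rightarrow> bool" where
  "touched \<omega> V L a b \<longleftrightarrow> (\<exists>q d. valid_probe \<omega> (convex hull V) L q d \<and>
     (a \<in> ray q d \<and> b \<in> ray q d \<or> a \<in> ray q (cis \<omega> * d) \<and> b \<in> ray q (cis \<omega> * d)))"

lemma eventually_nhds_less:
  assumes "(f \<longlongrightarrow> f m) (nhds m)" "c < (f m :: real)"
  shows "\<forall>\<^sub>F x in nhds m. c < f x"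
  using order_tendstoD(1)[OF assms] .

lemma eventually_nhds_greater:
  assumes "(f \<longlongrightarrow> f m) (nhds m)" "(f m :: real) < c"
  shows "\<forall>\<^sub>F x in nhds m. f x < c"
  using order_tendstoD(2)[OF assms] .

lemma eventually_nhds_cr_pos: "0 < cr u (m - q) \<Longrightarrow> \<forall>\<^sub>F x in nhds m. 0 < cr u (x - q)"
  by (rule eventually_nhds_less) (auto intro!: tendsto_intros filterlim_ident)

lemma card_edges:
  assumes "convex_gon \<omega> V"
  shows "card {(a, b). edge V a b} = card V"
proof -
  have "bij_betw fst {(a, b). edge V a b} V"
    unfolding bij_betw_def
  proof
    show "inj_on fst {(a, b). edge V a b}" by (auto simp: inj_on_def dest: edge_out_unique)
    show "fst ` {(a, b). edge V a b} = V"
    proof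
      show "fst ` {(a, b). edge V a b} \<subseteq> V" using edgeD(1) by auto
      show "V \<subseteq> fst ` {(a, b). edge V a b}"
        using convex_gonD(4)[OF assms] by (metis (mono_tags, lifting) case_prod_conv fst_conv imageI mem_Collect_eq subsetI)
    qed
  qed
  then show ?thesis by (rule bij_betw_same_card)
qed

lemma hull_misses_line:
  assumes "finite V" "\<delta> \<noteq> 0" "convex hull V \<inter> line_pts (l, \<delta>) = {}"
  shows "(\<forall>v\<in>V. 0 < cr \<delta> (v - l)) \<or> (\<forall>v\<in>V. 0 < cr (- \<delta>) (v - l))"
proof (rule ccontr)
  assume "\<not> ?thesis"
  then obtain v w where vw: "v \<in> V" "cr \<delta> (v - l) \<le> 0" "w \<in> V" "0 \<le> cr \<delta> (w - l)"
    by (auto simp: cr_minus not_less)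
  define f g where "f = cr \<delta> (v - l)" and "g = cr \<delta> (w - l)"
  obtain x where x: "x \<in> convex hull V" "cr \<delta> (x - l) = 0"
  proof (cases "g = f")
    case True
    then show ?thesis using that[of v] vw hull_inc[of v V convex] by (simp add: f_def g_def)
  next
    case False
    then have fg: "f < g" using vw f_def g_def by linarith
    define s where "s = g / (g - f)"
    have s: "0 \<le> s" "s \<le> 1" "s * f + (1 - s) * g = 0"
      using fg vw by (auto simp: s_def f_def g_def field_simps)
    have "s *\<^sub>R v + (1 - s) *\<^sub>R w \<in> convex hull V"
      using s vw by (intro convexD_alt[of _ w v s, unfolded add.commute[of "(1 - s) *\<^sub>R w"]]) (auto simp: hull_inc)
    moreover have "cr \<delta> (s *\<^sub>R v + (1 - s) *\<^sub>R w - l) = s * f + (1 - s) * g"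
      by (simp add: f_def g_def cr_def algebra_simps)
    ultimately show ?thesis using that s by simp
  qed
  obtain t where "x - l = of_real t * \<delta>" using cr_eq_0_cases[OF x(2) assms(2)] .
  then have "x = l + of_real t * \<delta>" by (simp add: algebra_simps)
  then show False using assms(3) x by (auto simp: line_pts_def)
qed

lemma hull_misses_lineD:
  assumes "\<And>v. v \<in> V \<Longrightarrow> 0 < cr \<delta> (v - l)"
  shows "convex hull V \<inter> line_pts (l, \<delta>) = {}" "convex hull V \<inter> line_pts (l, - \<delta>) = {}"
proof -
  have "y \<notin> convex hull V" if "cr \<delta> (y - l) = 0" for y
    using cr_hull_gt[OF assms, where x = y] that by auto
  moreover have "cr \<delta> (y - l) = 0" if "y \<in> line_pts (l, \<delta>) \<or> y \<in> line_pts (l, - \<delta>)" for y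
    using that by (auto simp: line_pts_def cr_of_real cr_minus cr_diff cr_add)
  ultimately show "convex hull V \<inter> line_pts (l, \<delta>) = {}" "convex hull V \<inter> line_pts (l, - \<delta>) = {}"
    by blast+
qed

lemma no_valid_probe_off_line:
  assumes "\<delta> = snd L \<or> \<delta> = - snd L" "\<And>v. v \<in> V \<Longrightarrow> 0 < cr \<delta> (v - fst L)"
  shows "\<not> valid_probe \<omega> (convex hull V) L q d"
proof -
  have "convex hull V \<inter> line_pts (fst L, snd L) = {}"
    using hull_misses_lineD[of V \<delta> "fst L", OF assms(2)] assms(1) by (metis minus_minus)
  moreover have "ray q (snd L) \<subseteq> line_pts L" if q: "q \<in> line_pts L" for q
  proof
    fix y assume "y \<in> ray q (snd L)"
    then obtain t where "y = q + of_real t * snd L" by (auto simp: ray_def)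
    moreover obtain s where "q = fst L + of_real s * snd L" using q by (auto simp: line_pts_def)
    ultimately have "y = fst L + of_real (s + t) * snd L" by (simp add: algebra_simps)
    then show "y \<in> line_pts L" unfolding line_pts_def by blast
  qed
  ultimately show ?thesis unfolding valid_probe_def by force
qed

context wedge_angle
begin

lemma convex_gon_convex_polygon:
  assumes P: "convex_gon \<omega> V"
  shows "convex_polygon_angles_gt \<omega> (convex hull V) (card V)"
proof -
  have fin: "finite V" using convex_gonD[OF P] by simp
  have ex: "v extreme_point_of convex hull V \<longleftrightarrow> v \<in> V" for v
    using convex_gon_extreme_points[OF P] by auto
  have dim: "aff_dim (convex hull V) = 2"
  proof -
    have "\<not> collinear V"
    proof
      assume "collinear V"
      then obtain k where k: "\<And>x y. x \<in> V \<Longrightarrow> y \<in> V \<Longrightarrow> \<exists>c. x - y = c *\<^sub>R k"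
        by (auto simp: collinear_def)
      obtain v where "v \<in> V" using convex_gonD(3)[OF P] by auto
      then obtain b where b: "edge V v b" using convex_gonD(4)[OF P] by blast
      obtain w where w: "w \<in> V" "w \<noteq> v" "w \<noteq> b" using third_vertex convex_gonD(1,2)[OF P] by metis
      obtain c1 c2 where "b - v = c1 *\<^sub>R k" "w - v = c2 *\<^sub>R k"
        using k[of b v] k[of w v] w \<open>v \<in> V\<close> edgeD(2)[OF b] by blast
      then have "cr (b - v) (w - v) = 0" by (simp add: cr_scaleR)
      then show False using edgeD(4)[OF b w] by simp
    qed
    then have "\<not> aff_dim V \<le> 1" using collinear_aff_dim by blast
    then show ?thesis using aff_dim_le_DIM[of V] by (simp add: aff_dim_convex_hull)
  qed
  have angle: "vec_angle (u - v) (w - v) > \<omega>"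
    if "v \<in> V" "u \<in> V" "w \<in> V" "u \<noteq> v" "w \<noteq> v" "u \<noteq> w"
      "closed_segment v u face_of convex hull V" "closed_segment v w face_of convex hull V" for u v w
  proof -
    obtain a b where ab: "edge V a v" "edge V v b"
      "(a - v) \<bullet> (b - v) < cos \<omega> * (norm (a - v) * norm (b - v))"
      using convex_gonD(4)[OF P] \<open>v \<in> V\<close> by blast
    have "edge V v u \<or> edge V u v" "edge V v w \<or> edge V w v"
      using convex_gon_face_edge[OF P] that by auto
    then have "(u = a \<and> w = b) \<or> (u = b \<and> w = a)"
      using ab edge_out_unique edge_in_unique \<open>u \<noteq> w\<close> by metis
    then have "(u - v) \<bullet> (w - v) < cos \<omega> * (norm (u - v) * norm (w - v))"
      using ab(3) by (auto simp: inner_commute mult.commute)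
    moreover have n: "0 < norm (u - v) * norm (w - v)" using that by simp
    ultimately have "(u - v) \<bullet> (w - v) / (norm (u - v) * norm (w - v)) < cos \<omega>"
      by (simp add: pos_divide_less_eq)
    moreover have "-1 \<le> (u - v) \<bullet> (w - v) / (norm (u - v) * norm (w - v))"
      using n Cauchy_Schwarz_ineq2[of "u - v" "w - v"] by (simp add: pos_le_divide_eq abs_le_iff)
    ultimately have "arccos (cos \<omega>) < arccos ((u - v) \<bullet> (w - v) / (norm (u - v) * norm (w - v)))"
      by (intro arccos_less_arccos) auto
    moreover have "arccos (cos \<omega>) = \<omega>" using pos le pi_gt_zero by (intro arccos_cos) linarith+
    ultimately show ?thesis by (simp add: vec_angle_def)
  qed
  show ?thesis
    unfolding convex_polygon_angles_gt_def ex Collect_mem_eq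
    using fin dim angle by (auto simp: polytope_def)
qed

text \<open>At the midpoint itself the strict inequalities already hold: it is strictly left of all
  other edges, the angles at \<open>a\<close> and \<open>b\<close> are the old ones, and the angle
  at the midpoint is straight. Nearby points inherit all this, and lying beyond the edge turns such
  a point into a vertex.\<close>

lemma insert_vertex:
  assumes P: "convex_gon \<omega> V" and e: "edge V a b"
  shows "\<forall>\<^sub>F x in nhds ((a + b) / 2). cr (b - a) (x - a) < 0 \<longrightarrow>
     x \<notin> convex hull V \<and> convex_gon \<omega> (insert x V) \<and>
     (\<forall>c d. edge (insert x V) c d \<longleftrightarrow> edge V c d \<and> (c, d) \<noteq> (a, b) \<or> (c, d) = (a, x) \<or> (c, d) = (x, b))"
proof -
  define m where "m = (a + b) / 2"
  have fin: "finite V" using convex_gonD[OF P] by simp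
  note eD = edgeD[OF e]
  have ma: "m - a = of_real (1/2) * (b - a)" and mb: "m - b = of_real (1/2) * (a - b)"
    by (simp_all add: m_def field_simps)
  obtain p where p: "edge V p a"
    "(p - a) \<bullet> (b - a) < cos \<omega> * (norm (p - a) * norm (b - a))"
    using convex_gonD(4)[OF P eD(1)] edge_out_unique[OF e] by blast
  obtain s where s: "edge V b s"
    "(a - b) \<bullet> (s - b) < cos \<omega> * (norm (a - b) * norm (s - b))"
    using convex_gonD(4)[OF P eD(2)] edge_in_unique[OF e] by blast
  have old: "\<forall>\<^sub>F x in nhds m. \<forall>c\<in>V. \<forall>d\<in>V. edge V c d \<and> (c, d) \<noteq> (a, b) \<longrightarrow> 0 < cr (d - c) (x - c)"
  proof (intro eventually_ball_finite fin ballI)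
    fix c d assume cd: "c \<in> V" "d \<in> V"
    show "\<forall>\<^sub>F x in nhds m. edge V c d \<and> (c, d) \<noteq> (a, b) \<longrightarrow> 0 < cr (d - c) (x - c)"
    proof (cases "edge V c d \<and> (c, d) \<noteq> (a, b)")
      case True
      \<comment> \<open>The line of another edge contains at most one of \<open>a\<close>,
        \<open>b\<close>, so their midpoint is strictly to its left.\<close>
      have "\<not> (cr (d - c) (a - c) = 0 \<and> cr (d - c) (b - c) = 0)"
        using edge_eq_0[of V c d a] edge_eq_0[of V c d b] True eD(1-3) edge_asym[OF P e] by auto
      then have "0 < cr (d - c) (a - c) + cr (d - c) (b - c)"
        using edge_nonneg[of V c d a] edge_nonneg[of V c d b] True eD(1,2) by auto
      also have "\<dots> = 2 * cr (d - c) (m - c)" by (simp add: m_def cr_def field_simps)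
      finally show ?thesis using eventually_nhds_cr_pos[of "d - c" m c] by simp
    next
      case False
      then show ?thesis by (intro always_eventually) auto
    qed
  qed
  have new1: "\<forall>\<^sub>F x in nhds m. \<forall>v\<in>V. v \<noteq> a \<and> v \<noteq> b \<longrightarrow> 0 < cr (x - a) (v - a)"
  proof (intro eventually_ball_finite fin ballI)
    fix v assume v: "v \<in> V"
    have "0 < cr (m - a) (v - a)" if "v \<noteq> a" "v \<noteq> b"
      unfolding ma cr_of_real using eD(4)[OF v that] by simp
    then show "\<forall>\<^sub>F x in nhds m. v \<noteq> a \<and> v \<noteq> b \<longrightarrow> 0 < cr (x - a) (v - a)"
      by (cases "v \<noteq> a \<and> v \<noteq> b")
        (auto intro!: eventually_nhds_less[of "\<lambda>x. cr (x - a) (v - a)"] tendsto_intros filterlim_ident)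
  qed
  have new2: "\<forall>\<^sub>F x in nhds m. \<forall>v\<in>V. v \<noteq> a \<and> v \<noteq> b \<longrightarrow> 0 < cr (b - x) (v - x)"
  proof (intro eventually_ball_finite fin ballI)
    fix v assume v: "v \<in> V"
    have "cr (b - m) (v - m) = 1/2 * cr (b - a) (v - a)"
      by (simp add: m_def cr_def field_simps)
    then have "0 < cr (b - m) (v - m)" if "v \<noteq> a" "v \<noteq> b"
      using eD(4)[OF v that] by simp
    then show "\<forall>\<^sub>F x in nhds m. v \<noteq> a \<and> v \<noteq> b \<longrightarrow> 0 < cr (b - x) (v - x)"
      by (cases "v \<noteq> a \<and> v \<noteq> b")
        (auto intro!: eventually_nhds_less[of "\<lambda>x. cr (b - x) (v - x)"] tendsto_intros filterlim_ident)
  qed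
  have ang1: "\<forall>\<^sub>F x in nhds m. (p - a) \<bullet> (x - a) - cos \<omega> * (norm (p - a) * norm (x - a)) < 0"
  proof (rule eventually_nhds_greater)
    show "(p - a) \<bullet> (m - a) - cos \<omega> * (norm (p - a) * norm (m - a)) < 0"
      unfolding ma using p(2) by (simp add: norm_mult scaleR_conv_of_real[symmetric] del: of_real_divide)
  qed (auto intro!: tendsto_intros filterlim_ident)
  have ang2: "\<forall>\<^sub>F x in nhds m. (x - b) \<bullet> (s - b) - cos \<omega> * (norm (x - b) * norm (s - b)) < 0"
  proof (rule eventually_nhds_greater)
    show "(m - b) \<bullet> (s - b) - cos \<omega> * (norm (m - b) * norm (s - b)) < 0"
      unfolding mb using s(2) by (simp add: norm_mult scaleR_conv_of_real[symmetric] del: of_real_divide)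
  qed (auto intro!: tendsto_intros filterlim_ident)
  have ang3: "\<forall>\<^sub>F x in nhds m. (a - x) \<bullet> (b - x) - cos \<omega> * (norm (a - x) * norm (b - x)) < 0"
  proof (rule eventually_nhds_greater)
    have "a - m = (1/2) *\<^sub>R (a - b)" "b - m = - ((1/2) *\<^sub>R (a - b))"
      by (simp_all add: m_def scaleR_conv_of_real field_simps)
    then have "(a - m) \<bullet> (b - m) = - ((norm (a - b))\<^sup>2 / 4)"
      by (simp add: power2_norm_eq_inner)
    also have "\<dots> < 0" using eD(3) by simp
    finally show "(a - m) \<bullet> (b - m) - cos \<omega> * (norm (a - m) * norm (b - m)) < 0"
      using cos_nonneg by (smt (verit) mult_nonneg_nonneg norm_ge_zero)
  qed (auto intro!: tendsto_intros filterlim_ident)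
  show ?thesis
    unfolding m_def[symmetric]
    using old new1 new2 ang1 ang2 ang3
  proof eventually_elim
    case (elim x)
    show ?case
    proof
      assume x: "cr (b - a) (x - a) < 0"
      let ?V = "insert x V"
      have xK: "x \<notin> convex hull V"
      proof
        assume "x \<in> convex hull V"
        then have "0 \<le> cr (b - a) (x - a)" using edge_nonneg[OF e] by (rule cr_hull_ge[rotated])
        then show False using x by simp
      qed
      then have xV: "x \<notin> V" using hull_subset[of V convex] by auto
      have e1: "edge ?V a x"
        unfolding edge_def using eD xV elim(2) x cr_swap[of "x - a" "b - a"] by auto
      have e2: "edge ?V x b"
      proof -
        have "cr (b - x) (a - x) = - cr (b - a) (x - a)" by (simp add: cr_def algebra_simps)
        then show ?thesis unfolding edge_def using eD xV elim(3) x by auto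
      qed
      have e3: "edge ?V c d" if "edge V c d" "(c, d) \<noteq> (a, b)" for c d
        using that elim(1) edgeD(1,2)[OF that(1)] by (auto simp: edge_def)
      have e4: "edge V c d" if "edge ?V c d" "c \<noteq> x" "d \<noteq> x" for c d
        using that by (auto simp: edge_def)
      have ab: "\<not> edge ?V a b"
        using edgeD(4)[of ?V a b x] x xV eD by auto
      have E: "edge ?V c d \<longleftrightarrow> edge V c d \<and> (c, d) \<noteq> (a, b) \<or> (c, d) = (a, x) \<or> (c, d) = (x, b)" for c d
      proof
        assume cd: "edge ?V c d"
        consider "c = x" | "d = x" | "c \<noteq> x" "d \<noteq> x" by blast
        then show "edge V c d \<and> (c, d) \<noteq> (a, b) \<or> (c, d) = (a, x) \<or> (c, d) = (x, b)"
        proof cases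
          case 1
          then show ?thesis using edge_out_unique[OF e2] cd by blast
        next
          case 2
          then show ?thesis using edge_in_unique[OF e1] cd by blast
        next
          case 3
          then show ?thesis using e4 cd ab by blast
        qed
      qed (use e1 e2 e3 in auto)
      have "convex_gon \<omega> ?V"
        unfolding convex_gon_def
      proof (intro conjI ballI)
        show "finite ?V" "3 \<le> card ?V" using fin convex_gonD(2)[OF P] xV by simp_all
        fix v assume "v \<in> ?V"
        then consider "v = x" | "v = a" | "v = b" | "v \<in> V" "v \<noteq> a" "v \<noteq> b" by blast
        then show "\<exists>a b. edge ?V a v \<and> edge ?V v b \<and>
           (a - v) \<bullet> (b - v) < cos \<omega> * (cmod (a - v) * cmod (b - v))"
        proof cases
          case 1
          then show ?thesis using e1 e2 elim(6) by auto
        next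
          case 2
          have "(p, a) \<noteq> (a, b)" using edgeD(3)[OF p(1)] by auto
          then have "edge ?V p a" using e3[OF p(1)] by simp
          then show ?thesis unfolding 2 using e1 elim(4) by (intro exI[of _ p] exI[of _ x]) auto
        next
          case 3
          have "(b, s) \<noteq> (a, b)" using eD(3) by auto
          then have "edge ?V b s" using e3[OF s(1)] by simp
          then show ?thesis unfolding 3 using e2 elim(5) by (intro exI[of _ x] exI[of _ s]) auto
        next
          case 4
          then obtain a' b' where "edge V a' v" "edge V v b'"
            "(a' - v) \<bullet> (b' - v) < cos \<omega> * (cmod (a' - v) * cmod (b' - v))"
            using convex_gonD(4)[OF P] by blast
          then show ?thesis using e3 4 by blast
        qed
      qed
      then show "x \<notin> convex hull V \<and> convex_gon \<omega> ?V \<and>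
         (\<forall>c d. edge ?V c d \<longleftrightarrow> edge V c d \<and> (c, d) \<noteq> (a, b) \<or> (c, d) = (a, x) \<or> (c, d) = (x, b))"
        using xK E by blast
    qed
  qed
qed

section \<open>Touched edges and the stability of answers\<close>

lemma probe_result_Hit:
  assumes P: "convex_gon \<omega> V" and v: "valid_probe \<omega> (convex hull V) L q d"
  shows "probe_result \<omega> (convex hull V) L = Hit q (ray q d) (ray q (cis \<omega> * d))
    (closest (convex hull V) q (ray q d)) (closest (convex hull V) q (ray q (cis \<omega> * d)))"
proof -
  have the: "(THE x. valid_probe \<omega> (convex hull V) L (fst x) (snd x)) = (q, d)"
  proof (rule the_equality)
    show "y = (q, d)" if "valid_probe \<omega> (convex hull V) L (fst y) (snd y)" for y
      using valid_probe_unique[OF P v that] by (metis prod.collapse)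
  qed (use v in simp)
  have ex: "\<exists>q d. valid_probe \<omega> (convex hull V) L q d" using v by blast
  show ?thesis
    unfolding probe_result_def the Let_def by (simp only: ex if_True fst_conv snd_conv)
qed

text \<open>Two edges on one ray have collinear ends, hence the same ends, and cannot be each
  other's reverse. On different rays their directions would differ by \<omega>, which genericity
  forbids.\<close>

lemma touched_unique:
  assumes P: "convex_gon \<omega> V" "generic \<omega> V" and e: "edge V a b" "edge V c d"
    and t: "touched \<omega> V L a b" "touched \<omega> V L c d"
  shows "(c, d) = (a, b)"
proof -
  obtain q u where v: "valid_probe \<omega> (convex hull V) L q u"
    "a \<in> ray q u \<and> b \<in> ray q u \<or> a \<in> ray q (cis \<omega> * u) \<and> b \<in> ray q (cis \<omega> * u)"
    using t(1) by (auto simp: touched_def)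
  have v': "c \<in> ray q u \<and> d \<in> ray q u \<or> c \<in> ray q (cis \<omega> * u) \<and> d \<in> ray q (cis \<omega> * u)"
    using t(2) valid_probe_unique[OF P(1) v(1)] by (auto simp: touched_def)
  have same: "cr (y - x) (z - x) = 0"
    if h: "x \<in> ray q w" "y \<in> ray q w" "z \<in> ray q w" for x y z w
  proof -
    obtain r s t where "x = q + of_real r * w" "y = q + of_real s * w" "z = q + of_real t * w"
      using h unfolding ray_def by blast
    then show ?thesis by (simp add: cr_def algebra_simps)
  qed
  have diff: "\<exists>t. y - x = of_real t * w"
    if h: "x \<in> ray q w" "y \<in> ray q w" for x y w
  proof -
    obtain r s where "x = q + of_real r * w" "y = q + of_real s * w"
      using h unfolding ray_def by blast
    then have "y - x = of_real (s - r) * w" by (simp add: algebra_simps)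
    then show ?thesis ..
  qed
  have ortho: False
    if h: "edge V a b" "edge V c d" "a \<in> ray q u" "b \<in> ray q u" "c \<in> ray q (cis \<omega> * u)" "d \<in> ray q (cis \<omega> * u)" for a b c d
  proof -
    obtain s t where "b - a = of_real s * u" "d - c = of_real t * (cis \<omega> * u)"
      using diff[OF h(3,4)] diff[OF h(5,6)] by blast
    then have "cr (cis \<omega> * (b - a)) (d - c) = 0"
      by (metis cr_of_real cr_self mult.left_commute mult_zero_right)
    then show False using P(2) h(1,2) by (auto simp: generic_def)
  qed
  have "\<not> edge V b a" using edge_asym[OF P(1) e(1)] .
  consider w where "a \<in> ray q w" "b \<in> ray q w" "c \<in> ray q w" "d \<in> ray q w"
    using v(2) v' ortho e by blast
  then show ?thesis
  proof cases
    case 1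
    then have "cr (b - a) (c - a) = 0" "cr (b - a) (d - a) = 0" using same by blast+
    then show ?thesis
      using edge_eq_0[OF e(1)] edgeD[OF e(2)] \<open>\<not> edge V b a\<close> e(2) by (metis)
  qed
qed

text \<open>When neither ray carries the edge, its midpoint is strictly inside the wedge, and a
  vertex nearby disturbs neither the validity of the wedge nor the contacts. After a miss by a
  proper line, \<open>valid_probe_exists\<close> shows that the line avoids the polygon, so the
  midpoint and all points near it are strictly on the polygon's side.\<close>

lemma probe_stable:
  assumes P: "convex_gon \<omega> V" and e: "edge V a b" and nt: "\<not> touched \<omega> V L a b"
  shows "\<forall>\<^sub>F x in nhds ((a + b) / 2). convex_gon \<omega> (insert x V) \<longrightarrow>
     (\<forall>q d. valid_probe \<omega> (convex hull insert x V) L q d \<longleftrightarrow> valid_probe \<omega> (convex hull V) L q d) \<and>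
     (\<forall>q d. valid_probe \<omega> (convex hull V) L q d \<longrightarrow> x \<notin> ray q d \<and> x \<notin> ray q (cis \<omega> * d)) \<and>
     probe_result \<omega> (convex hull insert x V) L = probe_result \<omega> (convex hull V) L"
proof -
  define m where "m = (a + b) / 2"
  have fin: "finite V" using convex_gonD[OF P] by simp
  note eD = edgeD[OF e]
  show ?thesis
  proof (cases "\<exists>q d. valid_probe \<omega> (convex hull V) L q d")
    case True
    then obtain q d where v: "valid_probe \<omega> (convex hull V) L q d" by blast
    note v1 = v[unfolded valid_probe_hull_iff[OF fin]]
    have d: "norm d = 1" using v1 by simp
    have W: "0 \<le> cr d (v - q)" "0 \<le> cr (v - q) (cis \<omega> * d)" if "v \<in> V" for v
      using v1 wedge_iff[OF d] that by auto
    have "0 < cr d (a - q) + cr d (b - q)"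
    proof (rule ccontr)
      assume "\<not> ?thesis"
      then have "cr d (a - q) = 0" "cr d (b - q) = 0" using W eD(1,2) by (smt (verit))+
      then have "a \<in> ray q d" "b \<in> ray q d" using ray1_iff[OF d] W eD(1,2) by auto
      then show False using nt v by (auto simp: touched_def)
    qed
    also have "\<dots> = 2 * cr d (m - q)" by (simp add: m_def cr_def field_simps)
    finally have m1: "0 < cr d (m - q)" by simp
    have "0 < cr (a - q) (cis \<omega> * d) + cr (b - q) (cis \<omega> * d)"
    proof (rule ccontr)
      assume "\<not> ?thesis"
      then have "cr (a - q) (cis \<omega> * d) = 0" "cr (b - q) (cis \<omega> * d) = 0" using W eD(1,2) by (smt (verit))+
      then have "a \<in> ray q (cis \<omega> * d)" "b \<in> ray q (cis \<omega> * d)" using ray2_iff[OF d] W eD(1,2) by auto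
      then show False using nt v by (auto simp: touched_def)
    qed
    also have "\<dots> = 2 * cr (m - q) (cis \<omega> * d)"
      unfolding m_def cr_def[of _ "cis \<omega> * d"] by (simp add: field_simps)
    finally have m2: "0 < cr (m - q) (cis \<omega> * d)" by simp
    have "\<forall>\<^sub>F x in nhds m. 0 < cr d (x - q)" using eventually_nhds_cr_pos[OF m1] .
    moreover have "\<forall>\<^sub>F x in nhds m. 0 < cr (x - q) (cis \<omega> * d)"
      by (rule eventually_nhds_less[of "\<lambda>x. cr (x - q) (cis \<omega> * d)"])
        (auto intro!: tendsto_intros filterlim_ident m2)
    ultimately show ?thesis
      unfolding m_def[symmetric]
    proof eventually_elim
      case (elim x)
      show ?case
      proof
        let ?V = "insert x V"
        assume P': "convex_gon \<omega> ?V"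
        have fin': "finite ?V" using fin by simp
        have xW: "x \<in> wedge \<omega> q d" using elim wedge_iff[OF d] by simp
        have mono: "convex hull V \<subseteq> convex hull ?V" by (rule hull_mono) auto
        have v': "valid_probe \<omega> (convex hull ?V) L q d"
          unfolding valid_probe_hull_iff[OF fin'] using v1 xW mono by auto
        have iff: "valid_probe \<omega> (convex hull ?V) L q' d' \<longleftrightarrow> valid_probe \<omega> (convex hull V) L q' d'" for q' d'
          using valid_probe_unique[OF P v] valid_probe_unique[OF P' v'] v v' by metis
        have xr: "x \<notin> ray q d" "x \<notin> ray q (cis \<omega> * d)"
          using elim ray1_iff[OF d] ray2_iff[OF d] by auto
        have W': "0 \<le> cr d (v - q)" "0 \<le> cr (v - q) (cis \<omega> * d)" if "v \<in> ?V" for v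
          using W elim that by auto
        have r1: "convex hull ?V \<inter> ray q d = convex hull V \<inter> ray q d"
        proof -
          have "y \<in> convex hull V" if "y \<in> convex hull ?V" "y \<in> ray q d" for y
          proof -
            have "y \<in> convex hull {v \<in> ?V. cr d (v - q) = 0}"
              using that ray1_iff[OF d] by (intro hull_cr_face fin' W') auto
            also have "\<dots> \<subseteq> convex hull V" using elim by (intro hull_mono) auto
            finally show ?thesis .
          qed
          then show ?thesis using mono by blast
        qed
        have sw: "cr (- (cis \<omega> * d)) w = cr w (cis \<omega> * d)" for w
          using cr_swap[of w "cis \<omega> * d"] by (simp add: cr_minus)
        have r2: "convex hull ?V \<inter> ray q (cis \<omega> * d) = convex hull V \<inter> ray q (cis \<omega> * d)"
        proof -
          have "y \<in> convex hull V" if "y \<in> convex hull ?V" "y \<in> ray q (cis \<omega> * d)" for y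
          proof -
            have "y \<in> convex hull {v \<in> ?V. cr (- (cis \<omega> * d)) (v - q) = 0}"
              by (intro hull_cr_face fin') (use that ray2_iff[OF d, of y q] sw W' in auto)
            also have "\<dots> \<subseteq> convex hull V" using elim sw by (intro hull_mono) auto
            finally show ?thesis .
          qed
          then show ?thesis using mono by blast
        qed
        have "probe_result \<omega> (convex hull ?V) L = probe_result \<omega> (convex hull V) L"
          unfolding probe_result_Hit[OF P v] probe_result_Hit[OF P' v'] by (simp only: closest_def r1 r2)
        moreover have "x \<notin> ray q' d' \<and> x \<notin> ray q' (cis \<omega> * d')"
          if "valid_probe \<omega> (convex hull V) L q' d'" for q' d'
          using valid_probe_unique[OF P v that] xr by simp
        ultimately show "(\<forall>q d. valid_probe \<omega> (convex hull ?V) L q d \<longleftrightarrow> valid_probe \<omega> (convex hull V) L q d) \<and>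
          (\<forall>q d. valid_probe \<omega> (convex hull V) L q d \<longrightarrow> x \<notin> ray q d \<and> x \<notin> ray q (cis \<omega> * d)) \<and>
          probe_result \<omega> (convex hull ?V) L = probe_result \<omega> (convex hull V) L"
          using iff by blast
      qed
    qed
  next
    case False
    have key: ?thesis if "\<forall>\<^sub>F x in nhds m. convex_gon \<omega> (insert x V) \<longrightarrow> (\<forall>q d. \<not> valid_probe \<omega> (convex hull insert x V) L q d)"
      using that unfolding m_def by eventually_elim (use False in \<open>auto simp: probe_result_def\<close>)
    show ?thesis
    \<comment> \<open>The type of lines admits the direction zero. Such a line has no valid probe,
      since the apex would have to lie in the polygon.\<close>
    proof (cases "snd L = 0")
      case True
      show ?thesis by (rule key, rule always_eventually) (metis probe_forward(2) True)
    next
      case nz: False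
      have "convex hull V \<inter> line_pts L = {}"
        using valid_probe_exists[OF fin convex_gonD(3)[OF P] nz] False by (metis disjoint_iff)
      then obtain \<delta> where \<delta>: "\<delta> = snd L \<or> \<delta> = - snd L" "\<And>v. v \<in> V \<Longrightarrow> 0 < cr \<delta> (v - fst L)"
        using hull_misses_line[OF fin nz, of "fst L"] by auto
      have "0 < cr \<delta> (a - fst L) + cr \<delta> (b - fst L)" using \<delta>(2) eD(1,2) by (simp add: add_pos_pos)
      also have "\<dots> = 2 * cr \<delta> (m - fst L)" by (simp add: m_def cr_def field_simps)
      finally have "\<forall>\<^sub>F x in nhds m. 0 < cr \<delta> (x - fst L)" by (intro eventually_nhds_cr_pos) simp
      then show ?thesis
      proof (intro key, eventually_elim)
        case (elim x)
        then show ?case using no_valid_probe_off_line[of \<delta> L "insert x V"] \<delta> by auto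
      qed
    qed
  qed
qed

end


section \<open>Generic positions\<close>

text \<open>What touching \<open>cd\<close> with a contact \<open>w\<close> on the other ray demands
  of these three points, without reference to the rest of the polygon, so that bad positions of one
  point can be listed against the others. The apex differs from all three because each has to fix
  the direction of its ray.\<close>

definition wedge_through :: "real \<Rightarrow> dline \<Rightarrow> complex \<Rightarrow> complex \<Rightarrow> complex \<Rightarrow> bool" where
  "wedge_through \<omega> L c d w \<longleftrightarrow> (\<exists>q u. q \<in> line_pts L \<and> q \<noteq> c \<and> q \<noteq> d \<and> q \<noteq> w \<and>
     (c \<in> ray q u \<and> d \<in> ray q u \<and> w \<in> ray q (cis \<omega> * u) \<or>
      c \<in> ray q (cis \<omega> * u) \<and> d \<in> ray q (cis \<omega> * u) \<and> w \<in> ray q u))"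

lemma wedge_through_commute: "wedge_through \<omega> L c d w \<longleftrightarrow> wedge_through \<omega> L d c w"
  unfolding wedge_through_def by (intro ex_cong1) auto

lemma ray_diff:
  assumes "x \<in> ray q u"
  obtains t where "x - q = of_real t * u"
proof -
  obtain t where "x = q + of_real t * u" using assms unfolding ray_def by blast
  then have "x - q = of_real t * u" by simp
  then show ?thesis by (rule that)
qed

lemma ray_collinear: "x \<in> ray q u \<Longrightarrow> y \<in> ray q u \<Longrightarrow> cr (x - q) (y - q) = 0"
  by (metis cr_of_real cr_self mult_zero_right ray_diff)

lemma ray_rotated:
  assumes "x \<in> ray q u" "y \<in> ray q (cis \<omega> * u)"
  shows "cr (cis \<omega> * (x - q)) (y - q) = 0" "cr (cis (- \<omega>) * (y - q)) (x - q) = 0"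
proof -
  obtain s t where st: "x - q = of_real s * u" "y - q = of_real t * (cis \<omega> * u)"
    using ray_diff[OF assms(1)] ray_diff[OF assms(2)] by metis
  have "cis \<omega> * (x - q) = of_real s * (cis \<omega> * u)" unfolding st by simp
  then show "cr (cis \<omega> * (x - q)) (y - q) = 0" unfolding st(2) by (simp only: cr_of_real cr_self mult_zero_right)
  have "cis (- \<omega>) * (y - q) = of_real t * (cis (- \<omega>) * cis \<omega> * u)" unfolding st by (simp only: mult_ac)
  then have "cis (- \<omega>) * (y - q) = of_real t * u" by (simp add: cis_mult)
  then show "cr (cis (- \<omega>) * (y - q)) (x - q) = 0" unfolding st(1) by (simp only: cr_of_real cr_self mult_zero_right)
qed

lemma negligible_UN: "finite I \<Longrightarrow> (\<And>i. i \<in> I \<Longrightarrow> negligible (A i)) \<Longrightarrow> negligible (\<Union>i\<in>I. A i)"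
  by (intro negligible_Union) auto

text \<open>The points beyond the edge and close to its midpoint form a nonempty open set, which no
  null set covers. A small step from the midpoint along the outer normal shows that it is
  nonempty.\<close>

lemma pick_outside:
  assumes "\<forall>\<^sub>F x in nhds ((a + b) / 2). P x" "a \<noteq> b" "negligible N"
  obtains x where "P x" "cr (b - a) (x - a) < 0" "x \<notin> N"
proof -
  define m where "m = (a + b) / 2"
  obtain S where S: "open S" "m \<in> S" "\<And>x. x \<in> S \<Longrightarrow> P x"
    using assms(1) unfolding eventually_nhds m_def by blast
  obtain \<epsilon> where \<epsilon>: "0 < \<epsilon>" "ball m \<epsilon> \<subseteq> S" using S openE by blast
  define T where "T = S \<inter> {x. cr (b - a) (x - a) < 0}"
  have "{x. cr (b - a) (x - a) < 0} = {x. (Complex (- Im (b - a)) (Re (b - a))) \<bullet> x < cr (b - a) a}"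
    by (auto simp: cr_def inner_complex_def algebra_simps)
  then have "open {x. cr (b - a) (x - a) < 0}" by (simp add: open_halfspace_lt)
  then have "open T" unfolding T_def using S by auto
  moreover have "T \<noteq> {}"
  proof -
    define \<eta> where "\<eta> = \<epsilon> / (2 * norm (b - a))"
    have \<eta>: "0 < \<eta>" using \<epsilon> assms(2) by (simp add: \<eta>_def)
    define y where "y = m - of_real \<eta> * (\<i> * (b - a))"
    have "dist m y = \<eta> * norm (b - a)"
      using \<eta> by (simp add: y_def dist_norm norm_mult)
    also have "\<dots> < \<epsilon>" using \<epsilon> assms(2) by (simp add: \<eta>_def)
    finally have "y \<in> S" using \<epsilon>(2) by auto
    have "cr (b - a) (y - a) = - \<eta> * (norm (b - a))\<^sup>2"
      unfolding cmod_power2 by (simp add: y_def m_def cr_def power2_eq_square field_simps)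
    also have "\<dots> < 0" using \<eta> assms(2) by simp
    finally show ?thesis using \<open>y \<in> S\<close> T_def by auto
  qed
  ultimately have "\<not> T \<subseteq> N" using open_not_negligible negligible_subset assms(3) by blast
  then show ?thesis using that S(3) T_def by auto
qed

section \<open>Null sets of bad positions for a single vertex\<close>

context wedge_angle
begin

text \<open>The equation describes a circle of constant viewing angle, which the line meets at most
  twice: in the line parameter it is quadratic with leading coefficient \<open>C\<close>, equal to
  \<open>- (norm \<delta>)\<^sup>2 * sin \<omega>\<close>.\<close>

lemma finite_apexes:
  assumes "snd L \<noteq> 0"
  shows "finite {q \<in> line_pts L. cr (cis \<omega> * (a - q)) (b - q) = 0}"
proof -
  obtain l \<delta> where L: "L = (l, \<delta>)" by (cases L)
  define A B C where "A = cr (cis \<omega> * (a - l)) (b - l)"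
    and "B = - cr (cis \<omega> * (a - l)) \<delta> - cr (cis \<omega> * \<delta>) (b - l)" and "C = cr (cis \<omega> * \<delta>) \<delta>"
  have "C \<noteq> 0" using assms sin_pos unfolding C_def cr_cis_self L by simp
  then have "finite {t. poly [:A, B, C:] t = 0}" by (intro poly_roots_finite) simp
  moreover have "{q \<in> line_pts L. cr (cis \<omega> * (a - q)) (b - q) = 0}
      \<subseteq> (\<lambda>t. l + of_real t * \<delta>) ` {t. poly [:A, B, C:] t = 0}"
  proof
    fix q assume q: "q \<in> {q \<in> line_pts L. cr (cis \<omega> * (a - q)) (b - q) = 0}"
    then obtain t where t: "q = l + of_real t * \<delta>" by (auto simp: line_pts_def L)
    have e: "cis \<omega> * (a - q) = cis \<omega> * (a - l) - of_real t * (cis \<omega> * \<delta>)" "b - q = b - l - of_real t * \<delta>"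
      unfolding t by (simp_all only: right_diff_distrib distrib_left mult_ac diff_diff_eq)
    have "cr (cis \<omega> * (a - q)) (b - q) = A + t * (B + t * C)"
      unfolding e cr_diff(1)[of "cis \<omega> * (a - l)"] cr_diff(2)[of _ "b - l"] cr_of_real A_def B_def C_def
      by (simp add: algebra_simps)
    then have "poly [:A, B, C:] t = 0" using q by simp
    then show "q \<in> (\<lambda>t. l + of_real t * \<delta>) ` {t. poly [:A, B, C:] t = 0}" using t by blast
  qed
  ultimately show ?thesis by (meson finite_imageI finite_subset)
qed

text \<open>The fixed points \<open>c\<close> and \<open>w\<close> on different rays leave finitely
  many choices for the apex, and \<open>x\<close> must lie on the line from the apex to
  \<open>c\<close>.\<close>

lemma negligible_wedge_through_side:
  assumes "snd L \<noteq> 0"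
  shows "negligible {x. wedge_through \<omega> L c x w}"
proof -
  define Q where "Q = {q \<in> line_pts L. cr (cis \<omega> * (c - q)) (w - q) = 0} \<union>
    {q \<in> line_pts L. cr (cis \<omega> * (w - q)) (c - q) = 0} - {c}"
  have "finite Q" unfolding Q_def using finite_apexes[OF assms] by blast
  then have "negligible (\<Union>q\<in>Q. {x. cr (c - q) (x - q) = 0})"
    by (intro negligible_UN negligible_cr_line) (auto simp: Q_def)
  moreover have "{x. wedge_through \<omega> L c x w} \<subseteq> (\<Union>q\<in>Q. {x. cr (c - q) (x - q) = 0})"
  proof
    fix x assume "x \<in> {x. wedge_through \<omega> L c x w}"
    then obtain q u where q: "q \<in> line_pts L" "q \<noteq> c"
      "c \<in> ray q u \<and> x \<in> ray q u \<and> w \<in> ray q (cis \<omega> * u) \<or>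
       c \<in> ray q (cis \<omega> * u) \<and> x \<in> ray q (cis \<omega> * u) \<and> w \<in> ray q u"
      unfolding wedge_through_def by blast
    then have "cr (cis \<omega> * (c - q)) (w - q) = 0 \<or> cr (cis \<omega> * (w - q)) (c - q) = 0"
      "cr (c - q) (x - q) = 0"
      using ray_rotated(1) ray_collinear by blast+
    then show "x \<in> (\<Union>q\<in>Q. {x. cr (c - q) (x - q) = 0})" using q by (auto simp: Q_def)
  qed
  ultimately show ?thesis by (rule negligible_subset)
qed

text \<open>The apex is where the line of \<open>c\<close> and \<open>d\<close> crosses
  \<open>L\<close>, at most one point unless both lie on \<open>L\<close>. Then \<open>x\<close> is
  on one of two lines through it, turned by \<omega> in either sense.\<close>

lemma negligible_wedge_through_opposite:
  assumes "snd L \<noteq> 0" "c \<noteq> d" "\<not> (c \<in> line_pts L \<and> d \<in> line_pts L)"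
  shows "negligible {x. wedge_through \<omega> L c d x}"
proof -
  define Q where "Q = {q \<in> line_pts L. cr (d - c) (q - c) = 0 \<and> q \<noteq> c}"
  define B where "B q = {x. cr (cis \<omega> * (c - q)) (x - q) = 0} \<union> {x. cr (cis (- \<omega>) * (c - q)) (x - q) = 0}" for q
  have dc: "d - c \<noteq> 0" using assms by simp
  have uniq: "q' = q" if qQ: "q \<in> Q" "q' \<in> Q" for q q'
  proof (rule ccontr)
    assume "q' \<noteq> q"
    obtain s s' where s: "q = fst L + of_real s * snd L" "q' = fst L + of_real s' * snd L"
      using qQ unfolding Q_def line_pts_def by blast
    have "cr (d - c) (q' - q) = 0"
      using qQ cr_diff(2)[of "d - c" "q' - c" "q - c"] by (simp add: Q_def)
    then obtain k where k: "q' - q = of_real k * (d - c)" using cr_eq_0_cases dc by blast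
    have "k \<noteq> 0" using k \<open>q' \<noteq> q\<close> by auto
    have "cr (d - c) (q - c) = 0" using qQ by (simp add: Q_def)
    then obtain j where j: "q - c = of_real j * (d - c)" using cr_eq_0_cases dc by blast
    have dcL: "d - c = of_real ((s' - s) / k) * snd L"
      using k \<open>k \<noteq> 0\<close> unfolding s by (simp add: field_simps)
    have "c = q - of_real j * (d - c)" using j by (simp add: algebra_simps)
    also have "\<dots> = fst L + of_real (s - j * ((s' - s) / k)) * snd L"
      unfolding dcL s by (simp add: algebra_simps)
    finally have cL: "c = fst L + of_real (s - j * ((s' - s) / k)) * snd L" .
    have "d = c + (d - c)" by simp
    also have "\<dots> = fst L + of_real (s - j * ((s' - s) / k) + (s' - s) / k) * snd L"
      unfolding dcL by (subst cL) (simp add: algebra_simps)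
    finally have "d \<in> line_pts L" unfolding line_pts_def by blast
    then show False using assms(3) cL unfolding line_pts_def by blast
  qed
  have "finite Q"
  proof (cases "Q = {}")
    case False
    then obtain q where "q \<in> Q" by blast
    then have "Q \<subseteq> {q}" using uniq by blast
    then show ?thesis by (rule finite_subset) simp
  qed simp
  then have "negligible (\<Union>q\<in>Q. B q)"
    unfolding B_def by (intro negligible_UN negligible_Un negligible_cr_line) (auto simp: Q_def)
  moreover have "{x. wedge_through \<omega> L c d x} \<subseteq> (\<Union>q\<in>Q. B q)"
  proof
    fix x assume "x \<in> {x. wedge_through \<omega> L c d x}"
    then obtain q u where q: "q \<in> line_pts L" "q \<noteq> c"
      "c \<in> ray q u \<and> d \<in> ray q u \<and> x \<in> ray q (cis \<omega> * u) \<or>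
       c \<in> ray q (cis \<omega> * u) \<and> d \<in> ray q (cis \<omega> * u) \<and> x \<in> ray q u"
      unfolding wedge_through_def by blast
    then have x: "x \<in> B q" and "cr (c - q) (d - q) = 0"
      using ray_rotated ray_collinear unfolding B_def by blast+
    moreover have "cr (d - c) (q - c) = cr (c - q) (d - q)" by (simp add: cr_def algebra_simps)
    ultimately have "q \<in> Q" using q by (simp add: Q_def)
    then show "x \<in> (\<Union>q\<in>Q. B q)" using x by blast
  qed
  ultimately show ?thesis by (rule negligible_subset)
qed

text \<open>The ray without the edge has a contact too, and it differs from both ends because the
  rays meet only in the apex. Touching an edge therefore requires \<open>wedge_through\<close>,
  which generic position can exclude.\<close>

lemma touched_witness:
  assumes P: "convex_gon \<omega> V" and "touched \<omega> V L c d" "c \<in> V" "d \<in> V"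
  obtains q u w where "valid_probe \<omega> (convex hull V) L q u" "w \<in> V" "w \<noteq> c" "w \<noteq> d"
    "c \<in> ray q u \<and> d \<in> ray q u \<and> w \<in> ray q (cis \<omega> * u) \<or>
     c \<in> ray q (cis \<omega> * u) \<and> d \<in> ray q (cis \<omega> * u) \<and> w \<in> ray q u"
    "wedge_through \<omega> L c d w"
proof -
  have fin: "finite V" using convex_gonD[OF P] by simp
  obtain q u where v: "valid_probe \<omega> (convex hull V) L q u"
    and cd: "c \<in> ray q u \<and> d \<in> ray q u \<or> c \<in> ray q (cis \<omega> * u) \<and> d \<in> ray q (cis \<omega> * u)"
    using assms(2) unfolding touched_def by blast
  note v1 = v[unfolded valid_probe_hull_iff[OF fin]]
  obtain w where w: "w \<in> V"
    "c \<in> ray q u \<and> d \<in> ray q u \<and> w \<in> ray q (cis \<omega> * u) \<or>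
     c \<in> ray q (cis \<omega> * u) \<and> d \<in> ray q (cis \<omega> * u) \<and> w \<in> ray q u"
    using cd v1 by blast
  have nq: "x \<noteq> q" if "x \<in> V" for x using probe_forward(1)[OF P v] that hull_inc by metis
  have both: "x = q" if "x \<in> ray q u" "x \<in> ray q (cis \<omega> * u)" for x
  proof -
    have n: "norm u = 1" using v1 by simp
    have "cr u (x - q) = 0" "cr (x - q) (cis \<omega> * u) = 0" using that ray1_iff[OF n] ray2_iff[OF n] by auto
    then show ?thesis using frame_decomp[OF n, of "x - q"] by simp
  qed
  have "w \<noteq> c" "w \<noteq> d" using w both nq by blast+
  moreover have "wedge_through \<omega> L c d w"
    unfolding wedge_through_def using w v1 nq[OF assms(3)] nq[OF assms(4)] nq[OF w(1)] by metis
  ultimately show ?thesis using that v w by blast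
qed

text \<open>The contacts of a probe lie weakly on different sides of the probing line, but all
  vertices lie left of the edge. If the edge is part of that line, one contact is forced onto it, so
  its ray runs along the line and carries the edge. This settles the case that
  \<open>negligible_wedge_through_opposite\<close> leaves open.\<close>

lemma line_edge_touched:
  assumes P: "convex_gon \<omega> V" and v: "valid_probe \<omega> (convex hull V) L q u" and e: "edge V c d"
    and cd: "c \<in> line_pts L" "d \<in> line_pts L"
  shows "touched \<omega> V L c d"
proof -
  define \<delta> e where "\<delta> = snd L" and "e = cis \<omega> * u"
  have fin: "finite V" using convex_gonD[OF P] by simp
  note eD = edgeD[OF e]
  note pf = probe_forward[OF P v, folded \<delta>_def e_def]
  note v1 = v[unfolded valid_probe_hull_iff[OF fin]]
  have n: "norm u = 1" using v1 by simp
  obtain l where l: "q = fst L + of_real l * \<delta>" using v1 by (auto simp: line_pts_def \<delta>_def)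
  have ahead: "\<exists>s. x = q + of_real s * \<delta>" if x: "x \<in> line_pts L" for x
  proof -
    obtain k where "x = fst L + of_real k * \<delta>" using x by (auto simp: line_pts_def \<delta>_def)
    then have "x = q + of_real (k - l) * \<delta>" by (simp add: l algebra_simps)
    then show ?thesis by blast
  qed
  obtain s where s: "c = q + of_real s * \<delta>" using ahead[OF cd(1)] by blast
  obtain t where t: "d = q + of_real t * \<delta>" using ahead[OF cd(2)] by blast
  have W: "0 \<le> cr u (v - q)" "0 \<le> cr (v - q) e" if "v \<in> V" for v
    using v1 wedge_iff[OF n] that by (auto simp: e_def)
  obtain p1 p2 where p: "p1 \<in> V" "p1 \<in> ray q u" "p2 \<in> V" "p2 \<in> ray q e" using v1 e_def by auto
  obtain s1 where s1: "p1 = q + of_real s1 * u" "0 \<le> s1" using p(2) by (auto simp: ray_def)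
  obtain s2 where s2: "p2 = q + of_real s2 * e" "0 \<le> s2" using p(4) by (auto simp: ray_def)
  have "s1 \<noteq> 0" "s2 \<noteq> 0" using pf(1) s1 s2 p hull_inc[of _ V convex] by auto
  then have s12: "0 < s1" "0 < s2" using s1 s2 by auto
  have dc: "d - c = of_real (t - s) * \<delta>" by (simp add: s t algebra_simps)
  have "cr (d - c) (p1 - c) = s1 * ((t - s) * cr \<delta> u)" "cr (d - c) (p2 - c) = s2 * ((t - s) * cr \<delta> e)"
    unfolding dc cr_of_real by (simp_all add: s s1 s2 cr_of_real cr_diff cr_add)
  then have g: "0 \<le> (t - s) * cr \<delta> u" "0 \<le> (t - s) * cr \<delta> e"
    using edge_nonneg[OF e p(1)] edge_nonneg[OF e p(3)] s12
    by (metis mult_le_cancel_left_pos mult_zero_right)+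
  have "t \<noteq> s" using eD(3) s t by auto
  then consider "s < t" | "t < s" by linarith
  then show ?thesis
  proof cases
    case 1
    then have "cr u \<delta> = 0" using g(1) pf(3) cr_swap[of u \<delta>] by (simp add: zero_le_mult_iff)
    then have "cr u (c - q) = 0" "cr u (d - q) = 0" by (simp_all add: s t cr_of_real)
    then have "c \<in> ray q u" "d \<in> ray q u" using ray1_iff[OF n] W eD(1,2) by (auto simp: e_def)
    then show ?thesis unfolding touched_def using v by blast
  next
    case 2
    then have "cr \<delta> e = 0" using g(2) pf(4) by (simp add: zero_le_mult_iff)
    then have "cr (c - q) e = 0" "cr (d - q) e = 0" by (simp_all add: s t cr_of_real)
    then have "c \<in> ray q e" "d \<in> ray q e" using ray2_iff[OF n] W eD(1,2) by (auto simp: e_def)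
    then show ?thesis unfolding touched_def e_def using v by blast
  qed
qed

text \<open>With both contacts still present, the only doubt is whether the line hits the smaller
  polygon ahead of the apex. The probe \<open>v0\<close> shows that it hits it, and the pointed cone
  shows where.\<close>

lemma valid_probe_subset:
  assumes P: "convex_gon \<omega> V'" and v: "valid_probe \<omega> (convex hull V') L q u"
    and sub: "V \<subseteq> V'" and r: "c \<in> V" "c \<in> ray q u" "w \<in> V" "w \<in> ray q (cis \<omega> * u)"
    and v0: "valid_probe \<omega> (convex hull V) L q0 u0"
  shows "valid_probe \<omega> (convex hull V) L q u"
proof -
  have fin: "finite V'" "finite V" using convex_gonD[OF P] sub finite_subset by auto
  note v1 = v[unfolded valid_probe_hull_iff[OF fin(1)]]
  note v2 = v0[unfolded valid_probe_hull_iff[OF fin(2)]]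
  note pf = probe_forward[OF P v]
  have n: "norm u = 1" using v1 by simp
  obtain t0 where t0: "q0 + of_real t0 * snd L \<in> convex hull V" using v2 by (auto simp: ray_def)
  obtain l l0 where l: "q = fst L + of_real l * snd L" "q0 = fst L + of_real l0 * snd L"
    using v1 v2 by (auto simp: line_pts_def)
  define t where "t = l0 + t0 - l"
  have z: "q + of_real t * snd L \<in> convex hull V" using t0 unfolding l t_def by (simp add: algebra_simps)
  also have "convex hull V \<subseteq> wedge \<omega> q u"
    using v1 sub hull_subset_wedge_iff[OF n, of V q] by blast
  finally have "0 \<le> cr u (of_real t * snd L)" "0 \<le> cr (of_real t * snd L) (cis \<omega> * u)"
    using wedge_iff[OF n] by auto
  then have "0 \<le> t" using cone_pointed[OF n pf(3,4)] pf(2) by blast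
  then have "q + of_real t * snd L \<in> ray q (snd L)" unfolding ray_def by blast
  then show ?thesis unfolding valid_probe_hull_iff[OF fin(2)] using v1 sub r z by blast
qed

text \<open>The edge \<open>ab\<close> disappears, and the old probe touched no other. A newly
  touched edge would have \<open>x\<close> as an end or as the contact on the other ray, and both
  happen only on null sets. If \<open>x\<close> is not involved, the same wedge touched that edge
  before.\<close>

lemma insert_untouched:
  assumes P: "convex_gon \<omega> V" "generic \<omega> V" and e: "edge V a b" and t: "touched \<omega> V L a b"
  obtains N where "negligible N"
    "\<forall>\<^sub>F x in nhds ((a + b) / 2). cr (b - a) (x - a) < 0 \<and> x \<notin> N \<longrightarrow>
       (\<forall>c d. edge (insert x V) c d \<longrightarrow> \<not> touched \<omega> (insert x V) L c d)"
proof -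
  have fin: "finite V" using convex_gonD[OF P(1)] by simp
  obtain q0 u0 where v0: "valid_probe \<omega> (convex hull V) L q0 u0" using t by (auto simp: touched_def)
  have nz: "snd L \<noteq> 0" using probe_forward(2)[OF P(1) v0] .
  define N1 where "N1 = (\<Union>(c, w)\<in>V \<times> V. {x. wedge_through \<omega> L c x w})"
  define N2 where "N2 = (\<Union>(c, d)\<in>{(c, d)\<in>V \<times> V. c \<noteq> d \<and> \<not> (c \<in> line_pts L \<and> d \<in> line_pts L)}. {x. wedge_through \<omega> L c d x})"
  have "finite {(c, d)\<in>V \<times> V. c \<noteq> d \<and> \<not> (c \<in> line_pts L \<and> d \<in> line_pts L)}"
    by (rule finite_subset[of _ "V \<times> V"]) (use fin in auto)
  then have N: "negligible (N1 \<union> N2)"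
    unfolding N1_def N2_def using fin negligible_wedge_through_side[OF nz] negligible_wedge_through_opposite[OF nz]
    by (intro negligible_Un negligible_UN) auto
  show ?thesis
  proof (rule that[OF N])
    show "\<forall>\<^sub>F x in nhds ((a + b) / 2). cr (b - a) (x - a) < 0 \<and> x \<notin> N1 \<union> N2 \<longrightarrow>
       (\<forall>c d. edge (insert x V) c d \<longrightarrow> \<not> touched \<omega> (insert x V) L c d)"
      using insert_vertex[OF P(1) e]
    proof eventually_elim
      case (elim x)
      show ?case
      proof (intro impI allI notI)
        fix c d
        let ?V = "insert x V"
        assume x: "cr (b - a) (x - a) < 0 \<and> x \<notin> N1 \<union> N2"
          and cd: "edge ?V c d" and tc: "touched \<omega> ?V L c d"
        have P': "convex_gon \<omega> ?V" and xK: "x \<notin> convex hull V" and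
          E: "\<And>c d. edge ?V c d \<longleftrightarrow> edge V c d \<and> (c, d) \<noteq> (a, b) \<or> (c, d) = (a, x) \<or> (c, d) = (x, b)"
          using elim x by blast+
        have xV: "x \<notin> V" using xK hull_inc by metis
        have nb1: "\<not> wedge_through \<omega> L c' x w'" "\<not> wedge_through \<omega> L x c' w'" if "c' \<in> V" "w' \<in> V" for c' w'
        proof -
          show "\<not> wedge_through \<omega> L c' x w'" using x that by (auto simp: N1_def)
          then show "\<not> wedge_through \<omega> L x c' w'" by (simp add: wedge_through_commute)
        qed
        obtain q u w where w: "valid_probe \<omega> (convex hull ?V) L q u" "w \<in> ?V" "w \<noteq> c" "w \<noteq> d"
          "c \<in> ray q u \<and> d \<in> ray q u \<and> w \<in> ray q (cis \<omega> * u) \<or>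
           c \<in> ray q (cis \<omega> * u) \<and> d \<in> ray q (cis \<omega> * u) \<and> w \<in> ray q u"
          "wedge_through \<omega> L c d w"
          using touched_witness[OF P' tc edgeD(1,2)[OF cd]] .
        consider "c = x" "d = b" | "d = x" "c = a" | "edge V c d" "(c, d) \<noteq> (a, b)" using E cd by blast
        then show False
        proof cases
          case 1
          then show False using w nb1(2)[of b w] edgeD(2)[OF e] by auto
        next
          case 2
          then show False using w nb1(1)[of a w] edgeD(1)[OF e] by auto
        next
          case 3
          note cdV = edgeD(1-3)[OF 3(1)]
          have no: "\<not> touched \<omega> V L c d"
            using touched_unique[OF P e 3(1) t] 3(2) by blast
          show False
          proof (cases "w = x")
            case True
            \<comment> \<open>An edge on \<open>L\<close> would have been touched by the old probe
              as well.\<close>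
            have "\<not> (c \<in> line_pts L \<and> d \<in> line_pts L)"
              using line_edge_touched[OF P(1) v0 3(1)] no by blast
            then have "x \<in> N2" unfolding N2_def using w(6) True cdV by auto
            then show False using x by blast
          next
            case False
            then have "w \<in> V" using w(2) by blast
            then have "valid_probe \<omega> (convex hull V) L q u"
              using w(5) cdV valid_probe_subset[OF P' w(1) _ _ _ _ _ v0, of c w]
                valid_probe_subset[OF P' w(1) _ _ _ _ _ v0, of w c] by blast
            then show False using no w(5) unfolding touched_def by blast
          qed
        qed
      qed
    qed
  qed
qed

lemma cr_cis_shift: "cr (cis \<omega> * y) z = - cr (cis (- \<omega>) * z) y"
  by (simp add: cr_def algebra_simps)

lemma cr_cis_self_nonzero: "y \<noteq> 0 \<Longrightarrow> cr (cis \<omega> * y) y \<noteq> 0"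
  using sin_pos by (simp add: cr_cis_self)

text \<open>A new edge against an old one is a matter of avoiding lines through the old vertices.
  The two new edges against each other need an open condition: near the midpoint both are close to
  half of \<open>b - a\<close>, hence almost parallel.\<close>

lemma insert_generic:
  assumes P: "convex_gon \<omega> V" "generic \<omega> V" and e: "edge V a b"
  obtains N where "negligible N"
    "\<forall>\<^sub>F x in nhds ((a + b) / 2). cr (b - a) (x - a) < 0 \<and> x \<notin> N \<longrightarrow> generic \<omega> (insert x V)"
proof -
  define m where "m = (a + b) / 2"
  have fin: "finite V" using convex_gonD[OF P(1)] by simp
  define D where "D = (\<lambda>(c, d). d - c) ` (V \<times> V) - {0}"
  define N where "N = (\<Union>y\<in>D. \<Union>v\<in>V. {x. cr (cis \<omega> * y) (x - v) = 0} \<union> {x. cr (cis (- \<omega>) * y) (x - v) = 0})"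
  have "finite D" using fin by (simp add: D_def)
  then have N: "negligible N"
    unfolding N_def using fin by (intro negligible_UN negligible_Un negligible_cr_line) (auto simp: D_def)
  have ba: "b - a \<noteq> 0" using edgeD(3)[OF e] by simp
  have "cr (cis \<omega> * (m - a)) (b - m) = 1/4 * cr (cis \<omega> * (b - a)) (b - a)"
    unfolding m_def cr_def by (simp add: field_simps)
  then have "cr (cis \<omega> * (m - a)) (b - m) < 0" using ba sin_pos by (simp add: cr_cis_self)
  then have n1: "\<forall>\<^sub>F x in nhds m. cr (cis \<omega> * (x - a)) (b - x) < 0"
    by (intro eventually_nhds_greater[of "\<lambda>x. cr (cis \<omega> * (x - a)) (b - x)"] tendsto_intros filterlim_ident)
  have "cr (cis \<omega> * (b - m)) (m - a) = 1/4 * cr (cis \<omega> * (b - a)) (b - a)"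
    unfolding m_def cr_def by (simp add: field_simps)
  then have "cr (cis \<omega> * (b - m)) (m - a) < 0" using ba sin_pos by (simp add: cr_cis_self)
  then have n2: "\<forall>\<^sub>F x in nhds m. cr (cis \<omega> * (b - x)) (x - a) < 0"
    by (intro eventually_nhds_greater[of "\<lambda>x. cr (cis \<omega> * (b - x)) (x - a)"] tendsto_intros filterlim_ident)
  show ?thesis
  proof (rule that[OF N])
    show "\<forall>\<^sub>F x in nhds ((a + b) / 2). cr (b - a) (x - a) < 0 \<and> x \<notin> N \<longrightarrow> generic \<omega> (insert x V)"
      using insert_vertex[OF P(1) e] n1[unfolded m_def] n2[unfolded m_def]
    proof eventually_elim
      case (elim x)
      show ?case
      proof
        assume x: "cr (b - a) (x - a) < 0 \<and> x \<notin> N"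
        have E: "edge (insert x V) c d \<longleftrightarrow> edge V c d \<and> (c, d) \<noteq> (a, b) \<or> (c, d) = (a, x) \<or> (c, d) = (x, b)"
          and "x \<notin> convex hull V" for c d
          using elim(1) x by blast+
        then have xV: "x \<notin> V" using hull_inc by metis
        have gen: "cr (cis \<omega> * (x - v)) (d - c) \<noteq> 0" "cr (cis \<omega> * (d - c)) (x - v) \<noteq> 0"
          "cr (cis \<omega> * (v - x)) (d - c) \<noteq> 0" "cr (cis \<omega> * (d - c)) (v - x) \<noteq> 0"
          if "edge V c d" "v \<in> V" for c d v
        proof -
          have "d - c \<in> D" using edgeD[OF that(1)] by (force simp: D_def)
          then have *: "cr (cis \<omega> * (d - c)) (x - v) \<noteq> 0" "cr (cis (- \<omega>) * (d - c)) (x - v) \<noteq> 0"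
            using x that(2) unfolding N_def by blast+
          then show "cr (cis \<omega> * (x - v)) (d - c) \<noteq> 0" "cr (cis \<omega> * (d - c)) (x - v) \<noteq> 0"
            using cr_cis_shift[of "x - v" "d - c"] by simp_all
          moreover have "v - x = - (x - v)" by simp
          ultimately show "cr (cis \<omega> * (v - x)) (d - c) \<noteq> 0" "cr (cis \<omega> * (d - c)) (v - x) \<noteq> 0"
            by (metis cr_minus mult_minus_right neg_equal_0_iff_equal)+
        qed
        have V: "a \<in> V" "b \<in> V" using edgeD[OF e] by auto
        then have "x \<noteq> a" "x \<noteq> b" using xV by auto
        have old: "cr (cis \<omega> * (d - c)) (d' - c') \<noteq> 0" if "edge V c d" "edge V c' d'" for c d c' d'
          using P(2) that by (auto simp: generic_def)
        show "generic \<omega> (insert x V)"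
          unfolding generic_def E
        proof (intro allI impI)
          fix c d c' d'
          assume "edge V c d \<and> (c, d) \<noteq> (a, b) \<or> (c, d) = (a, x) \<or> (c, d) = (x, b)"
            "edge V c' d' \<and> (c', d') \<noteq> (a, b) \<or> (c', d') = (a, x) \<or> (c', d') = (x, b)"
          then show "cr (cis \<omega> * (d - c)) (d' - c') \<noteq> 0"
            using old gen[of _ _ a] gen[of _ _ b] V elim(2,3) \<open>x \<noteq> a\<close> \<open>x \<noteq> b\<close>
              cr_cis_self_nonzero[of "x - a"] cr_cis_self_nonzero[of "b - x"] by auto
        qed
      qed
    qed
  qed
qed

end


section \<open>The adversary against a correct strategy\<close>

lemma run_prefix_eq:
  assumes "\<And>j. j < k \<Longrightarrow> \<sigma> p c r (run \<omega> \<sigma> K p c r j) = Inl (L j)"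
    and "\<And>j. j < k \<Longrightarrow> probe_result \<omega> K' (L j) = probe_result \<omega> K (L j)"
  shows "j \<le> k \<Longrightarrow> run \<omega> \<sigma> K' p c r j = run \<omega> \<sigma> K p c r j"
proof (induction j)
  case (Suc j)
  then show ?case using assms[of j] by (simp add: Let_def)
qed simp

lemma run_stopped:
  assumes "\<sigma> p c r (run \<omega> \<sigma> K p c r N) = Inr X" "N \<le> k"
  shows "run \<omega> \<sigma> K p c r k = run \<omega> \<sigma> K p c r N"
  using assms(2)
proof (induction k rule: dec_induct)
  case (step k)
  then show ?case using assms(1) by (simp add: Let_def)
qed simp

text \<open>\<open>determines\<close> promises the right output at some index only. The history is
  frozen from the first stop on, so that output is already the one given at the first stop.\<close>

lemma determines_stopped:
  assumes "determines \<omega> \<sigma> K p c r" and "\<sigma> p c r (run \<omega> \<sigma> K p c r N) = Inr X"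
    and "\<And>j. j < N \<Longrightarrow> isl (\<sigma> p c r (run \<omega> \<sigma> K p c r j))"
  shows "X = K"
proof -
  obtain k where k: "\<sigma> p c r (run \<omega> \<sigma> K p c r k) = Inr K" using assms(1) by (auto simp: determines_def)
  then have "N \<le> k" using assms(3)[of k] by (metis isl_def not_le sum.distinct(1))
  then show ?thesis using run_stopped[of \<sigma> p c r \<omega> K N X k] assms(2) k by simp
qed

lemma half_sum_in_ball:
  assumes "a \<in> ball c r" "b \<in> ball c r"
  shows "(a + b) / 2 \<in> ball (c::complex) r"
proof -
  have "(a + b) / 2 = (1/2) *\<^sub>R a + (1/2) *\<^sub>R b" by (simp add: scaleR_conv_of_real)
  also have "\<dots> \<in> ball c r" by (rule convexD[OF convex_ball assms]) auto
  finally show ?thesis .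
qed

section \<open>Growing polygons and counting untouched edges\<close>

locale correct_prober = wedge_angle +
  fixes \<sigma> :: strategy and p c :: complex and r :: real
  assumes correct: "correct_strategy \<omega> \<sigma>" and r_pos: "0 < r"
begin

abbreviation ans :: "complex set \<Rightarrow> nat \<Rightarrow> dline + complex set" where
  "ans V k \<equiv> \<sigma> p c r (run \<omega> \<sigma> (convex hull V) p c r k)"

text \<open>The prober knows \<open>p\<close>, \<open>c\<close>, \<open>r\<close> from the outset,
  so all polygons of the adversary share them. The ball is open in order to leave room for new
  vertices.\<close>

definition admissible :: "complex set \<Rightarrow> bool" where
  "admissible V \<longleftrightarrow> convex_gon \<omega> V \<and> generic \<omega> V \<and> p \<in> convex hull V \<and> V \<subseteq> ball c r"

text \<open>The condition concerns questions, not the last answer: the \<open>N\<close>-th line is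
  chosen after only \<open>N - 1\<close> answers. This leaves the freedom to alter the polygon in a
  way that changes the latest answer.\<close>

definition evades :: "complex set \<Rightarrow> nat \<Rightarrow> bool" where
  "evades V N \<longleftrightarrow> (\<forall>j<N. \<exists>L. ans V j = Inl L \<and> (\<forall>a b. edge V a b \<longrightarrow> \<not> touched \<omega> V L a b))"

lemma admissible_determines:
  assumes "convex_gon \<omega> V" "p \<in> convex hull V" "V \<subseteq> ball c r"
  shows "determines \<omega> \<sigma> (convex hull V) p c r"
proof -
  have "convex hull V \<subseteq> cball c r"
    using assms(3) by (intro hull_minimal convex_cball) auto
  then show ?thesis
    using correct convex_gon_convex_polygon[OF assms(1)] assms(2) r_pos unfolding correct_strategy_def by blast
qed

lemma cannot_stop:
  assumes V: "admissible V" and e: "edge V a b"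
    and L: "\<And>j. j < N \<Longrightarrow> ans V j = Inl (L j)" "\<And>j. j < N \<Longrightarrow> \<not> touched \<omega> V (L j) a b"
  shows "isl (ans V N)"
proof (rule ccontr)
  assume "\<not> isl (ans V N)"
  then obtain X where X: "ans V N = Inr X" by (metis sum.collapse(2))
  have P: "convex_gon \<omega> V" "p \<in> convex hull V" "V \<subseteq> ball c r" using V by (auto simp: admissible_def)
  have "X = convex hull V"
    by (rule determines_stopped[OF admissible_determines[OF P] X]) (simp add: L)
  define m where "m = (a + b) / 2"
  have "m \<in> ball c r"
    unfolding m_def using edgeD(1,2)[OF e] P(3) by (intro half_sum_in_ball) auto
  then have "\<forall>\<^sub>F x in nhds m. x \<in> ball c r" by (intro eventually_nhds_in_open) auto
  moreover have "\<forall>\<^sub>F x in nhds m. \<forall>j\<in>{..<N}. convex_gon \<omega> (insert x V) \<longrightarrow>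
      probe_result \<omega> (convex hull insert x V) (L j) = probe_result \<omega> (convex hull V) (L j)"
    unfolding m_def
    by (intro eventually_ball_finite ballI eventually_mono[OF probe_stable[OF P(1) e L(2)]]) auto
  moreover note insert_vertex[OF P(1) e, folded m_def]
  ultimately have "\<forall>\<^sub>F x in nhds m. cr (b - a) (x - a) < 0 \<longrightarrow> x \<in> ball c r \<and> convex_gon \<omega> (insert x V) \<and>
      x \<notin> convex hull V \<and>
      (\<forall>j\<in>{..<N}. probe_result \<omega> (convex hull insert x V) (L j) = probe_result \<omega> (convex hull V) (L j))"
    by eventually_elim blast
  from pick_outside[OF this[unfolded m_def] edgeD(3)[OF e] negligible_empty]
  obtain x where x: "x \<in> ball c r" "convex_gon \<omega> (insert x V)" "x \<notin> convex hull V"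
    "\<forall>j\<in>{..<N}. probe_result \<omega> (convex hull insert x V) (L j) = probe_result \<omega> (convex hull V) (L j)"
    by blast
  have same: "run \<omega> \<sigma> (convex hull insert x V) p c r j = run \<omega> \<sigma> (convex hull V) p c r j" if "j \<le> N" for j
    using run_prefix_eq[of N \<sigma> p c r \<omega> "convex hull V" L "convex hull insert x V"] L(1) x(4) that by auto
  have "p \<in> convex hull insert x V" using P(2) hull_mono[of V "insert x V" convex] by blast
  then have det: "determines \<omega> \<sigma> (convex hull insert x V) p c r"
    using admissible_determines[OF x(2)] P(3) x(1) by simp
  have "X = convex hull insert x V"
    by (rule determines_stopped[OF det, of N]) (simp_all add: same X L)
  moreover have "x \<in> convex hull insert x V" by (simp add: hull_inc)
  ultimately show False using x(3) \<open>X = convex hull V\<close> by simp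
qed

lemma evadesE:
  assumes "evades V N"
  obtains L where "\<And>j. j < N \<Longrightarrow> ans V j = Inl (L j)"
    "\<And>j a b. j < N \<Longrightarrow> edge V a b \<Longrightarrow> \<not> touched \<omega> V (L j) a b"
  using assms unfolding evades_def by metis

lemma convex_gon_edge_exists:
  assumes "convex_gon \<omega> V"
  obtains a b where "edge V a b"
  using convex_gonD(3,4)[OF assms] by blast

lemma evades_grow:
  assumes V: "admissible V" and ev: "evades V N"
  shows "\<exists>V'. admissible V' \<and> card V' = Suc (card V) \<and> evades V' (Suc N)"
proof -
  have P: "convex_gon \<omega> V" "generic \<omega> V" "p \<in> convex hull V" "V \<subseteq> ball c r" using V by (auto simp: admissible_def)
  obtain L0 where L0: "\<And>j. j < N \<Longrightarrow> ans V j = Inl (L0 j)"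
    "\<And>j a b. j < N \<Longrightarrow> edge V a b \<Longrightarrow> \<not> touched \<omega> V (L0 j) a b" using evadesE[OF ev] by blast
  obtain a0 b0 where "edge V a0 b0" using convex_gon_edge_exists[OF P(1)] .
  then have "isl (ans V N)" using cannot_stop[OF V _ L0(1) L0(2)] by blast
  then obtain LN where LN: "ans V N = Inl LN" by (auto simp: isl_def)
  define L where "L = L0(N := LN)"
  have L: "ans V j = Inl (L j)" if "j \<le> N" for j using L0(1) LN that by (auto simp: L_def)
  have nt: "\<not> touched \<omega> V (L j) c d" if "j < N" "edge V c d" for j c d using L0(2) that by (auto simp: L_def)
  \<comment> \<open>If the new line touches an edge, that edge must be broken. Otherwise any edge
    serves, and \<open>probe_stable\<close> applies to the new line as well.\<close>
  obtain a b where e: "edge V a b" and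
    tch: "touched \<omega> V LN a b \<or> (\<forall>c d. edge V c d \<longrightarrow> \<not> touched \<omega> V LN c d)"
    using \<open>edge V a0 b0\<close> by blast
  define m where "m = (a + b) / 2"
  have "m \<in> ball c r"
    unfolding m_def using edgeD(1,2)[OF e] P(4) by (intro half_sum_in_ball) auto
  then have ball: "\<forall>\<^sub>F x in nhds m. x \<in> ball c r" by (intro eventually_nhds_in_open) auto
  obtain N1 where N1: "negligible N1"
    "\<forall>\<^sub>F x in nhds m. cr (b - a) (x - a) < 0 \<and> x \<notin> N1 \<longrightarrow> generic \<omega> (insert x V)"
    by (rule insert_generic[OF P(1,2) e, folded m_def])
  define stable where "stable x L' \<longleftrightarrow> (convex_gon \<omega> (insert x V) \<longrightarrow>
     (\<forall>q d. valid_probe \<omega> (convex hull insert x V) L' q d \<longleftrightarrow> valid_probe \<omega> (convex hull V) L' q d) \<and>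
     (\<forall>q d. valid_probe \<omega> (convex hull V) L' q d \<longrightarrow> x \<notin> ray q d \<and> x \<notin> ray q (cis \<omega> * d)) \<and>
     probe_result \<omega> (convex hull insert x V) L' = probe_result \<omega> (convex hull V) L')" for x L'
  have st: "\<forall>\<^sub>F x in nhds m. stable x L'" if "\<not> touched \<omega> V L' a b" for L'
    unfolding stable_def m_def by (rule probe_stable[OF P(1) e that])
  have stN: "\<forall>\<^sub>F x in nhds m. \<forall>j\<in>{..<N}. stable x (L j)"
    by (intro eventually_ball_finite) (use st nt e in auto)
  have vert: "\<forall>\<^sub>F x in nhds m. cr (b - a) (x - a) < 0 \<longrightarrow>
     x \<notin> convex hull V \<and> convex_gon \<omega> (insert x V) \<and>
     (\<forall>c d. edge (insert x V) c d \<longleftrightarrow> edge V c d \<and> (c, d) \<noteq> (a, b) \<or> (c, d) = (a, x) \<or> (c, d) = (x, b))"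
    using insert_vertex[OF P(1) e] by (simp only: m_def)
  have keep: "\<not> touched \<omega> (insert x V) L' c d"
    if s: "stable x L'" and g: "convex_gon \<omega> (insert x V)"
      and no: "\<And>c d. edge V c d \<Longrightarrow> \<not> touched \<omega> V L' c d"
      and cd: "edge V c d \<or> (c, d) = (a, x) \<or> (c, d) = (x, b)" for x L' c d
    using cd s g no unfolding stable_def touched_def by blast
  obtain N2 where N2: "negligible N2"
    "\<forall>\<^sub>F x in nhds m. cr (b - a) (x - a) < 0 \<and> x \<notin> N2 \<longrightarrow>
       (\<forall>c d. edge (insert x V) c d \<longrightarrow> \<not> touched \<omega> (insert x V) LN c d)"
  proof (cases "touched \<omega> V LN a b")
    case True
    show ?thesis by (rule insert_untouched[OF P(1,2) e True, folded m_def]) (rule that)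
  next
    case False
    have "\<forall>\<^sub>F x in nhds m. cr (b - a) (x - a) < 0 \<and> x \<notin> {} \<longrightarrow>
       (\<forall>c d. edge (insert x V) c d \<longrightarrow> \<not> touched \<omega> (insert x V) LN c d)"
      using st[OF False] vert
    proof eventually_elim
      case (elim x)
      then show ?case using keep[of x LN] tch False by blast
    qed
    then show ?thesis using that negligible_empty by blast
  qed
  have "negligible (N1 \<union> N2)" using N1(1) N2(1) by (rule negligible_Un)
  define good where "good x \<longleftrightarrow> x \<in> ball c r \<and> generic \<omega> (insert x V) \<and> (\<forall>j\<in>{..<N}. stable x (L j)) \<and>
     x \<notin> convex hull V \<and> convex_gon \<omega> (insert x V) \<and>
     (\<forall>c d. edge (insert x V) c d \<longleftrightarrow> edge V c d \<and> (c, d) \<noteq> (a, b) \<or> (c, d) = (a, x) \<or> (c, d) = (x, b)) \<and>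
     (\<forall>c d. edge (insert x V) c d \<longrightarrow> \<not> touched \<omega> (insert x V) LN c d)" for x
  have "\<forall>\<^sub>F x in nhds m. cr (b - a) (x - a) < 0 \<longrightarrow> x \<notin> N1 \<union> N2 \<longrightarrow> good x"
    using ball N1(2) stN vert N2(2) unfolding good_def by eventually_elim blast
  from pick_outside[OF this[unfolded m_def] edgeD(3)[OF e] \<open>negligible (N1 \<union> N2)\<close>]
  obtain x where "good x" by blast
  then have x: "x \<in> ball c r" "generic \<omega> (insert x V)" "\<And>j. j < N \<Longrightarrow> stable x (L j)"
     "x \<notin> convex hull V" "convex_gon \<omega> (insert x V)"
     and xE: "\<And>c d. edge (insert x V) c d \<Longrightarrow> edge V c d \<or> (c, d) = (a, x) \<or> (c, d) = (x, b)"
     "\<And>c d. edge (insert x V) c d \<Longrightarrow> \<not> touched \<omega> (insert x V) LN c d"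
    unfolding good_def by auto
  have "p \<in> convex hull insert x V" using P(3) hull_mono[of V "insert x V" convex] by blast
  then have "admissible (insert x V)" using x P(4) by (simp add: admissible_def)
  moreover have "card (insert x V) = Suc (card V)"
  proof -
    have "x \<notin> V" using x(4) hull_inc[of x V convex] by blast
    then show ?thesis by (rule card_insert_disjoint[OF convex_gonD(1)[OF P(1)]])
  qed
  moreover have "evades (insert x V) (Suc N)"
    unfolding evades_def
  proof (intro allI impI)
    fix j assume j: "j < Suc N"
    \<comment> \<open>Up to \<open>j = N\<close> only the first \<open>N\<close> answers occur, and
      these are stable; the answer to \<open>LN\<close> itself may have changed.\<close>
    have "run \<omega> \<sigma> (convex hull insert x V) p c r j = run \<omega> \<sigma> (convex hull V) p c r j"
      using run_prefix_eq[of N \<sigma> p c r \<omega> "convex hull V" L "convex hull insert x V" j] L x(3,5) j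
      unfolding stable_def by auto
    then have "ans (insert x V) j = Inl (L j)" using L j by simp
    moreover have "\<not> touched \<omega> (insert x V) (L j) c d" if cd: "edge (insert x V) c d" for c d
    proof (cases "j = N")
      case True
      then show ?thesis using xE(2)[OF cd] by (simp add: L_def)
    next
      case False
      then have "j < N" using j by simp
      show ?thesis using keep[OF x(3) x(5), of j c d] nt xE(1)[OF cd] \<open>j < N\<close> by blast
    qed
    ultimately show "\<exists>L. ans (insert x V) j = Inl L \<and>
        (\<forall>a b. edge (insert x V) a b \<longrightarrow> \<not> touched \<omega> (insert x V) L a b)" by blast
  qed
  ultimately show ?thesis by blast
qed

lemma evades_grow_iterated:
  assumes "admissible V" "evades V N"
  shows "\<exists>V'. admissible V' \<and> card V' = card V + k \<and> evades V' (N + k)"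
proof (induction k)
  case 0
  then show ?case using assms by auto
next
  case (Suc k)
  then show ?case using evades_grow by (metis add_Suc_right)
qed

text \<open>Each probe after the first \<open>N\<close> touches at most one edge, so after
  \<open>k\<close> probes at most \<open>k - N\<close> edges are touched. As long as this is less
  than the number of edges, \<open>cannot_stop\<close> applies.\<close>

lemma evades_lower_bound:
  assumes V: "admissible V" and ev: "evades V N"
  shows "k < N + card V \<Longrightarrow> isl (ans V k)"
proof (induction k rule: less_induct)
  case (less k)
  have P: "convex_gon \<omega> V" "generic \<omega> V" using V by (auto simp: admissible_def)
  have "\<exists>L. ans V j = Inl L" if "j < k" for j using less that by (auto simp: isl_def)
  then obtain L where L: "\<And>j. j < k \<Longrightarrow> ans V j = Inl (L j)" by metis
  have early: "\<not> touched \<omega> V (L j) a b" if "edge V a b" "j < N" "j < k" for j a b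
    using ev that L[OF that(3)] unfolding evades_def by fastforce
  define E where "E = {(a, b). edge V a b}"
  define T where "T j = {(a, b). edge V a b \<and> touched \<omega> V (L j) a b}" for j
  have "finite E"
    by (rule finite_subset[of _ "V \<times> V"]) (use convex_gonD(1)[OF P(1)] edgeD(1,2) in \<open>auto simp: E_def\<close>)
  have T1: "card (T j) \<le> 1" "finite (T j)" for j
  proof -
    show "finite (T j)" by (rule finite_subset[OF _ \<open>finite E\<close>]) (auto simp: T_def E_def)
    have "x = y" if "x \<in> T j" "y \<in> T j" for x y
      using that touched_unique[OF P] unfolding T_def by blast
    then show "card (T j) \<le> 1" using \<open>finite (T j)\<close> by (metis card_le_Suc0_iff_eq One_nat_def)
  qed
  have "card (\<Union>j\<in>{N..<k}. T j) \<le> (\<Sum>j\<in>{N..<k}. card (T j))" by (rule card_UN_le) simp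
  also have "\<dots> \<le> (\<Sum>j\<in>{N..<k}. 1)" by (intro sum_mono T1)
  also have "\<dots> < card E" using less.prems card_edges[OF P(1)] convex_gonD(2)[OF P(1)] by (simp add: E_def)
  finally have "\<not> E \<subseteq> (\<Union>j\<in>{N..<k}. T j)" using card_mono[of "\<Union>j\<in>{N..<k}. T j" E] T1(2) by auto
  then obtain a b where "(a, b) \<in> E" "(a, b) \<notin> (\<Union>j\<in>{N..<k}. T j)" by auto
  then have ab: "edge V a b" "\<And>j. N \<le> j \<Longrightarrow> j < k \<Longrightarrow> \<not> touched \<omega> V (L j) a b"
    by (auto simp: E_def T_def)
  then have "\<not> touched \<omega> V (L j) a b" if "j < k" for j
    using early that by (cases "j < N") auto
  then show ?case using cannot_stop[OF V ab(1) L] by blast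
qed

lemma evades_many_probes:
  assumes V: "admissible V" "evades V N" and n: "card V \<le> n"
  shows "\<exists>K. convex_polygon_angles_gt \<omega> K n \<and> p \<in> K \<and> 0 < r \<and> K \<subseteq> cball c r \<and>
    makes_at_least \<omega> \<sigma> K p c r (N + (n - card V) + n)"
proof -
  obtain V' where V': "admissible V'" "card V' = card V + (n - card V)" "evades V' (N + (n - card V))"
    using evades_grow_iterated[OF V] by blast
  have P: "convex_gon \<omega> V'" "p \<in> convex hull V'" "V' \<subseteq> ball c r" using V' by (auto simp: admissible_def)
  have "convex hull V' \<subseteq> cball c r" using P(3) by (intro hull_minimal convex_cball) auto
  moreover have "makes_at_least \<omega> \<sigma> (convex hull V') p c r (N + (n - card V) + n)"
    unfolding makes_at_least_def using evades_lower_bound[OF V'(1,3)] V'(2) n by simp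
  ultimately show ?thesis
    using convex_gon_convex_polygon[OF P(1)] V'(2) n P(2) r_pos by (intro exI[of _ "convex hull V'"]) simp
qed

end


section \<open>Moving vertices into generic position\<close>

lemma edge_scale:
  assumes "k \<noteq> 0"
  shows "edge ((*) k ` V) (k * a) (k * b) \<longleftrightarrow> edge V a b"
proof -
  have c: "cr (k * b - k * a) (k * v - k * a) = (norm k)\<^sup>2 * cr (b - a) (v - a)" for v
    unfolding right_diff_distrib[symmetric] cr_mult_left ..
  have m: "k * x \<in> (*) k ` V \<longleftrightarrow> x \<in> V" for x using assms by auto
  show ?thesis unfolding edge_def m ball_simps c using assms by (simp add: zero_less_mult_iff)
qed

lemma convex_gon_scale:
  assumes "k \<noteq> 0" "convex_gon \<omega> V"
  shows "convex_gon \<omega> ((*) k ` V)"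
  unfolding convex_gon_def
proof (intro conjI ballI)
  show "finite ((*) k ` V)" using convex_gonD(1)[OF assms(2)] by simp
  show "3 \<le> card ((*) k ` V)" using convex_gonD(2)[OF assms(2)] assms(1) by (simp add: card_image inj_on_def)
  fix v assume "v \<in> (*) k ` V"
  then obtain w where w: "v = k * w" "w \<in> V" by blast
  then obtain a b where ab: "edge V a w" "edge V w b"
    "(a - w) \<bullet> (b - w) < cos \<omega> * (norm (a - w) * norm (b - w))" using convex_gonD(4)[OF assms(2)] by blast
  have "(norm k)\<^sup>2 * ((a - w) \<bullet> (b - w)) < (norm k)\<^sup>2 * (cos \<omega> * (norm (a - w) * norm (b - w)))"
    using ab(3) assms(1) by simp
  then have "(k * a - k * w) \<bullet> (k * b - k * w) < cos \<omega> * (norm (k * a - k * w) * norm (k * b - k * w))"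
    unfolding right_diff_distrib[symmetric] inner_mult_left_complex norm_mult
    by (simp add: power2_eq_square mult_ac)
  then show "\<exists>a b. edge ((*) k ` V) a v \<and> edge ((*) k ` V) v b \<and>
      (a - v) \<bullet> (b - v) < cos \<omega> * (norm (a - v) * norm (b - v))"
    using edge_scale[OF assms(1)] ab w by blast
qed

lemma generic_scale:
  assumes "k \<noteq> 0" "generic \<omega> V"
  shows "generic \<omega> ((*) k ` V)"
  unfolding generic_def
proof (intro allI impI)
  fix a b c d assume e: "edge ((*) k ` V) a b" "edge ((*) k ` V) c d"
  then obtain a' b' c' d' where w: "a = k * a'" "b = k * b'" "c = k * c'" "d = k * d'"
    using edgeD(1,2) by (metis imageE)
  then have "cr (cis \<omega> * (b' - a')) (d' - c') \<noteq> 0"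
    using e edge_scale[OF assms(1)] assms(2) unfolding generic_def by blast
  moreover have "cr (cis \<omega> * (b - a)) (d - c) = (norm k)\<^sup>2 * cr (cis \<omega> * (b' - a')) (d' - c')"
    unfolding w right_diff_distrib[symmetric] cr_mult_left[symmetric] by (simp only: mult_ac)
  ultimately show "cr (cis \<omega> * (b - a)) (d - c) \<noteq> 0" using assms(1) by simp
qed

lemma tendsto_replace: "((\<lambda>x. if v = x0 then x else v) \<longlongrightarrow> v) (nhds x0)"
  by (cases "v = x0") (auto simp: filterlim_ident)

text \<open>With the pairs of neighbours kept, all conditions are finitely many strict inequalities
  or inequations, continuous in the vertex that \<open>h\<close> moves. No further edges appear,
  because a vertex has only one outgoing edge.\<close>

lemma move_vertex:
  assumes P: "convex_gon \<omega> V" "generic \<omega> V" and x0: "x0 \<in> V"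
  shows "\<forall>\<^sub>F x in nhds x0. convex_gon \<omega> (insert x (V - {x0})) \<and> generic \<omega> (insert x (V - {x0})) \<and>
    card (insert x (V - {x0})) = card V"
proof -
  define h where "h x v = (if v = x0 then x else v)" for x v :: complex
  have fin: "finite V" using convex_gonD(1)[OF P(1)] .
  have h: "((\<lambda>x. h x v) \<longlongrightarrow> v) (nhds x0)" for v unfolding h_def by (rule tendsto_replace)
  have h0: "h x0 v = v" for v by (simp add: h_def)
  have new: "\<forall>\<^sub>F x in nhds x0. \<forall>v\<in>V. v \<noteq> x0 \<longrightarrow> x \<noteq> v"
  proof (intro eventually_ball_finite fin ballI)
    fix v assume "v \<in> V"
    show "\<forall>\<^sub>F x in nhds x0. v \<noteq> x0 \<longrightarrow> x \<noteq> v"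
      using eventually_nhds_in_open[of "- {v}" x0] by (cases "v = x0") (auto elim: eventually_mono)
  qed
  have e: "\<forall>\<^sub>F x in nhds x0. \<forall>c\<in>V. \<forall>d\<in>V. \<forall>v\<in>V. edge V c d \<and> v \<noteq> c \<and> v \<noteq> d \<longrightarrow>
      0 < cr (h x d - h x c) (h x v - h x c)"
  proof (intro eventually_ball_finite fin ballI)
    fix c d v assume cd: "c \<in> V" "d \<in> V" "v \<in> V"
    show "\<forall>\<^sub>F x in nhds x0. edge V c d \<and> v \<noteq> c \<and> v \<noteq> d \<longrightarrow> 0 < cr (h x d - h x c) (h x v - h x c)"
    proof (cases "edge V c d \<and> v \<noteq> c \<and> v \<noteq> d")
      case True
      then have "0 < cr (d - c) (v - c)" using edgeD(4) cd by blast
      moreover have "((\<lambda>x. cr (h x d - h x c) (h x v - h x c)) \<longlongrightarrow> cr (d - c) (v - c)) (nhds x0)"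
        by (intro tendsto_cr tendsto_diff; rule h)
      ultimately have "\<forall>\<^sub>F x in nhds x0. 0 < cr (h x d - h x c) (h x v - h x c)"
        by (rule order_tendstoD(1)[rotated])
      then show ?thesis by (rule eventually_mono) simp
    next
      case False
      then show ?thesis by (intro always_eventually) auto
    qed
  qed
  have a: "\<forall>\<^sub>F x in nhds x0. \<forall>u\<in>V. \<forall>v\<in>V. \<forall>w\<in>V. (u - v) \<bullet> (w - v) < cos \<omega> * (norm (u - v) * norm (w - v)) \<longrightarrow>
      (h x u - h x v) \<bullet> (h x w - h x v) < cos \<omega> * (norm (h x u - h x v) * norm (h x w - h x v))"
  proof (intro eventually_ball_finite fin ballI)
    fix u v w
    show "\<forall>\<^sub>F x in nhds x0. (u - v) \<bullet> (w - v) < cos \<omega> * (norm (u - v) * norm (w - v)) \<longrightarrow>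
      (h x u - h x v) \<bullet> (h x w - h x v) < cos \<omega> * (norm (h x u - h x v) * norm (h x w - h x v))"
    proof (cases "(u - v) \<bullet> (w - v) < cos \<omega> * (norm (u - v) * norm (w - v))")
      case True
      have "((\<lambda>x. cos \<omega> * (norm (h x u - h x v) * norm (h x w - h x v)) - (h x u - h x v) \<bullet> (h x w - h x v))
          \<longlongrightarrow> cos \<omega> * (norm (u - v) * norm (w - v)) - (u - v) \<bullet> (w - v)) (nhds x0)"
        by (intro tendsto_diff tendsto_inner tendsto_mult tendsto_norm tendsto_const; rule h)
      then have "\<forall>\<^sub>F x in nhds x0. 0 < cos \<omega> * (norm (h x u - h x v) * norm (h x w - h x v)) - (h x u - h x v) \<bullet> (h x w - h x v)"
        by (rule order_tendstoD(1)) (use True in simp)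
      then show ?thesis by (rule eventually_mono) simp
    next
      case False
      then show ?thesis by (intro always_eventually) auto
    qed
  qed
  have g: "\<forall>\<^sub>F x in nhds x0. \<forall>a\<in>V. \<forall>b\<in>V. \<forall>c\<in>V. \<forall>d\<in>V. edge V a b \<and> edge V c d \<longrightarrow>
      cr (cis \<omega> * (h x b - h x a)) (h x d - h x c) \<noteq> 0"
  proof (intro eventually_ball_finite fin ballI)
    fix a b c d
    show "\<forall>\<^sub>F x in nhds x0. edge V a b \<and> edge V c d \<longrightarrow> cr (cis \<omega> * (h x b - h x a)) (h x d - h x c) \<noteq> 0"
    proof (cases "edge V a b \<and> edge V c d")
      case True
      then have "cr (cis \<omega> * (b - a)) (d - c) \<noteq> 0" using P(2) by (auto simp: generic_def)
      moreover have "((\<lambda>x. cr (cis \<omega> * (h x b - h x a)) (h x d - h x c)) \<longlongrightarrow> cr (cis \<omega> * (b - a)) (d - c)) (nhds x0)"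
        by (intro tendsto_cr tendsto_diff tendsto_mult tendsto_const; rule h)
      ultimately have "\<forall>\<^sub>F x in nhds x0. cr (cis \<omega> * (h x b - h x a)) (h x d - h x c) \<noteq> 0"
        using tendsto_imp_eventually_ne by blast
      then show ?thesis by (rule eventually_mono) simp
    next
      case False
      then show ?thesis by (intro always_eventually) auto
    qed
  qed
  show ?thesis
    using new e a g
  proof eventually_elim
    case (elim x)
    let ?V = "insert x (V - {x0})"
    have V: "?V = h x ` V" using x0 by (auto simp: h_def)
    have inj: "h x v = h x w \<longleftrightarrow> v = w" if "v \<in> V" "w \<in> V" for v w
      using elim(1) that by (auto simp: h_def)
    have E: "edge ?V (h x c) (h x d)" if "edge V c d" for c d
      unfolding V edge_def using elim(2) edgeD[OF that] inj that by auto
    have card: "card ?V = card V"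
      unfolding V by (intro card_image inj_onI) (use inj in blast)
    have G: "convex_gon \<omega> ?V"
      unfolding convex_gon_def
    proof (intro conjI ballI)
      show "finite ?V" using fin by simp
      show "3 \<le> card ?V" unfolding card by (rule convex_gonD(2)[OF P(1)])
      fix w assume "w \<in> ?V"
      then obtain v where v: "w = h x v" "v \<in> V" unfolding V by blast
      obtain a b where ab: "edge V a v" "edge V v b"
        "(a - v) \<bullet> (b - v) < cos \<omega> * (norm (a - v) * norm (b - v))" using convex_gonD(4)[OF P(1) v(2)] by blast
      then have "(h x a - h x v) \<bullet> (h x b - h x v) < cos \<omega> * (norm (h x a - h x v) * norm (h x b - h x v))"
        using elim(3) edgeD(1,2) by blast
      then show "\<exists>a b. edge ?V a w \<and> edge ?V w b \<and> (a - w) \<bullet> (b - w) < cos \<omega> * (norm (a - w) * norm (b - w))"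
        using E ab v by blast
    qed
    have E': "\<exists>c d. edge V c d \<and> u = h x c \<and> w = h x d" if uw: "edge ?V u w" for u w
    proof -
      obtain c where c: "u = h x c" "c \<in> V" using edgeD(1)[OF uw] unfolding V by blast
      obtain d where d: "edge V c d" using convex_gonD(4)[OF P(1) c(2)] by blast
      then have "w = h x d" using edge_out_unique[OF uw] E c by metis
      then show ?thesis using c d by blast
    qed
    have "generic \<omega> ?V"
      unfolding generic_def
    proof (intro allI impI)
      fix a b c d assume "edge ?V a b" "edge ?V c d"
      then obtain a' b' c' d' where "edge V a' b'" "edge V c' d'" "a = h x a'" "b = h x b'" "c = h x c'" "d = h x d'"
        using E' by meson
      then show "cr (cis \<omega> * (b - a)) (d - c) \<noteq> 0" using elim(4) edgeD(1,2) by blast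
    qed
    then show ?case using G card by blast
  qed
qed

section \<open>Polygons that share two vertices\<close>

context wedge_angle
begin

text \<open>\<open>P1\<close> and \<open>P2\<close> are meant as the contacts of the first probe,
  and \<open>G\<close> as an open region in which the other vertices may move without affecting its
  answer. Vertices on both sides of the line \<open>P1P2\<close> keep that pair from being an
  edge.\<close>

definition in_family :: "complex set \<Rightarrow> complex \<Rightarrow> complex \<Rightarrow> complex set \<Rightarrow> bool" where
  "in_family G P1 P2 V \<longleftrightarrow> convex_gon \<omega> V \<and> generic \<omega> V \<and> P1 \<in> V \<and> P2 \<in> V \<and> V - {P1, P2} \<subseteq> G \<and>
     (\<exists>v\<in>V - {P1, P2}. 0 < cr (P2 - P1) (v - P1)) \<and> (\<exists>v\<in>V - {P1, P2}. cr (P2 - P1) (v - P1) < 0)"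

lemma in_family_not_edge:
  assumes "in_family G P1 P2 V" "edge V c d"
  shows "{c, d} \<noteq> {P1, P2}"
proof
  assume "{c, d} = {P1, P2}"
  obtain v w where v: "v \<in> V" "0 < cr (P2 - P1) (v - P1)" and w: "w \<in> V" "cr (P2 - P1) (w - P1) < 0"
    using assms(1) unfolding in_family_def by blast
  have sw: "cr (P1 - P2) (v - P2) = - cr (P2 - P1) (v - P1)" by (simp add: cr_def algebra_simps)
  consider "c = P1" "d = P2" | "c = P2" "d = P1"
    using \<open>{c, d} = {P1, P2}\<close> by (auto simp: doubleton_eq_iff)
  then show False
  proof cases
    case 1
    then show False using edge_nonneg[OF assms(2) w(1)] w(2) by simp
  next
    case 2
    then show False using edge_nonneg[OF assms(2) v(1)] v(2) sw by simp
  qed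
qed

lemma in_family_move:
  assumes F: "in_family G P1 P2 V" and G: "open G" and x0: "x0 \<in> V - {P1, P2}"
  shows "\<forall>\<^sub>F x in nhds x0. in_family G P1 P2 (insert x (V - {x0})) \<and> card (insert x (V - {x0})) = card V"
proof -
  have P: "convex_gon \<omega> V" "generic \<omega> V" using F by (auto simp: in_family_def)
  have neg: "cr (P1 - P2) y = - cr (P2 - P1) y" for y by (simp add: cr_def algebra_simps)
  obtain v w where v: "v \<in> V - {P1, P2}" "0 < cr (P2 - P1) (v - P1)"
    and w: "w \<in> V - {P1, P2}" "0 < cr (P1 - P2) (w - P1)"
    using F unfolding in_family_def neg by auto
  have "x0 \<in> G" using F x0 by (auto simp: in_family_def)
  then have g: "\<forall>\<^sub>F x in nhds x0. x \<in> G" using G by (intro eventually_nhds_in_open)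
  have ne: "\<forall>\<^sub>F x in nhds x0. x \<in> - {P1, P2}" using x0 by (intro eventually_nhds_in_open) auto
  have pos: "\<forall>\<^sub>F x in nhds x0. z = x0 \<longrightarrow> 0 < cr u (x - P1)" if "0 < cr u (z - P1)" for z u
    using eventually_nhds_cr_pos[of u x0 P1] that by (cases "z = x0") auto
  have "x0 \<in> V" using x0 by blast
  show ?thesis
    using move_vertex[OF P \<open>x0 \<in> V\<close>] g ne pos[OF v(2)] pos[OF w(2)]
  proof eventually_elim
    case (elim x)
    have "\<exists>v\<in>insert x (V - {x0}) - {P1, P2}. 0 < cr (P2 - P1) (v - P1)"
    proof (cases "v = x0")
      case True
      then show ?thesis using elim by auto
    next
      case False
      then show ?thesis using v by auto
    qed
    moreover have "\<exists>v\<in>insert x (V - {x0}) - {P1, P2}. cr (P2 - P1) (v - P1) < 0"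
    proof (cases "w = x0")
      case True
      then show ?thesis using elim by (auto simp: neg)
    next
      case False
      then show ?thesis using w by (auto simp: neg)
    qed
    ultimately show ?case using elim(1,2) F x0 unfolding in_family_def by auto
  qed
qed

text \<open>The vertices other than \<open>P1\<close> and \<open>P2\<close> are made generic one after the other; \<open>U\<close> is the set of
  those already treated.\<close>

lemma in_family_untouched_aux:
  assumes G: "open G" and nz: "snd L \<noteq> 0"
    and F: "in_family G P1 P2 V" and U: "U \<subseteq> V" "P1 \<in> U" "P2 \<in> U"
    and off: "\<And>x. x \<in> U - {P1, P2} \<Longrightarrow> x \<notin> line_pts L"
    and good: "\<And>x y z. x \<in> U \<Longrightarrow> y \<in> U \<Longrightarrow> z \<in> U \<Longrightarrow> x \<noteq> y \<Longrightarrow> z \<noteq> x \<Longrightarrow> z \<noteq> y \<Longrightarrow>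
       {x, y} \<noteq> {P1, P2} \<Longrightarrow> \<not> wedge_through \<omega> L x y z"
  shows "\<exists>V'. in_family G P1 P2 V' \<and> card V' = card V \<and> (\<forall>x y z. x \<in> V' \<longrightarrow> y \<in> V' \<longrightarrow> z \<in> V' \<longrightarrow> x \<noteq> y \<longrightarrow>
     z \<noteq> x \<longrightarrow> z \<noteq> y \<longrightarrow> {x, y} \<noteq> {P1, P2} \<longrightarrow> \<not> wedge_through \<omega> L x y z)"
  using F U off good
proof (induction "card (V - U)" arbitrary: V U rule: less_induct)
  case (less V U)
  note F = less.prems(1) and U = less.prems(2-4) and off = less.prems(5) and good = less.prems(6)
  have fin: "finite V" using F convex_gonD(1) by (auto simp: in_family_def)
  show ?case
  proof (cases "V = U")
    case True
    then show ?thesis using F good by blast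
  next
    case False
    then obtain x0 where x0: "x0 \<in> V" "x0 \<notin> U" using U by blast
    have finU: "finite U" using U fin finite_subset by blast
    define N1 where "N1 = (\<Union>(c, w)\<in>U \<times> U. {x. wedge_through \<omega> L c x w})"
    define N2 where "N2 = (\<Union>(c, d)\<in>{(c, d)\<in>U \<times> U. c \<noteq> d \<and> \<not> (c \<in> line_pts L \<and> d \<in> line_pts L)}. {x. wedge_through \<omega> L c d x})"
    have "finite {(c, d)\<in>U \<times> U. c \<noteq> d \<and> \<not> (c \<in> line_pts L \<and> d \<in> line_pts L)}"
      by (rule finite_subset[of _ "U \<times> U"]) (use finU in auto)
    then have "negligible (N1 \<union> N2)"
      unfolding N1_def N2_def using finU negligible_wedge_through_side[OF nz] negligible_wedge_through_opposite[OF nz]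
      by (intro negligible_Un negligible_UN) auto
    moreover have "negligible (line_pts L)"
    proof (rule negligible_subset[OF negligible_cr_line[OF nz, of "fst L"]])
      show "line_pts L \<subseteq> {x. cr (snd L) (x - fst L) = 0}" by (auto simp: line_pts_def cr_of_real)
    qed
    ultimately have neg: "negligible (N1 \<union> N2 \<union> line_pts L)" by (rule negligible_Un)
    obtain S where S: "open S" "x0 \<in> S"
      "\<And>x. x \<in> S \<Longrightarrow> in_family G P1 P2 (insert x (V - {x0})) \<and> card (insert x (V - {x0})) = card V"
      using in_family_move[OF F G, of x0] x0 U unfolding eventually_nhds by auto
    have "\<not> S \<subseteq> N1 \<union> N2 \<union> line_pts L"
      using open_not_negligible[of S] S neg negligible_subset by blast
    then obtain x where x: "x \<in> S" "x \<notin> N1" "x \<notin> N2" "x \<notin> line_pts L" by blast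
    let ?V = "insert x (V - {x0})" and ?U = "insert x U"
    have FV: "in_family G P1 P2 ?V" "card ?V = card V" using S(3)[OF x(1)] by auto
    have UV: "?U \<subseteq> ?V" using U x0 by auto
    have xU: "x \<notin> V - {x0}"
    proof
      assume "x \<in> V - {x0}"
      then have "card ?V = card (V - {x0})" by (simp add: insert_absorb)
      also have "\<dots> < card V" using x0 fin by (rule_tac card_Diff1_less)
      finally show False using FV(2) by simp
    qed
    have "?V - ?U = (V - U) - {x0}" using xU x0 U by auto
    also have "card \<dots> < card (V - U)" using x0 fin by (intro card_Diff1_less) auto
    finally have lt: "card (?V - ?U) < card (V - U)" .
    have g': "\<not> wedge_through \<omega> L u v w"
      if uv: "u \<in> ?U" "v \<in> ?U" "w \<in> ?U" "u \<noteq> v" "w \<noteq> u" "w \<noteq> v" "{u, v} \<noteq> {P1, P2}" for u v w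
    proof -
      consider "u = x" | "v = x" | "w = x" | "u \<noteq> x" "v \<noteq> x" "w \<noteq> x" by blast
      then show ?thesis
      proof cases
        case 1
        then have "\<not> wedge_through \<omega> L v x w" using x(2) uv unfolding N1_def by auto
        then show ?thesis using 1 wedge_through_commute by blast
      next
        case 2
        then show ?thesis using x(2) uv unfolding N1_def by auto
      next
        case 3
        then have "u \<in> U" "v \<in> U" using uv by auto
        \<comment> \<open>\<open>P1\<close> and \<open>P2\<close> may both lie on \<open>L\<close>,
          but all other treated vertices are off it. Any other pair thus has a point off
          \<open>L\<close>, as the null set \<open>N2\<close> requires.\<close>
        moreover have "u \<notin> {P1, P2} \<or> v \<notin> {P1, P2}" using uv by auto
        ultimately have "\<not> (u \<in> line_pts L \<and> v \<in> line_pts L)" using off by blast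
        then show ?thesis using x(3) 3 uv \<open>u \<in> U\<close> \<open>v \<in> U\<close> unfolding N2_def by auto
      next
        case 4
        then show ?thesis using good[of u v w] uv by blast
      qed
    qed
    have "P1 \<in> ?U" "P2 \<in> ?U" using U by auto
    moreover have "y \<notin> line_pts L" if "y \<in> ?U - {P1, P2}" for y using that off x(4) by blast
    ultimately show ?thesis using less.hyps[OF lt FV(1) UV _ _ _ g'] FV(2) by simp
  qed
qed

text \<open>The one pair that generic position cannot handle is \<open>P1\<close>,
  \<open>P2\<close>, and it is not an edge.\<close>

lemma in_family_untouched:
  assumes "open G" "in_family G P1 P2 V"
  shows "\<exists>V'. in_family G P1 P2 V' \<and> card V' = card V \<and> (\<forall>a b. edge V' a b \<longrightarrow> \<not> touched \<omega> V' L a b)"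
proof (cases "snd L = 0")
  case True
  then have "\<not> touched \<omega> V L a b" for a b
    using assms(2) probe_forward(2)[of V L] unfolding touched_def in_family_def by blast
  then show ?thesis using assms by blast
next
  case False
  have V: "P1 \<in> V" "P2 \<in> V" using assms(2) by (auto simp: in_family_def)
  have "\<exists>V'. in_family G P1 P2 V' \<and> card V' = card V \<and> (\<forall>x y z. x \<in> V' \<longrightarrow> y \<in> V' \<longrightarrow> z \<in> V' \<longrightarrow> x \<noteq> y \<longrightarrow>
     z \<noteq> x \<longrightarrow> z \<noteq> y \<longrightarrow> {x, y} \<noteq> {P1, P2} \<longrightarrow> \<not> wedge_through \<omega> L x y z)"
    by (rule in_family_untouched_aux[OF assms(1) False assms(2), of "{P1, P2}"]) (use V in auto)
  then obtain V' where V': "in_family G P1 P2 V'" "card V' = card V"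
    "\<And>x y z. x \<in> V' \<Longrightarrow> y \<in> V' \<Longrightarrow> z \<in> V' \<Longrightarrow> x \<noteq> y \<Longrightarrow> z \<noteq> x \<Longrightarrow> z \<noteq> y \<Longrightarrow>
       {x, y} \<noteq> {P1, P2} \<Longrightarrow> \<not> wedge_through \<omega> L x y z"
    by blast
  have P: "convex_gon \<omega> V'" using V'(1) by (simp add: in_family_def)
  have "\<not> touched \<omega> V' L a b" if e: "edge V' a b" for a b
  proof
    assume t: "touched \<omega> V' L a b"
    note eD = edgeD[OF e]
    obtain w where "w \<in> V'" "w \<noteq> a" "w \<noteq> b" "wedge_through \<omega> L a b w"
      using touched_witness[OF P t eD(1,2)] by metis
    then show False using V'(3)[OF eD(1,2) _ eD(3)] in_family_not_edge[OF V'(1) e] by blast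
  qed
  then show ?thesis using V' by blast
qed

end


section \<open>Initial polygons and the lower bound\<close>

text \<open>The last condition puts the other vertices strictly inside the wedge that is symmetric about the
  real axis and has the corners \<open>\<plusminus>\<i>h\<close> on its rays.\<close>

definition kite :: "real \<Rightarrow> complex set \<Rightarrow> real \<Rightarrow> bool" where
  "kite \<omega> Q h \<longleftrightarrow> convex_gon \<omega> Q \<and> generic \<omega> Q \<and> 0 < h \<and> Complex 0 h \<in> Q \<and> Complex 0 (- h) \<in> Q \<and>
     (\<exists>v\<in>Q. Re v < 0) \<and> (\<exists>v\<in>Q. 0 < Re v) \<and>
     (\<forall>v\<in>Q - {Complex 0 h, Complex 0 (- h)}. 0 < cos (\<omega> / 2) * (h - \<bar>Im v\<bar>) + sin (\<omega> / 2) * Re v)"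

section \<open>The square and the pentagon\<close>

lemma edgeI:
  assumes "a \<in> V" "b \<in> V" "a \<noteq> b" "\<And>v. v \<in> V \<Longrightarrow> v = a \<or> v = b \<or> 0 < cr (b - a) (v - a)"
  shows "edge V a b"
  using assms unfolding edge_def by blast

text \<open>Angles and turns between edges are multiples of a right angle, so an acute \<omega>
  makes the angle condition and genericity hold. At \<open>-1\<close> the last condition of
  \<open>kite\<close> reads \<open>sin (\<omega> / 2) < cos (\<omega> / 2)\<close>: the wedge
  through \<open>\<i>\<close> and \<open>-\<i>\<close> has its apex at
  \<open>- cot (\<omega> / 2)\<close>, left of \<open>-1\<close>.\<close>

lemma kite_square:
  assumes "0 < \<omega>" "\<omega> < pi / 2"
  shows "kite \<omega> {1, \<i>, -1, -\<i>} 1" "card {1, \<i>, -1, -\<i>} = 4"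
proof -
  let ?Q = "{1, \<i>, -1, -\<i>}"
  have c: "0 < cos \<omega>" "0 < sin \<omega>" using assms by (auto intro!: cos_gt_zero sin_gt_zero)
  show card: "card ?Q = 4" by (simp add: complex_eq_iff)
  have e: "edge ?Q 1 \<i>" "edge ?Q \<i> (-1)" "edge ?Q (-1) (-\<i>)" "edge ?Q (-\<i>) 1"
    by (rule edgeI; auto simp: cr_def complex_eq_iff)+
  have E: "(a, b) \<in> {(1, \<i>), (\<i>, -1), (-1, -\<i>), (-\<i>, 1)}" if "edge ?Q a b" for a b
    using edgeD(1)[OF that] edge_out_unique[OF that] e by auto
  have "convex_gon \<omega> ?Q"
    unfolding convex_gon_def
  proof (intro conjI ballI)
    show "3 \<le> card ?Q" unfolding card by simp
    fix v assume "v \<in> ?Q"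
    then consider "v = 1" | "v = \<i>" | "v = -1" | "v = -\<i>" by auto
    then show "\<exists>a b. edge ?Q a v \<and> edge ?Q v b \<and> (a - v) \<bullet> (b - v) < cos \<omega> * (norm (a - v) * norm (b - v))"
    proof cases
      case 1
      show ?thesis unfolding 1
        by (rule exI[of _ "-\<i>"], rule exI[of _ \<i>]) (use e c in \<open>auto simp: inner_complex_def complex_eq_iff\<close>)
    next
      case 2
      show ?thesis unfolding 2
        by (rule exI[of _ 1], rule exI[of _ "-1"]) (use e c in \<open>auto simp: inner_complex_def complex_eq_iff\<close>)
    next
      case 3
      show ?thesis unfolding 3
        by (rule exI[of _ \<i>], rule exI[of _ "-\<i>"]) (use e c in \<open>auto simp: inner_complex_def complex_eq_iff\<close>)
    next
      case 4
      show ?thesis unfolding 4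
        by (rule exI[of _ "-1"], rule exI[of _ 1]) (use e c in \<open>auto simp: inner_complex_def complex_eq_iff\<close>)
    qed
  qed simp
  moreover have "generic \<omega> ?Q"
    unfolding generic_def
  proof (intro allI impI)
    fix a b c' d assume "edge ?Q a b" "edge ?Q c' d"
    from E[OF this(1)] E[OF this(2)] show "cr (cis \<omega> * (b - a)) (d - c') \<noteq> 0"
      using c by (auto simp: cr_def)
  qed
  moreover have "sin (\<omega> / 2) < cos (\<omega> / 2)"
  proof -
    have "sin (\<omega> / 2) < sin (pi / 2 - \<omega> / 2)" using assms by (intro sin_monotone_2pi) auto
    then show ?thesis by (simp add: cos_sin_eq)
  qed
  moreover have "0 < sin (\<omega> / 2)" using assms by (intro sin_gt_zero) auto
  ultimately show "kite \<omega> ?Q 1" unfolding kite_def by (auto simp: complex_eq_iff)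
qed

text \<open>The tip \<open>-2\<close> lies to the right of \<open>-3\<close>, the apex of the
  right-angled wedge through the corners \<open>Complex 0 3\<close> and
  \<open>Complex 0 (-3)\<close>. Being closer to the origin than these corners, it also has an
  obtuse angle. The remaining coordinates make all other angles obtuse and no two edges
  perpendicular.\<close>

lemma kite_pentagon:
  defines "Q \<equiv> {-2, Complex 0 (-3), Complex 3 (-2), Complex 3 2, Complex 0 3}"
  shows "kite (pi / 2) Q 3" "card Q = 5"
proof -
  show card: "card Q = 5" by (simp add: Q_def complex_eq_iff)
  have e: "edge Q (-2) (Complex 0 (-3))" "edge Q (Complex 0 (-3)) (Complex 3 (-2))"
    "edge Q (Complex 3 (-2)) (Complex 3 2)" "edge Q (Complex 3 2) (Complex 0 3)" "edge Q (Complex 0 3) (-2)"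
    unfolding Q_def by (rule edgeI; auto simp: cr_def complex_eq_iff)+
  have E: "(a, b) \<in> {(-2, Complex 0 (-3)), (Complex 0 (-3), Complex 3 (-2)),
      (Complex 3 (-2), Complex 3 2), (Complex 3 2, Complex 0 3), (Complex 0 3, -2)}" if "edge Q a b" for a b
    using edgeD(1)[OF that] edge_out_unique[OF that] e unfolding Q_def by auto
  have "convex_gon (pi / 2) Q"
    unfolding convex_gon_def
  proof (intro conjI ballI)
    show "finite Q" by (simp add: Q_def)
    show "3 \<le> card Q" unfolding card by simp
    have *: "\<exists>a b. edge Q a v \<and> edge Q v b \<and> (a - v) \<bullet> (b - v) < cos (pi / 2) * (norm (a - v) * norm (b - v))"
      if "edge Q a v" "edge Q v b" "(a - v) \<bullet> (b - v) < 0" for a b v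
      using that by auto
    fix v assume "v \<in> Q"
    then consider "v = -2" | "v = Complex 0 (-3)" | "v = Complex 3 (-2)" | "v = Complex 3 2" | "v = Complex 0 3"
      by (auto simp: Q_def)
    then show "\<exists>a b. edge Q a v \<and> edge Q v b \<and> (a - v) \<bullet> (b - v) < cos (pi / 2) * (norm (a - v) * norm (b - v))"
    proof cases
      case 1
      show ?thesis unfolding 1 by (rule *[OF e(5,1)]) (simp add: inner_complex_def)
    next
      case 2
      show ?thesis unfolding 2 by (rule *[OF e(1,2)]) (simp add: inner_complex_def)
    next
      case 3
      show ?thesis unfolding 3 by (rule *[OF e(2,3)]) (simp add: inner_complex_def)
    next
      case 4
      show ?thesis unfolding 4 by (rule *[OF e(3,4)]) (simp add: inner_complex_def)
    next
      case 5
      show ?thesis unfolding 5 by (rule *[OF e(4,5)]) (simp add: inner_complex_def)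
    qed
  qed
  moreover have "generic (pi / 2) Q"
    unfolding generic_def
  proof (intro allI impI)
    fix a b c d assume "edge Q a b" "edge Q c d"
    from E[OF this(1)] E[OF this(2)] show "cr (cis (pi / 2) * (b - a)) (d - c) \<noteq> 0"
      by (auto simp: cr_def)
  qed
  moreover have "0 < cos (pi / 2 / 2) * (3 - \<bar>Im v\<bar>) + sin (pi / 2 / 2) * Re v"
    if "v \<in> Q - {Complex 0 3, Complex 0 (- 3)}" for v
  proof -
    have "0 < 3 - \<bar>Im v\<bar> + Re v" using that by (auto simp: Q_def)
    then have "0 < sqrt 2 / 2 * (3 - \<bar>Im v\<bar> + Re v)" by simp
    moreover have "cos (pi / 2 / 2) = sqrt 2 / 2" "sin (pi / 2 / 2) = sqrt 2 / 2"
      using cos_45 sin_45 by simp_all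
    ultimately show ?thesis by (simp only: distrib_left)
  qed
  moreover have "Complex 0 3 \<in> Q" "Complex 0 (- 3) \<in> Q"
    by (simp_all add: Q_def)
  moreover have "\<exists>v\<in>Q. Re v < 0" by (rule bexI[of _ "-2"]) (simp_all add: Q_def)
  moreover have "\<exists>v\<in>Q. 0 < Re v" by (rule bexI[of _ "Complex 3 2"]) (simp_all add: Q_def)
  ultimately show "kite (pi / 2) Q 3" unfolding kite_def by (intro conjI ballI) simp_all
qed

section \<open>The first two probes\<close>

context wedge_angle
begin

text \<open>The first probe either misses a small scaled copy of the kite, or meets it along its axis and
  is answered by the two corners \<open>P1\<close> and \<open>P2\<close>.\<close>

lemma first_probe_answer:
  assumes K: "kite \<omega> Q h" and \<rho>: "0 < \<rho>"
  shows "\<exists>k G ans. k \<noteq> 0 \<and> norm k < \<rho> \<and> open G \<and>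
    in_family G (k * Complex 0 (- h)) (k * Complex 0 h) ((*) k ` Q) \<and>
    (\<forall>V. in_family G (k * Complex 0 (- h)) (k * Complex 0 h) V \<longrightarrow>
       probe_result \<omega> (convex hull V) L = ans \<and> (\<forall>a b. edge V a b \<longrightarrow> \<not> touched \<omega> V L a b))"
proof -
  obtain l \<delta> where L: "L = (l, \<delta>)" by (cases L)
  have Q: "convex_gon \<omega> Q" "generic \<omega> Q" "0 < h" "Complex 0 h \<in> Q" "Complex 0 (- h) \<in> Q"
    using K by (auto simp: kite_def)
  obtain v1 v2 where v12: "v1 \<in> Q" "Re v1 < 0" "v2 \<in> Q" "0 < Re v2" using K by (auto simp: kite_def)
  have fam: "in_family G (k * Complex 0 (- h)) (k * Complex 0 h) ((*) k ` Q)"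
    if k: "k \<noteq> 0" and G: "(*) k ` Q - {k * Complex 0 (- h), k * Complex 0 h} \<subseteq> G" for k G
  proof -
    have c: "cr (k * Complex 0 h - k * Complex 0 (- h)) (k * v - k * Complex 0 (- h)) = - ((norm k)\<^sup>2 * (2 * h * Re v))" for v
      unfolding right_diff_distrib[symmetric] cr_mult_left by (simp add: cr_def)
    have nk: "0 < (norm k)\<^sup>2" using k by simp
    have ne: "v1 \<noteq> Complex 0 h" "v1 \<noteq> Complex 0 (- h)" "v2 \<noteq> Complex 0 h" "v2 \<noteq> Complex 0 (- h)"
      using v12 by auto
    have in1: "k * v1 \<in> (*) k ` Q - {k * Complex 0 (- h), k * Complex 0 h}"
      and in2: "k * v2 \<in> (*) k ` Q - {k * Complex 0 (- h), k * Complex 0 h}"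
      using v12(1,3) ne mult_left_cancel[OF k] by (blast)+
    have "2 * h * Re v1 < 0" "0 < 2 * h * Re v2"
      using v12 Q(3) by (simp_all add: mult_less_0_iff)
    note mult_pos_neg[OF nk this(1)] mult_pos_pos[OF nk this(2)]
    then have c1: "0 < cr (k * Complex 0 h - k * Complex 0 (- h)) (k * v1 - k * Complex 0 (- h))"
      and c2: "cr (k * Complex 0 h - k * Complex 0 (- h)) (k * v2 - k * Complex 0 (- h)) < 0"
      by (simp_all only: c neg_0_less_iff_less neg_less_0_iff_less)
    have "\<exists>v\<in>(*) k ` Q - {k * Complex 0 (- h), k * Complex 0 h}.
         0 < cr (k * Complex 0 h - k * Complex 0 (- h)) (v - k * Complex 0 (- h))"
      by (rule bexI[where x = "k * v1"]) (rule c1 in1)+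
    moreover have "\<exists>v\<in>(*) k ` Q - {k * Complex 0 (- h), k * Complex 0 h}.
         cr (k * Complex 0 h - k * Complex 0 (- h)) (v - k * Complex 0 (- h)) < 0"
      by (rule bexI[where x = "k * v2"]) (rule c2 in2)+
    moreover have "k * Complex 0 (- h) \<in> (*) k ` Q" "k * Complex 0 h \<in> (*) k ` Q" using Q(4,5) by blast+
    ultimately show ?thesis
      unfolding in_family_def using convex_gon_scale[OF k Q(1)] generic_scale[OF k Q(2)] G by (intro conjI)
  qed
  have miss: "probe_result \<omega> (convex hull V) L = Miss \<and> (\<forall>a b. edge V a b \<longrightarrow> \<not> touched \<omega> V L a b)"
    if "\<And>q d. \<not> valid_probe \<omega> (convex hull V) L q d" for V
    using that by (auto simp: probe_result_def touched_def)
  \<comment> \<open>For a nonzero direction, \<open>cr \<delta> l = 0\<close> says that the line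
    passes through the origin, the midpoint of the two corners.\<close>
  consider "\<delta> = 0" | "\<delta> \<noteq> 0" "cr \<delta> l \<noteq> 0" | "\<delta> \<noteq> 0" "cr \<delta> l = 0" by blast
  then show ?thesis
  proof cases
    case 1
    have "probe_result \<omega> (convex hull V) L = Miss \<and> (\<forall>a b. edge V a b \<longrightarrow> \<not> touched \<omega> V L a b)"
      if "in_family UNIV P1 P2 V" for V P1 P2
      by (rule miss) (use that probe_forward(2)[of V L] 1 L in \<open>auto simp: in_family_def\<close>)
    then show ?thesis using fam[of "of_real (\<rho> / 2)" UNIV] \<rho>
      by (intro exI[of _ "of_real (\<rho> / 2)"] exI[of _ UNIV] exI[of _ Miss]) auto
  next
    case 2
    \<comment> \<open>The orientation is chosen so that the origin lies strictly to the left of the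
      line. That side serves as \<open>G\<close>, and a small copy about the origin fits into
      it.\<close>
    define \<delta>' where "\<delta>' = (if cr \<delta> l < 0 then \<delta> else - \<delta>)"
    have \<delta>': "\<delta>' = snd L \<or> \<delta>' = - snd L" "0 < cr \<delta>' (0 - l)"
      using 2 by (auto simp: \<delta>'_def L cr_minus)
    define G where "G = {x. 0 < cr \<delta>' (x - l)}"
    have "G = {x. (Complex (- Im \<delta>') (Re \<delta>')) \<bullet> x > cr \<delta>' l}"
      by (auto simp: G_def cr_def inner_complex_def algebra_simps)
    then have G: "open G" by (simp add: open_halfspace_gt)
    have "\<forall>\<^sub>F x in nhds 0. x \<in> G" using \<delta>'(2) G by (intro eventually_nhds_in_open) (auto simp: G_def)
    then obtain \<epsilon> where \<epsilon>: "0 < \<epsilon>" "ball 0 \<epsilon> \<subseteq> G"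
      unfolding eventually_nhds_metric by (auto simp: subset_eq dist_commute)
    have "bounded Q" using convex_gonD(1)[OF Q(1)] by (simp add: finite_imp_bounded)
    then obtain B where B: "0 < B" "\<And>v. v \<in> Q \<Longrightarrow> norm v \<le> B" by (auto simp: bounded_pos)
    define t where "t = min (\<rho> / 2) (\<epsilon> / (2 * B))"
    have t: "0 < t" "t < \<rho>" "t * B < \<epsilon>"
    proof -
      show "0 < t" "t < \<rho>" using \<rho> \<epsilon> B by (auto simp: t_def min_def)
      have "t * B \<le> \<epsilon> / (2 * B) * B" using B by (intro mult_right_mono) (auto simp: t_def)
      also have "\<dots> < \<epsilon>" using B \<epsilon> by simp
      finally show "t * B < \<epsilon>" .
    qed
    have sub: "of_real t * v \<in> G" if "v \<in> Q" for v
    proof -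
      have "norm (of_real t * v) \<le> t * B" using B(2)[OF that] t by (simp add: norm_mult)
      then have "of_real t * v \<in> ball 0 \<epsilon>" using t(3) by simp
      then show ?thesis using \<epsilon> by blast
    qed
    have "probe_result \<omega> (convex hull V) L = Miss \<and> (\<forall>a b. edge V a b \<longrightarrow> \<not> touched \<omega> V L a b)"
      if V: "in_family G (of_real t * Complex 0 (- h)) (of_real t * Complex 0 h) V" for V
    proof (rule miss)
      have "V \<subseteq> G" using V sub Q(4,5) by (auto simp: in_family_def)
      then show "\<not> valid_probe \<omega> (convex hull V) L q d" for q d
        by (intro no_valid_probe_off_line[OF \<delta>'(1)]) (auto simp: G_def L)
    qed
    then show ?thesis using fam[of "of_real t" G] t G sub
      by (intro exI[of _ "of_real t"] exI[of _ G] exI[of _ Miss]) auto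
  next
    case 3
    \<comment> \<open>The copy is turned so that the axis of the kite points along the line.\<close>
    define k' where "k' = \<delta> / of_real (norm \<delta>)"
    have k': "norm k' = 1" using 3 by (simp add: k'_def norm_divide)
    define k where "k = of_real (\<rho> / 2) * k'"
    have nk: "norm k = \<rho> / 2" using k' \<rho> by (simp add: k_def norm_mult)
    have k0: "k \<noteq> 0" using nk \<rho> by auto
    define co si where "co = cos (\<omega> / 2)" and "si = sin (\<omega> / 2)"
    have co: "0 < co" "0 < si"
      using pos le pi_gt_zero unfolding co_def si_def by (auto intro!: cos_gt_zero sin_gt_zero)
    \<comment> \<open>With half opening angle \<open>\<omega> / 2\<close>, a symmetric wedge has the
      corners at height \<open>h\<close> on its rays exactly if its apex is
      \<open>h * cot (\<omega> / 2)\<close> behind them along the axis.\<close>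
    define \<tau> where "\<tau> = h * co / si"
    have \<tau>: "0 < \<tau>" "si * \<tau> = h * co" using co Q(3) by (simp_all add: \<tau>_def)
    define d q where "d = k' * cis (- \<omega> / 2)" and "q = k * of_real (- \<tau>)"
    have d: "norm d = 1" using k' by (simp add: d_def norm_mult)
    have e: "cis \<omega> * d = k' * cis (\<omega> / 2)"
    proof -
      have "cis \<omega> * d = k' * (cis \<omega> * cis (- \<omega> / 2))" by (simp only: d_def mult_ac)
      then show ?thesis by (simp add: cis_mult)
    qed
    define s where "s = \<tau> * (\<rho> / 2) / norm \<delta>"
    have s: "0 \<le> s" using \<tau> \<rho> by (simp add: s_def)
    have qs: "q = - (of_real s * \<delta>)" by (simp add: q_def k_def k'_def s_def)
    have kv: "k * v - q = k' * (of_real (\<rho> / 2) * (v + of_real \<tau>))" for v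
      by (simp add: k_def q_def algebra_simps)
    have c1: "cr d (k * v - q) = \<rho> / 2 * (co * (h + Im v) + si * Re v)" for v
    proof -
      have "cr d (k * v - q) = \<rho> / 2 * cr (cis (- \<omega> / 2)) (v + of_real \<tau>)"
        unfolding kv d_def cr_mult_left k' cr_of_real by simp
      also have "cr (cis (- \<omega> / 2)) (v + of_real \<tau>) = co * Im v + si * Re v + si * \<tau>"
        by (simp add: cr_def co_def si_def algebra_simps)
      finally show ?thesis unfolding \<tau>(2) by (simp add: algebra_simps)
    qed
    have c2: "cr (k * v - q) (cis \<omega> * d) = \<rho> / 2 * (co * (h - Im v) + si * Re v)" for v
    proof -
      have "cr (k * v - q) (cis \<omega> * d) = \<rho> / 2 * cr (v + of_real \<tau>) (cis (\<omega> / 2))"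
        unfolding kv e cr_mult_left k' cr_of_real by simp
      also have "cr (v + of_real \<tau>) (cis (\<omega> / 2)) = si * Re v - co * Im v + si * \<tau>"
        by (simp add: cr_def co_def si_def algebra_simps)
      finally show ?thesis unfolding \<tau>(2) by (simp add: algebra_simps)
    qed
    define G where "G = {x. 0 < cr d (x - q)} \<inter> {x. 0 < cr (x - q) (cis \<omega> * d)}"
    have "{x. 0 < cr d (x - q)} = {x. (Complex (- Im d) (Re d)) \<bullet> x > cr d q}"
      by (auto simp: cr_def inner_complex_def algebra_simps)
    moreover have "{x. 0 < cr (x - q) w} = {x. (Complex (Im w) (- Re w)) \<bullet> x > cr q w}" for w
      by (auto simp: cr_def inner_complex_def algebra_simps)
    ultimately have G: "open G" unfolding G_def by (auto simp: open_halfspace_gt)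
    define P1 P2 where "P1 = k * Complex 0 (- h)" and "P2 = k * Complex 0 h"
    have inG: "k * v \<in> G" if "v \<in> Q" "v \<noteq> Complex 0 h" "v \<noteq> Complex 0 (- h)" for v
    proof -
      have "0 < co * (h - \<bar>Im v\<bar>) + si * Re v" using K that by (auto simp: kite_def co_def si_def)
      moreover have "co * (h - \<bar>Im v\<bar>) \<le> co * (h + Im v)" "co * (h - \<bar>Im v\<bar>) \<le> co * (h - Im v)"
        using co by (auto intro!: mult_left_mono)
      ultimately show ?thesis using \<rho> unfolding G_def c1 c2 by (simp add: c1 c2)
    qed
    then have F0: "in_family G P1 P2 ((*) k ` Q)"
      unfolding P1_def P2_def by (intro fam k0) auto
    have P1: "cr d (P1 - q) = 0" "0 < cr (P1 - q) (cis \<omega> * d)"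
      and P2: "0 < cr d (P2 - q)" "cr (P2 - q) (cis \<omega> * d) = 0"
      unfolding P1_def P2_def c1 c2 using \<rho> co Q(3) by auto
    have main: "probe_result \<omega> (convex hull V) L = Hit q (ray q d) (ray q (cis \<omega> * d)) P1 P2 \<and>
        (\<forall>a b. edge V a b \<longrightarrow> \<not> touched \<omega> V L a b)" if V: "in_family G P1 P2 V" for V
    proof -
      have gV: "convex_gon \<omega> V" and PV: "P1 \<in> V" "P2 \<in> V" and VG: "V - {P1, P2} \<subseteq> G"
        using V by (auto simp: in_family_def)
      have fin: "finite V" using convex_gonD(1)[OF gV] .
      have W: "0 \<le> cr d (v - q)" "0 \<le> cr (v - q) (cis \<omega> * d)" if "v \<in> V" for v
        using that VG P1 P2 by (cases "v = P1 \<or> v = P2"; force simp: G_def)+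
      have on1: "v = P1" if "v \<in> V" "cr d (v - q) = 0" for v
        using that VG P2 by (cases "v = P2"; force simp: G_def)
      have on2: "v = P2" if "v \<in> V" "cr (v - q) (cis \<omega> * d) = 0" for v
        using that VG P1 by (cases "v = P1"; force simp: G_def)
      have r1: "P1 \<in> ray q d" using ray1_iff[OF d] P1 by simp
      have r2: "P2 \<in> ray q (cis \<omega> * d)" using ray2_iff[OF d] P2 by simp
      \<comment> \<open>\<open>P1\<close> and \<open>P2\<close> belong to every member of the
        family, so the line meets each member at least in their midpoint.\<close>
      have "0 = (1/2) *\<^sub>R P1 + (1/2) *\<^sub>R P2"
        by (simp add: P1_def P2_def complex_eq_iff scaleR_conv_of_real)
      then have "0 \<in> convex hull V"
        using convexD[OF convex_convex_hull, of P1 V P2 "1/2" "1/2"] PV hull_inc[of _ V convex] by auto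
      moreover have "0 \<in> ray q (snd L)"
      proof -
        have "0 = q + of_real s * snd L" by (simp add: qs L)
        then show ?thesis unfolding ray_def using s by blast
      qed
      moreover have "q \<in> line_pts L"
      proof -
        obtain t where t: "l = of_real t * \<delta>" using cr_eq_0_cases[OF 3(2,1)] .
        have "q = l + of_real (- s - t) * \<delta>" by (simp add: qs t algebra_simps)
        then show ?thesis unfolding line_pts_def L fst_conv snd_conv by blast
      qed
      ultimately have v: "valid_probe \<omega> (convex hull V) L q d"
        unfolding valid_probe_hull_iff[OF fin] using d W wedge_iff[OF d] r1 r2 PV by blast
      have cl1: "closest (convex hull V) q (ray q d) = P1"
      proof -
        have "x = P1" if x: "x \<in> convex hull V" "x \<in> ray q d" for x
        proof -
          have "x \<in> convex hull {v \<in> V. cr d (v - q) = 0}"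
            using x ray1_iff[OF d] by (intro hull_cr_face fin W) auto
          also have "\<dots> \<subseteq> convex hull {P1}" using on1 by (intro hull_mono) auto
          finally show ?thesis by simp
        qed
        then have "convex hull V \<inter> ray q d = {P1}" using r1 hull_inc[OF PV(1), of convex] by blast
        then show ?thesis unfolding closest_def by auto
      qed
      have sw: "cr (- (cis \<omega> * d)) w = cr w (cis \<omega> * d)" for w
        using cr_swap[of w "cis \<omega> * d"] by (simp add: cr_minus)
      have cl2: "closest (convex hull V) q (ray q (cis \<omega> * d)) = P2"
      proof -
        have "x = P2" if x: "x \<in> convex hull V" "x \<in> ray q (cis \<omega> * d)" for x
        proof -
          have "x \<in> convex hull {v \<in> V. cr (- (cis \<omega> * d)) (v - q) = 0}"
            by (intro hull_cr_face fin) (use x ray2_iff[OF d, of x q] sw W in auto)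
          also have "\<dots> \<subseteq> convex hull {P2}" using on2 sw by (intro hull_mono) auto
          finally show ?thesis by simp
        qed
        then have "convex hull V \<inter> ray q (cis \<omega> * d) = {P2}" using r2 hull_inc[OF PV(2), of convex] by blast
        then show ?thesis unfolding closest_def by auto
      qed
      have "\<not> touched \<omega> V L a b" if e: "edge V a b" for a b
      proof
        assume "touched \<omega> V L a b"
        then have "a \<in> ray q d \<and> b \<in> ray q d \<or> a \<in> ray q (cis \<omega> * d) \<and> b \<in> ray q (cis \<omega> * d)"
          unfolding touched_def using valid_probe_unique[OF gV v] by metis
        then have "a = b" using on1 on2 edgeD(1,2)[OF e] ray1_iff[OF d] ray2_iff[OF d] by metis
        then show False using edgeD(3)[OF e] by simp
      qed
      then show ?thesis using probe_result_Hit[OF gV v] cl1 cl2 by simp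
    qed
    show ?thesis
      by (rule exI[of _ k], rule exI[of _ G], rule exI[of _ "Hit q (ray q d) (ray q (cis \<omega> * d)) P1 P2"])
        (use k0 nk \<rho> G F0 main in \<open>auto simp: P1_def P2_def\<close>)
  qed
qed

end

context correct_prober
begin

text \<open>The empty history fixes the first line, whose answer \<open>a1\<close> is the same for
  the whole family. The second line \<open>L2\<close> is thus known before a member of the family
  has to be chosen.\<close>

lemma evades_two:
  assumes K: "kite \<omega> Q h" and p0: "p = 0" "c = 0"
  shows "\<exists>V. admissible V \<and> card V = card Q \<and> evades V 2"
proof -
  have Q: "convex_gon \<omega> Q" using K by (simp add: kite_def)
  have "bounded Q" using convex_gonD(1)[OF Q] by (simp add: finite_imp_bounded)
  then obtain B where B: "0 < B" "\<And>v. v \<in> Q \<Longrightarrow> norm v \<le> B" by (auto simp: bounded_pos)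
  have small: "(*) k ` Q \<subseteq> ball 0 r" if "norm k < r / B" for k
  proof
    fix x assume "x \<in> (*) k ` Q"
    then obtain v where v: "x = k * v" "v \<in> Q" by blast
    have "norm x \<le> norm k * B" unfolding v norm_mult using B(2)[OF v(2)] by (intro mult_left_mono) auto
    also have "\<dots> < r" using that B(1) by (simp add: pos_less_divide_eq)
    finally show "x \<in> ball 0 r" by simp
  qed
  have rB: "0 < r / B" using B r_pos by simp
  have mid: "0 \<in> convex hull V" if "in_family G (k * Complex 0 (- h)) (k * Complex 0 h) V" for G k V
  proof -
    have "0 = (1/2) *\<^sub>R (k * Complex 0 (- h)) + (1/2) *\<^sub>R (k * Complex 0 h)"
      by (simp add: complex_eq_iff scaleR_conv_of_real)
    moreover have "k * Complex 0 (- h) \<in> convex hull V" "k * Complex 0 h \<in> convex hull V"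
      using that hull_inc[of _ V convex] by (auto simp: in_family_def)
    ultimately show ?thesis
      using convexD[OF convex_convex_hull, of "k * Complex 0 (- h)" V "k * Complex 0 h" "1/2" "1/2"] by auto
  qed
  have adm: "admissible V" if "in_family G (k * Complex 0 (- h)) (k * Complex 0 h) V" "V \<subseteq> ball 0 r" for G k V
  proof -
    have "convex_gon \<omega> V" "generic \<omega> V" using that(1) by (simp_all add: in_family_def)
    then show ?thesis unfolding admissible_def using mid[OF that(1)] that(2) p0 by simp
  qed
  have start: "\<exists>L. \<sigma> p c r [] = Inl L"
  proof -
    \<comment> \<open>Any line serves here: a small admissible copy suffices to show that the
      strategy cannot stop at once.\<close>
    obtain k G where k: "norm k < r / B" "in_family G (k * Complex 0 (- h)) (k * Complex 0 h) ((*) k ` Q)"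
      using first_probe_answer[OF K rB] by blast
    have V: "admissible ((*) k ` Q)" using adm[OF k(2)] small[OF k(1)] by blast
    then have "convex_gon \<omega> ((*) k ` Q)" by (simp add: admissible_def)
    then obtain a b where "edge ((*) k ` Q) a b" by (rule convex_gon_edge_exists)
    then have "isl (ans ((*) k ` Q) 0)" using cannot_stop[OF V, of a b 0] by simp
    then show ?thesis by (simp add: isl_def)
  qed
  then obtain L1 where L1: "\<sigma> p c r [] = Inl L1" by blast
  obtain k G a1 where k: "k \<noteq> 0" "norm k < r / B" and G: "open G"
    and F: "in_family G (k * Complex 0 (- h)) (k * Complex 0 h) ((*) k ` Q)"
    and a1: "\<And>V. in_family G (k * Complex 0 (- h)) (k * Complex 0 h) V \<Longrightarrow>
       probe_result \<omega> (convex hull V) L1 = a1 \<and> (\<forall>a b. edge V a b \<longrightarrow> \<not> touched \<omega> V L1 a b)"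
    using first_probe_answer[OF K rB, of L1] by blast
  \<comment> \<open>Moved vertices must also stay inside the disk known to the prober.\<close>
  define G' where "G' = G \<inter> ball 0 r"
  have G': "open G'" using G by (simp add: G'_def open_Int)
  have F': "in_family G' (k * Complex 0 (- h)) (k * Complex 0 h) ((*) k ` Q)"
    using F small[OF k(2)] unfolding in_family_def G'_def by blast
  have sub: "in_family G (k * Complex 0 (- h)) (k * Complex 0 h) V" "V \<subseteq> ball 0 r"
    if "in_family G' (k * Complex 0 (- h)) (k * Complex 0 h) V" for V
  proof -
    show "in_family G (k * Complex 0 (- h)) (k * Complex 0 h) V"
      using that unfolding in_family_def G'_def by blast
    have "k * Complex 0 (- h) \<in> ball 0 r" "k * Complex 0 h \<in> ball 0 r"
      using F small[OF k(2)] unfolding in_family_def by blast+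
    then show "V \<subseteq> ball 0 r" using that unfolding in_family_def G'_def by blast
  qed
  have run1: "run \<omega> \<sigma> (convex hull V) p c r 1 = [a1]"
    if "in_family G' (k * Complex 0 (- h)) (k * Complex 0 h) V" for V
    using L1 a1[OF sub(1)[OF that]] by simp
  have V0: "admissible ((*) k ` Q)" using adm[OF sub[OF F']] .
  then have "convex_gon \<omega> ((*) k ` Q)" by (simp add: admissible_def)
  then obtain a b where ab: "edge ((*) k ` Q) a b" by (rule convex_gon_edge_exists)
  have "isl (ans ((*) k ` Q) 1)"
    by (rule cannot_stop[OF V0 ab, of 1 "\<lambda>_. L1"]) (use L1 a1[OF F] ab in auto)
  then obtain L2 where L2: "\<sigma> p c r [a1] = Inl L2" unfolding run1[OF F'] by (auto simp: isl_def)
  obtain V where V: "in_family G' (k * Complex 0 (- h)) (k * Complex 0 h) V" "card V = card ((*) k ` Q)"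
    "\<And>a b. edge V a b \<Longrightarrow> \<not> touched \<omega> V L2 a b"
    using in_family_untouched[OF G' F'] by metis
  have "evades V 2"
    unfolding evades_def
  proof (intro allI impI)
    fix j :: nat assume "j < 2"
    then consider "j = 0" | "j = 1" by linarith
    then show "\<exists>L. ans V j = Inl L \<and> (\<forall>a b. edge V a b \<longrightarrow> \<not> touched \<omega> V L a b)"
    proof cases
      case 1
      then show ?thesis using L1 a1[OF sub(1)[OF V(1)]] by auto
    next
      case 2
      then show ?thesis using L2 V(3) run1[OF V(1)] by auto
    qed
  qed
  moreover have "card V = card Q" using V(2) k(1) by (simp add: card_image inj_on_def)
  ultimately show ?thesis using adm[OF sub[OF V(1)]] by blast
qed

end

theorem theorem4p5:
  shows "(\<forall>\<omega> \<sigma> n. 0 < \<omega> \<and> \<omega> < pi / 2 \<and> correct_strategy \<omega> \<sigma> \<and> 5 \<le> n \<longrightarrow>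
            (\<exists>K p c r. convex_polygon_angles_gt \<omega> K n \<and> p \<in> K \<and> 0 < r \<and> K \<subseteq> cball c r \<and>
                       makes_at_least \<omega> \<sigma> K p c r (2 * n - 2)))
       \<and> (\<forall>\<sigma> n. correct_strategy (pi / 2) \<sigma> \<and> 5 \<le> n \<longrightarrow>
            (\<exists>K p c r. convex_polygon_angles_gt (pi / 2) K n \<and> p \<in> K \<and> 0 < r \<and> K \<subseteq> cball c r \<and>
                       makes_at_least (pi / 2) \<sigma> K p c r (2 * n - 3)))"
proof -
  have main: "\<exists>K p c r. convex_polygon_angles_gt \<omega> K n \<and> p \<in> K \<and> 0 < r \<and> K \<subseteq> cball c r \<and>
      makes_at_least \<omega> \<sigma> K p c r (2 + (n - card Q) + n)"
    if h: "0 < \<omega>" "\<omega> \<le> pi / 2" "correct_strategy \<omega> \<sigma>" "kite \<omega> Q y" "card Q \<le> n" for \<omega> \<sigma> n Q y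
  proof -
    \<comment> \<open>The prober is told the common centre of all kites and the unit circle about
      it.\<close>
    interpret correct_prober \<omega> \<sigma> 0 0 1 by unfold_locales (use h in auto)
    obtain V where V: "admissible V" "card V = card Q" "evades V 2"
      using evades_two[OF h(4)] by blast
    then show ?thesis using evades_many_probes[OF V(1,3), of n] h(5) by metis
  qed
  show ?thesis
  proof (intro conjI allI impI)
    fix \<omega> :: real and \<sigma> :: strategy and n :: nat
    assume a: "0 < \<omega> \<and> \<omega> < pi / 2 \<and> correct_strategy \<omega> \<sigma> \<and> 5 \<le> n"
    \<comment> \<open>Two initial probes without a touched edge, one more for each of the
      \<open>n - 4\<close> insertions, and one probe for each of the \<open>n\<close> edges.\<close>
    then have "2 + (n - card {1, \<i>, -1, -\<i>}) + n = 2 * n - 2" using kite_square(2)[of \<omega>] by auto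
    then show "\<exists>K p c r. convex_polygon_angles_gt \<omega> K n \<and> p \<in> K \<and> 0 < r \<and> K \<subseteq> cball c r \<and>
        makes_at_least \<omega> \<sigma> K p c r (2 * n - 2)"
      using main[of \<omega> \<sigma> _ 1 n, OF _ _ _ kite_square(1)] kite_square(2)[of \<omega>] a by auto
  next
    fix \<sigma> :: strategy and n :: nat
    assume a: "correct_strategy (pi / 2) \<sigma> \<and> 5 \<le> n"
    then have "2 + (n - 5) + n = 2 * n - 3" by auto
    then show "\<exists>K p c r. convex_polygon_angles_gt (pi / 2) K n \<and> p \<in> K \<and> 0 < r \<and> K \<subseteq> cball c r \<and>
        makes_at_least (pi / 2) \<sigma> K p c r (2 * n - 3)"
      using main[OF _ _ _ kite_pentagon(1), of \<sigma> n] kite_pentagon(2) a pi_gt_zero by auto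
  qed
qed

end
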